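(* Let $\mathscr{T}$ be a hierarchical T-mesh with $V^+$ crossing vertices, $E$ interior l-edges and $\delta-1$ isolated subdivided cells. Suppose there are $F_{\mathscr{G}}$ cells in its crossing-vertex-relationship graph $\mathscr{G}$. Then $$V^+-E+\delta=F_{\mathscr{G}}.$$
   Context: A T-mesh is a rectangular grid that allows T-junctions: a region is subdivided by finitely many horizontal and vertical segments into finitely many closed axis-parallel rectangles (the cells) with pairwise disjoint interiors. It is regular if the region $\Omega$ occupied by all its cells is a rectangle; all T-meshes here are regular. Vertices are the grid points (corners of cells); a vertex on $\partial\Omega$ is a boundary vertex, and an interior vertex is a crossing vertex if four edges meet there and a T-vertex if exactly three edges meet there. A T-vertex is horizontal if exactly one of its three edges is horizontal, and vertical if exactly one of them is vertical. Edges are the segments joining adjacent vertices; an edge is interior if it does not lie on $\partial\Omega$. A horizontal (vertical) l-edge is a continuous line segment consisting of horizontal (vertical) interior edges whose two endpoints are boundary vertices or horizontal (vertical) T-vertices, i.e. a longest possible line segment in the mesh. The boundary consists of four boundary l-edges; all other l-edges are interior l-edges. Hierarchical T-mesh: start from a tensor-product mesh (full rectangular grid), the level-$0$ mesh, whose cells have level $0$. The level-$(k+1)$ mesh is obtained from the level-$k$ mesh by choosing some cells of level $k$ and subdividing each into four subcells (which are cells of level $k+1$) by joining the midpoints of opposite edges with two straight segments. A mesh obtained after finitely many levels is a (classical) hierarchical T-mesh. The term "hierarchical T-mesh" refers both to these classical meshes and to their extensions. Extension (associated with the space of $C^{1,1}$ piecewise biquadratic splines over the mesh): take a tensor-product mesh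 $\mathscr{M}$ with $6$ vertical and $6$ horizontal lines whose central rectangle is the region occupied by the mesh; all edges of the mesh with an endpoint on its boundary are extended (straight) to reach the boundary of $\mathscr{M}$; the extension consists of $\mathscr{M}$, the mesh, and these extended segments. Isolated subdivided cell: when passing from level $k$ to level $k+1$ in forming the hierarchical T-mesh, a cell of level $k$ that is subdivided while all its horizontally and vertically neighboring cells of level $k$ remain unchanged. (For an extension, the level-$k$ mesh is the extension, with the same $\mathscr{M}$, of the level-$k$ mesh of the original; the neighboring cells outside the original rectangle are included among the neighboring cells, and such a cell counts as changed if it is cut by an extended segment.) Crossing-vertex-relationship graph (CVR graph) $\mathscr{G}$ of $\mathscr{T}$: the plane graph obtained by keeping all crossing vertices of $\mathscr{T}$ and the line segments of the mesh with two endpoints being crossing vertices, and removing all other vertices and edges of $\mathscr{T}$ (so its vertices are the crossing vertices, and its edges join consecutive crossing vertices on the same l-edge). Its cells are its bounded faces, i.e. the bounded connected components of the complement of $\mathscr{G}$ in the plane.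
   Formalization: For classical (non-extended) hierarchical T-meshes the initial tensor-product mesh is required to have an interior line in each direction (at least 2×2 cells); for a single cell the formula fails (0−0+1≠0), as for a row of n≥3 cells. Rows of two cells, where it holds, are also left out. *)

theory Defs
  imports "HOL-Analysis.Analysis"
begin

section \<open>Meshes as finite sets of cells\<close>

text \<open>A cell is given by its lower left and its upper right corner.\<close>

type_synonym cell = "(real \<times> real) \<times> (real \<times> real)"

definition rect :: "cell \<Rightarrow> (real \<times> real) set" where
  "rect c = cbox (fst c) (snd c)"

definition corners :: "cell \<Rightarrow> (real \<times> real) set" where
  "corners c = {fst (fst c), fst (snd c)} \<times> {snd (fst c), snd (snd c)}"

definition region :: "cell set \<Rightarrow> (real \<times> real) set" where
  "region T = (\<Union>c\<in>T. rect c)"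

definition skeleton :: "cell set \<Rightarrow> (real \<times> real) set" where
  "skeleton T = (\<Union>c\<in>T. frontier (rect c))"

definition vertices :: "cell set \<Rightarrow> (real \<times> real) set" where
  "vertices T = (\<Union>c\<in>T. corners c)"

definition boundary_vertices :: "cell set \<Rightarrow> (real \<times> real) set" where
  "boundary_vertices T = vertices T \<inter> frontier (region T)"

definition interior_vertices :: "cell set \<Rightarrow> (real \<times> real) set" where
  "interior_vertices T = vertices T \<inter> interior (region T)"

text \<open>An edge contains no vertices besides its two endpoints, so the edges meeting at a vertex
  are exactly the edges containing it.\<close>

definition h_edges :: "cell set \<Rightarrow> (real \<times> real) set set" where
  "h_edges T = {closed_segment (a, y) (b, y) | a b y.
     a < b \<and> (a, y) \<in> vertices T \<and> (b, y) \<in> vertices T \<and>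
     closed_segment (a, y) (b, y) \<subseteq> skeleton T \<and>
     open_segment (a, y) (b, y) \<inter> vertices T = {}}"

definition v_edges :: "cell set \<Rightarrow> (real \<times> real) set set" where
  "v_edges T = {closed_segment (x, a) (x, b) | x a b.
     a < b \<and> (x, a) \<in> vertices T \<and> (x, b) \<in> vertices T \<and>
     closed_segment (x, a) (x, b) \<subseteq> skeleton T \<and>
     open_segment (x, a) (x, b) \<inter> vertices T = {}}"

definition edges :: "cell set \<Rightarrow> (real \<times> real) set set" where
  "edges T = h_edges T \<union> v_edges T"

definition interior_edge :: "cell set \<Rightarrow> (real \<times> real) set \<Rightarrow> bool" where
  "interior_edge T e \<longleftrightarrow> e \<in> edges T \<and> \<not> e \<subseteq> frontier (region T)"

definition crossing_vertices :: "cell set \<Rightarrow> (real \<times> real) set" where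
  "crossing_vertices T = {v \<in> interior_vertices T. card {e \<in> edges T. v \<in> e} = 4}"

definition T_vertices :: "cell set \<Rightarrow> (real \<times> real) set" where
  "T_vertices T = {v \<in> interior_vertices T. card {e \<in> edges T. v \<in> e} = 3}"

definition h_T_vertices :: "cell set \<Rightarrow> (real \<times> real) set" where
  "h_T_vertices T = {v \<in> T_vertices T. card {e \<in> h_edges T. v \<in> e} = 1}"

definition v_T_vertices :: "cell set \<Rightarrow> (real \<times> real) set" where
  "v_T_vertices T = {v \<in> T_vertices T. card {e \<in> v_edges T. v \<in> e} = 1}"

text \<open>The l-edges below consist of interior edges, so the four boundary l-edges are not among
  them.\<close>

definition h_l_edges :: "cell set \<Rightarrow> (real \<times> real) set set" where
  "h_l_edges T = {closed_segment (a, y) (b, y) | a b y.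
     a < b \<and>
     (a, y) \<in> boundary_vertices T \<union> h_T_vertices T \<and>
     (b, y) \<in> boundary_vertices T \<union> h_T_vertices T \<and>
     (\<exists>A \<subseteq> {e \<in> h_edges T. interior_edge T e}. closed_segment (a, y) (b, y) = \<Union>A)}"

definition v_l_edges :: "cell set \<Rightarrow> (real \<times> real) set set" where
  "v_l_edges T = {closed_segment (x, a) (x, b) | x a b.
     a < b \<and>
     (x, a) \<in> boundary_vertices T \<union> v_T_vertices T \<and>
     (x, b) \<in> boundary_vertices T \<union> v_T_vertices T \<and>
     (\<exists>A \<subseteq> {e \<in> v_edges T. interior_edge T e}. closed_segment (x, a) (x, b) = \<Union>A)}"

definition interior_l_edges :: "cell set \<Rightarrow> (real \<times> real) set set" where
  "interior_l_edges T = h_l_edges T \<union> v_l_edges T"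

section \<open>The crossing-vertex-relationship graph\<close>

text \<open>An edge of the graph joins two consecutive crossing vertices of one l-edge; it may pass
  through T-vertices, which are forgotten. Since each of the four boundary l-edges contains no
  crossing vertex, only interior l-edges matter.\<close>

definition cvr_edges :: "cell set \<Rightarrow> (real \<times> real) set set" where
  "cvr_edges T = {closed_segment p q | p q.
     p \<noteq> q \<and> p \<in> crossing_vertices T \<and> q \<in> crossing_vertices T \<and>
     (\<exists>l \<in> interior_l_edges T. p \<in> l \<and> q \<in> l) \<and>
     open_segment p q \<inter> crossing_vertices T = {}}"

definition cvr_graph :: "cell set \<Rightarrow> (real \<times> real) set" where
  "cvr_graph T = crossing_vertices T \<union> \<Union>(cvr_edges T)"

definition cvr_cells :: "cell set \<Rightarrow> (real \<times> real) set set" where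
  "cvr_cells T = {C \<in> components (- cvr_graph T). bounded C}"

section \<open>Hierarchical T-meshes\<close>

definition tensor_mesh :: "real list \<Rightarrow> real list \<Rightarrow> cell set" where
  "tensor_mesh xs ys = {((xs ! i, ys ! j), (xs ! Suc i, ys ! Suc j)) | i j.
     Suc i < length xs \<and> Suc j < length ys}"

definition subcells :: "cell \<Rightarrow> cell set" where
  "subcells c = (let (a, b) = c; m = midpoint a b in
     {(a, m), ((fst m, snd a), (fst b, snd m)), ((fst a, snd m), (fst m, snd b)), (m, b)})"

text \<open>\<open>S k\<close> is the set of cells of level \<open>k\<close> that are subdivided when passing from level \<open>k\<close> to
  level \<open>k + 1\<close>.\<close>

primrec level_cells :: "real list \<Rightarrow> real list \<Rightarrow> (nat \<Rightarrow> cell set) \<Rightarrow> nat \<Rightarrow> cell set" where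
  "level_cells xs ys S 0 = tensor_mesh xs ys"
| "level_cells xs ys S (Suc k) = (\<Union>c\<in>S k. subcells c)"

primrec level_mesh :: "real list \<Rightarrow> real list \<Rightarrow> (nat \<Rightarrow> cell set) \<Rightarrow> nat \<Rightarrow> cell set" where
  "level_mesh xs ys S 0 = tensor_mesh xs ys"
| "level_mesh xs ys S (Suc k) = (level_mesh xs ys S k - S k) \<union> (\<Union>c\<in>S k. subcells c)"

definition grid_lines :: "real list \<Rightarrow> bool" where
  "grid_lines xs \<longleftrightarrow> 2 \<le> length xs \<and> sorted_wrt (<) xs"

definition subdivision_process ::
  "real list \<Rightarrow> real list \<Rightarrow> (nat \<Rightarrow> cell set) \<Rightarrow> nat \<Rightarrow> bool" where
  "subdivision_process xs ys S N \<longleftrightarrow>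
     grid_lines xs \<and> grid_lines ys \<and> (\<forall>k<N. S k \<subseteq> level_cells xs ys S k)"

definition neighbouring :: "cell \<Rightarrow> cell \<Rightarrow> bool" where
  "neighbouring c d \<longleftrightarrow> c \<noteq> d \<and> (\<exists>p q. p \<noteq> q \<and> rect c \<inter> rect d = closed_segment p q)"

section \<open>Extensions\<close>

text \<open>The frame is the tensor-product mesh with the six vertical lines \<open>u\<close> and the six horizontal
  lines \<open>v\<close>; its central rectangle is the region of the mesh.\<close>

definition extension_frame :: "real list \<Rightarrow> real list \<Rightarrow> real list \<Rightarrow> real list \<Rightarrow> bool" where
  "extension_frame u v xs ys \<longleftrightarrow>
     length u = 6 \<and> sorted_wrt (<) u \<and> u ! 2 = hd xs \<and> u ! 3 = last xs \<and>
     length v = 6 \<and> sorted_wrt (<) v \<and> v ! 2 = hd ys \<and> v ! 3 = last ys"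

text \<open>The cells outside the central rectangle: the cells of the frame at the four corners are left
  alone, and those below, above, left and right of the central rectangle are cut by the lines
  through the boundary vertices on the respective side, since each boundary vertex other than the
  four corners is an endpoint of an edge orthogonal to the boundary.\<close>

definition extension :: "real list \<Rightarrow> real list \<Rightarrow> cell set \<Rightarrow> cell set" where
  "extension u v T = T \<union>
     tensor_mesh (take 3 u) (take 3 v) \<union> tensor_mesh (take 3 u) (drop 3 v) \<union>
     tensor_mesh (drop 3 u) (take 3 v) \<union> tensor_mesh (drop 3 u) (drop 3 v) \<union>
     tensor_mesh (sorted_list_of_set {x. (x, v ! 2) \<in> vertices T}) (take 3 v) \<union>
     tensor_mesh (sorted_list_of_set {x. (x, v ! 3) \<in> vertices T}) (drop 3 v) \<union>
     tensor_mesh (take 3 u) (sorted_list_of_set {y. (u ! 2, y) \<in> vertices T}) \<union>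
     tensor_mesh (drop 3 u) (sorted_list_of_set {y. (u ! 3, y) \<in> vertices T})"

section \<open>Isolated subdivided cells\<close>

text \<open>A neighbouring cell remains unchanged if it is still a cell of the next mesh. For an
  extension, the neighbours to be considered include the cells outside the original region.\<close>

definition isolated_cells ::
  "real list \<Rightarrow> real list \<Rightarrow> (nat \<Rightarrow> cell set) \<Rightarrow> nat \<Rightarrow> cell set" where
  "isolated_cells xs ys S k = {c \<in> S k.
     \<forall>d \<in> level_cells xs ys S k. neighbouring c d \<longrightarrow> d \<in> level_mesh xs ys S (Suc k)}"

definition isolated_cells_ext ::
  "real list \<Rightarrow> real list \<Rightarrow> real list \<Rightarrow> real list \<Rightarrow> (nat \<Rightarrow> cell set) \<Rightarrow> nat \<Rightarrow> cell set" where
  "isolated_cells_ext u v xs ys S k = {c \<in> S k.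
     \<forall>d \<in> level_cells xs ys S k
            \<union> (extension u v (level_mesh xs ys S k) - level_mesh xs ys S k).
       neighbouring c d \<longrightarrow> d \<in> extension u v (level_mesh xs ys S (Suc k))}"

text \<open>\<open>hierarchical_T_mesh T i\<close>: \<open>T\<close> is a hierarchical T-mesh, obtained by a process with \<open>i\<close>
  isolated subdivided cells. If no extension takes place, the initial grid must have an interior
  line in each of the two directions: a single undivided cell has no crossing vertices, no
  interior l-edges, no isolated subdivided cells and a graph without cells, so
  \<open>0 - 0 + 1 \<noteq> 0\<close>, and a single row of \<open>n \<ge> 3\<close> cells gives \<open>0 - (n - 1) + 1 \<noteq> 0\<close>.\<close>

inductive hierarchical_T_mesh :: "cell set \<Rightarrow> nat \<Rightarrow> bool" where
  classical:
    "\<lbrakk>subdivision_process xs ys S N; 3 \<le> length xs; 3 \<le> length ys\<rbrakk> \<Longrightarrow>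
     hierarchical_T_mesh (level_mesh xs ys S N) (\<Sum>k<N. card (isolated_cells xs ys S k))"
| extended:
    "\<lbrakk>subdivision_process xs ys S N; extension_frame u v xs ys\<rbrakk> \<Longrightarrow>
     hierarchical_T_mesh (extension u v (level_mesh xs ys S N))
       (\<Sum>k<N. card (isolated_cells_ext u v xs ys S k))"

end

theory Submission
  imports Defs
begin

text \<open>Every crossing vertex lies on exactly one horizontal and on exactly one vertical l-edge, and every
interior l-edge of a hierarchical T-mesh carries a crossing vertex. An l-edge with \<open>n\<close> crossing
vertices contributes \<open>n - 1\<close> edges to the crossing-vertex-relationship graph, so this graph has
\<open>2 * V - E\<close> edges, where \<open>V\<close> is the number of crossing vertices and \<open>E\<close> the number of interior
l-edges. If \<open>C\<close> is the number of its connected components and \<open>F\<close> the number of its bounded faces,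
Euler's formula \<open>V - (2 * V - E) + F = C\<close> becomes \<open>V - E + C = F\<close> (\<open>tmesh_Euler\<close>). The
theorem therefore says that \<open>C\<close> exceeds the number of isolated subdivided cells by one.

Euler's formula is proved for straight-line graphs in the plane by adding the edges one at a time
(\<open>plane_graph_Euler\<close>). An edge between two components of the graph separates nothing, by Janiszewski's
theorem; an edge within a component cuts exactly one face into two: into at most two because the open
edge has only two sides, and into at least two by the Jordan curve theorem.

The components are counted level by level (\<open>card_classes\<close>). The full lines of the initial grid cross
each other, so initially there is one component. When cells of level \<open>k\<close> are subdivided, the new
crossing vertices are the centres of these cells and the midpoints of those of their sides that they
share with another subdivided cell; for an extension also the points where a midline, prolonged
into the frame, crosses lines of the frame. The old l-edges that
contain such sides (or border sides) of one cell all meet one and the same old component: every such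
side of a cell of level \<open>k > 0\<close> lies on a line that is linked to the centre of the parent of the cell
(\<open>root_exists\<close>). So subdividing never merges old components; the centre of a cell with a shared side
joins the old component belonging to that cell, and the centre of an isolated cell is a new component
of its own.

Two devices keep the case distinctions small. Horizontal and vertical segments are treated
simultaneously: a direction \<open>d :: bool\<close> is a parameter (\<open>True\<close> for horizontal). Classical
meshes and extensions are treated simultaneously as well: in both cases the horizontal (vertical)
edges form the union of the full lines of a large grid and of the midlines of the subdivided cells,
prolonged to the boundary of the large grid where the cell touches the boundary of the original region
(locale \<open>hier\<close>). In the classical case the large grid is the initial grid itself.\<close>

section \<open>Adding a segment to a compact plane set\<close>

text \<open>By Janiszewski's theorem, two points that neither of two compact sets with connected intersection
separates are not separated by the union. This applies twice, since the segment meets each of the two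
parts in a single point.\<close>

lemma components_Compl_Un_bridge:
  fixes K1 K2 :: "complex set"
  assumes K: "compact K1" "compact K2" "K1 \<inter> K2 = {}" and pq: "p \<in> K1" "q \<in> K2"
    and e: "closed_segment p q \<inter> (K1 \<union> K2) = {p, q}"
  shows "components (- (K1 \<union> K2 \<union> closed_segment p q)) =
      (\<lambda>C. C - closed_segment p q) ` components (- (K1 \<union> K2))"
    and "inj_on (\<lambda>C. C - closed_segment p q) (components (- (K1 \<union> K2)))"
proof -
  let ?e = "closed_segment p q" and ?K = "K1 \<union> K2"
  have comp: "compact ?e" "compact (K1 \<union> ?e)" "compact ?K"
    using K by (auto intro: compact_Un)
  have e1: "K1 \<inter> ?e = {p}" and e2: "(K1 \<union> ?e) \<inter> K2 = {q}"
    using e pq K(3) by auto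
  have nonsep: "connected (- ?e)"
    using connected_arc_complement[OF arc_linepath[of p q]] pq K(3) by auto
  have eq: "connected_component_set (- (?K \<union> ?e)) x = connected_component_set (- ?K) x - ?e"
    if x: "x \<notin> ?K" "x \<notin> ?e" for x
  proof
    show "connected_component_set (- (?K \<union> ?e)) x \<subseteq> connected_component_set (- ?K) x - ?e"
      using connected_component_mono[of "- (?K \<union> ?e)" "- ?K" x] connected_component_subset[of "- (?K \<union> ?e)" x]
      by blast
    show "connected_component_set (- ?K) x - ?e \<subseteq> connected_component_set (- (?K \<union> ?e)) x"
    proof
      fix y assume y: "y \<in> connected_component_set (- ?K) x - ?e"
      then have yK: "connected_component (- ?K) x y" and "y \<notin> ?e" by auto
      then have "connected_component (- ?e) x y"
        using nonsep x by (auto simp: connected_iff_connected_component)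
      moreover have c1: "connected_component (- K1) x y" and c2: "connected_component (- K2) x y"
        using connected_component_of_subset[OF yK] by auto
      ultimately have "connected_component (- (K1 \<union> ?e)) x y"
        using Janiszewski[of K1 ?e x y] K comp e1 by (simp add: compact_imp_closed)
      then have "connected_component (- ((K1 \<union> ?e) \<union> K2)) x y"
        using Janiszewski[of "K1 \<union> ?e" K2 x y] K comp e2 c2 by (simp add: compact_imp_closed)
      then show "y \<in> connected_component_set (- (?K \<union> ?e)) x"
        by (simp add: Int_ac)
    qed
  qed
  have open_K: "open (- ?K)" using comp(3) compact_imp_closed open_Compl by blast
  have thick: "\<exists>x\<in>C. x \<notin> ?e" if C: "C \<in> components (- ?K)" for C
  proof -
    have "open C" "C \<noteq> {}"
      using C open_components[OF open_K] in_components_nonempty by auto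
    then have "interior C \<noteq> {}" by (simp add: interior_open)
    moreover have "interior ?e = {}"
      by (rule interior_closed_segment_ge2) simp
    ultimately show ?thesis
      by (metis interior_mono subset_empty subsetI)
  qed
  show "components (- (?K \<union> ?e)) = (\<lambda>C. C - ?e) ` components (- ?K)"
  proof (intro equalityI subsetI)
    fix C assume "C \<in> components (- (?K \<union> ?e))"
    then obtain x where "x \<in> - (?K \<union> ?e)" "C = connected_component_set (- (?K \<union> ?e)) x"
      by (auto elim: componentsE)
    then show "C \<in> (\<lambda>C. C - ?e) ` components (- ?K)"
      using eq[of x] componentsI[of x "- ?K"] by blast
  next
    fix D assume "D \<in> (\<lambda>C. C - ?e) ` components (- ?K)"
    then obtain C where C: "C \<in> components (- ?K)" "D = C - ?e" by auto
    then obtain x where x: "x \<in> C" "x \<notin> ?e" using thick by blast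
    then have "C = connected_component_set (- ?K) x" "x \<notin> ?K"
      using C components_iff connected_component_eq in_components_subset by (smt (verit) ComplD in_components_subset subsetD mem_Collect_eq)+
    then show "D \<in> components (- (?K \<union> ?e))"
      using eq[of x] x C componentsI[of x "- (?K \<union> ?e)"] by auto
  qed
  show "inj_on (\<lambda>C. C - ?e) (components (- ?K))"
  proof (rule inj_onI)
    fix C D assume CD: "C \<in> components (- ?K)" "D \<in> components (- ?K)" "C - ?e = D - ?e"
    then obtain x where "x \<in> C" "x \<notin> ?e" using thick by blast
    then have "C \<inter> D \<noteq> {}" using CD by blast
    then show "C = D" using CD components_nonoverlap by blast
  qed
qed

text \<open>The arc in \<open>K\<close> and the segment together form a Jordan curve. The open segment lies in one face
\<open>U\<close> of \<open>K\<close>. Small half discs along one side of it all belong to the same face of the enlarged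
set, so \<open>U\<close> falls into at most two faces; and points on opposite sides of the segment are
separated by the Jordan curve.\<close>

lemma components_Compl_Un_chord:
  fixes K :: "complex set"
  assumes K: "compact K" and pq: "p \<noteq> q" and e: "closed_segment p q \<inter> K = {p, q}"
    and g: "arc g" "path_image g \<subseteq> K" "pathstart g = p" "pathfinish g = q"
  obtains U U1 U2 where "U \<in> components (- K)"
    "components (- (K \<union> closed_segment p q)) = (components (- K) - {U}) \<union> {U1, U2}"
    "U1 \<noteq> U2" "U1 \<notin> components (- K) - {U}" "U2 \<notin> components (- K) - {U}"
proof -
  \<comment> \<open>The coordinate along the segment: \<open>\<phi>\<close> maps the real interval from 0 to 1 onto it.\<close>
  define \<phi> where "\<phi> w = p + (q - p) * w" for w
  have cont: "continuous_on S \<phi>" for S unfolding \<phi>_def by (intro continuous_intros)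
  have \<phi>_inv: "\<phi> ((z - p) / (q - p)) = z" for z using pq by (simp add: \<phi>_def)
  have \<phi>_inj: "\<phi> w = \<phi> w' \<longleftrightarrow> w = w'" for w w' using pq by (simp add: \<phi>_def)
  have \<phi>_open: "open (\<phi> ` S)" if "open S" for S
  proof -
    have "\<phi> ` S = (\<lambda>z. (z - p) / (q - p)) -` S"
      using \<phi>_inv \<phi>_inj by (auto simp: image_iff) (metis \<phi>_inv)+
    moreover have "open ((\<lambda>z. (z - p) / (q - p)) -` S)"
      using that pq by (intro open_vimage continuous_intros) auto
    ultimately show ?thesis by simp
  qed
  let ?e = "closed_segment p q"
  define W where "W = - (K \<union> ?e)"
  have e_eq: "?e = (\<lambda>t. \<phi> (of_real t)) ` {0..1}"
    unfolding closed_segment_def \<phi>_def by (auto simp: scaleR_conv_of_real algebra_simps image_iff)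
  have e_in: "\<phi> w \<in> ?e \<longleftrightarrow> Im w = 0 \<and> 0 \<le> Re w \<and> Re w \<le> 1" for w
    unfolding e_eq using \<phi>_inj by (auto simp: image_iff complex_eq_iff intro!: bexI[of _ "Re w"])
  have notK: "\<phi> (of_real t) \<notin> K" if "0 < t" "t < 1" for t
  proof
    assume "\<phi> (of_real t) \<in> K"
    then have "\<phi> (of_real t) \<in> {p, q}" using e e_in[of "of_real t"] that by auto
    then show False using that pq \<phi>_inj[of "of_real t" 0] \<phi>_inj[of "of_real t" 1] by (auto simp: \<phi>_def)
  qed
  have "\<exists>r>0. r \<le> t \<and> r \<le> 1 - t \<and> (\<forall>w \<in> ball (of_real t) r. \<phi> w \<notin> K)" if t: "0 < t" "t < 1" for t
  proof -
    have "open (\<phi> -` (- K))" using cont K by (intro open_vimage) (auto simp: compact_imp_closed continuous_on_eq_continuous_at)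
    moreover have "of_real t \<in> \<phi> -` (- K)" using notK t by auto
    ultimately obtain r where "r > 0" "ball (of_real t) r \<subseteq> \<phi> -` (- K)"
      unfolding open_contains_ball by blast
    then show ?thesis using t by (intro exI[of _ "min r (min t (1 - t))"]) auto
  qed
  then obtain r where r: "\<And>t. 0 < t \<Longrightarrow> t < 1 \<Longrightarrow> r t > 0 \<and> r t \<le> t \<and> r t \<le> 1 - t \<and> (\<forall>w \<in> ball (of_real t) (r t). \<phi> w \<notin> K)"
    by metis
  define B where "B t = ball (of_real t :: complex) (r t)" for t
  have B_seg: "0 < Re w \<and> Re w < 1" if "w \<in> B t" "0 < t" "t < 1" for w t
  proof -
    have "\<bar>Re w - t\<bar> \<le> dist (of_real t) w"
      using abs_Re_le_cmod[of "of_real t - w"] by (simp add: dist_norm)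
    then show ?thesis using that r[of t] by (auto simp: B_def)
  qed
  have B_W: "\<phi> w \<in> W \<longleftrightarrow> Im w \<noteq> 0" if "w \<in> B t" "0 < t" "t < 1" for w t
    using B_seg[OF that] r[of t] that by (auto simp: W_def e_in B_def)
  \<comment> \<open>The open upper half plane for \<open>s = 1\<close> and the lower one for \<open>s = -1\<close>.\<close>
  define hplane :: "real \<Rightarrow> complex set" where "hplane s = {w. 0 < s * Im w}" for s
  have convB: "convex (B t \<inter> hplane s)" for t s
  proof -
    have "hplane s = {w. inner (s *\<^sub>R \<i>) w > 0}" by (auto simp: hplane_def inner_complex_def)
    then have "convex (hplane s)" by (metis convex_halfspace_gt)
    then show ?thesis unfolding B_def by (intro convex_Int) auto
  qed
  have conn: "connected (\<phi> ` (B t \<inter> hplane s))" for t s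
    using convB convex_connected cont connected_continuous_image by blast
  define pt :: "real \<Rightarrow> real \<Rightarrow> complex" where "pt s t = \<phi> (Complex t (s * r t / 2))" for s t
  have pt_in: "pt s t \<in> \<phi> ` (B t \<inter> hplane s)" if "0 < t" "t < 1" "\<bar>s\<bar> = 1" for s t
  proof -
    have "Complex t (s * r t / 2) \<in> B t"
    proof -
      have "dist (of_real t) (Complex t (s * r t / 2)) = \<bar>s * r t / 2\<bar>"
        by (simp add: dist_norm cmod_def complex_of_real_def)
      also have "\<dots> < r t" using r[of t] that by (simp add: abs_mult)
      finally show ?thesis by (simp add: B_def)
    qed
    moreover have "s * (s * r t) > 0"
    proof -
      have "s * s = 1" using that by (metis abs_mult_self_eq mult_1)
      then show ?thesis using r[of t] that by (simp flip: mult.assoc)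
    qed
    ultimately show ?thesis unfolding pt_def hplane_def by auto
  qed
  have sub: "\<phi> ` (B t \<inter> hplane s) \<subseteq> connected_component_set W (pt s t)" if "0 < t" "t < 1" "\<bar>s\<bar> = 1" for s t
    using B_W that conn pt_in by (intro connected_component_maximal) (auto simp: hplane_def)
  define cc where "cc s = connected_component_set W (pt s (1/2))" for s
  \<comment> \<open>The component of the half disc on one side does not change along the open segment.\<close>
  have cc: "connected_component_set W (pt s t) = cc s" if s: "\<bar>s\<bar> = 1" and t: "0 < t" "t < 1" for s t
  proof -
    have "\<forall>a\<in>{0<..<1}. \<forall>\<^sub>F b in at a within {0<..<1}. connected_component_set W (pt s a) = connected_component_set W (pt s b)"
    proof
      fix a :: real assume a: "a \<in> {0<..<1}"
      show "\<forall>\<^sub>F b in at a within {0<..<1}. connected_component_set W (pt s a) = connected_component_set W (pt s b)"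
        unfolding eventually_at
      proof (intro exI[of _ "r a / 2"] conjI ballI impI)
        show "0 < r a / 2" using r a by auto
        fix b :: real assume b: "b \<in> {0<..<1}" and "b \<noteq> a \<and> dist b a < r a / 2"
        then have ab: "\<bar>a - b\<bar> < r a / 2" by (auto simp: dist_real_def abs_minus_commute)
        define h where "h = min (r a) (r b) / 2"
        have h: "0 < h" "h \<le> r a / 2" "h \<le> r b / 2" using r a b by (auto simp: h_def)
        define w where "w = Complex b (s * h)"
        have "dist (of_real b) w = \<bar>s * h\<bar>" by (simp add: w_def dist_norm cmod_def complex_of_real_def)
        then have "dist (of_real b) w = h" using s h by (simp add: abs_mult)
        moreover have "dist (of_real a) (of_real b :: complex) = \<bar>a - b\<bar>"
          by (simp add: dist_norm flip: of_real_diff)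
        ultimately have "w \<in> B a \<inter> B b"
          using ab h dist_triangle[of "of_real a" w "of_real b"] r[of b] b by (auto simp: B_def)
        moreover have "s * s = 1" using s by (metis abs_mult_self_eq mult_1)
        then have "w \<in> hplane s" using h by (simp add: w_def hplane_def flip: mult.assoc)
        ultimately have "\<phi> w \<in> connected_component_set W (pt s a)" "\<phi> w \<in> connected_component_set W (pt s b)"
          using sub[of a s] sub[of b s] a b s by auto
        then show "connected_component_set W (pt s a) = connected_component_set W (pt s b)"
          by (metis connected_component_eq)
      qed
    qed
    then show ?thesis
      using connected_local_const[of "{0<..<1::real}" t "1/2" "\<lambda>t. connected_component_set W (pt s t)"] t
      by (simp add: cc_def)
  qed
  have ptW: "pt s t \<in> W" if "0 < t" "t < 1" "\<bar>s\<bar> = 1" for s t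
    using pt_in[OF that] B_W that by (auto simp: hplane_def)
  have ccW: "cc s \<in> components W" if "\<bar>s\<bar> = 1" for s
    unfolding cc_def using ptW[of "1/2" s] that by (auto intro: componentsI)
  have Bcc: "\<phi> w \<in> cc 1 \<union> cc (-1) \<union> (\<lambda>t. \<phi> (of_real t)) ` {0<..<1}" if "w \<in> B t" "0 < t" "t < 1" for w t
  proof (cases "Im w = 0")
    case True
    then have "w = of_real (Re w)" by (simp add: complex_eq_iff)
    then show ?thesis using B_seg[OF that] by (metis UnI2 greaterThanLessThan_iff imageI)
  next
    case False
    then have "w \<in> B t \<inter> hplane 1 \<or> w \<in> B t \<inter> hplane (-1)" using that by (auto simp: hplane_def)
    then have "\<phi> w \<in> \<phi> ` (B t \<inter> hplane 1) \<or> \<phi> w \<in> \<phi> ` (B t \<inter> hplane (-1))" by blast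
    then have "\<phi> w \<in> cc 1 \<or> \<phi> w \<in> cc (-1)"
      using sub[of t 1] sub[of t "-1"] cc[of 1 t] cc[of "-1" t] that by auto
    then show ?thesis by blast
  qed
  define I where "I = (\<lambda>t. \<phi> (of_real t)) ` {0<..<1::real}"
  have "connected I" unfolding I_def
    using cont by (intro connected_continuous_image) (auto intro!: continuous_on_compose2[OF cont] continuous_intros)
  have I_K: "I \<subseteq> - K" using notK by (auto simp: I_def)
  define U where "U = connected_component_set (- K) (\<phi> (1/2))"
  have half: "\<phi> (1/2) \<in> I" unfolding I_def by (rule image_eqI[of _ _ "1/2"]) auto
  have U: "U \<in> components (- K)" unfolding U_def using half I_K by (auto intro: componentsI)
  have IU: "I \<subseteq> U" unfolding U_def using \<open>connected I\<close> half I_K connected_component_maximal by blast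
  have e_I: "?e - K = I"
  proof (intro equalityI subsetI)
    fix z assume z: "z \<in> ?e - K"
    then obtain t where t: "0 \<le> t" "t \<le> 1" "z = \<phi> (of_real t)" unfolding e_eq by auto
    have "p \<in> K" "q \<in> K" using e by auto
    then have "t \<noteq> 0" "t \<noteq> 1" using t z by (auto simp: \<phi>_def)
    then show "z \<in> I" using t by (auto simp: I_def)
  next
    fix z assume "z \<in> I"
    then show "z \<in> ?e - K" using notK e_in by (auto simp: I_def)
  qed
  have openW: "open W" unfolding W_def using K by (auto intro!: open_Compl closed_Un simp: compact_imp_closed)
  have WK: "W \<subseteq> - K" by (auto simp: W_def)
  have comp_sub: "C \<subseteq> U" if C: "C \<in> components W" "C \<inter> U \<noteq> {}" for C
    using C U in_components_connected in_components_subset WK components_maximal[of U "- K" C]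
    by (metis (no_types, lifting) Int_commute subset_trans)
  \<comment> \<open>The two components together with the open segment are open and closed relative to \<open>U\<close>.\<close>
  have UW: "U \<subseteq> cc 1 \<union> cc (-1) \<union> I"
  proof (rule ccontr)
    assume no: "\<not> U \<subseteq> cc 1 \<union> cc (-1) \<union> I"
    define N where "N = (\<Union>t\<in>{0<..<1}. \<phi> ` B t)"
    define A where "A = cc 1 \<union> cc (-1) \<union> N"
    define A' where "A' = \<Union>(components W - {cc 1, cc (-1)})"
    have A_eq: "A = cc 1 \<union> cc (-1) \<union> I"
    proof -
      have "N \<subseteq> cc 1 \<union> cc (-1) \<union> I"
      proof
        fix z assume "z \<in> N"
        then obtain t w where "0 < t" "t < 1" "w \<in> B t" "z = \<phi> w" unfolding N_def by auto
        then show "z \<in> cc 1 \<union> cc (-1) \<union> I" using Bcc[of w t] by (simp add: I_def)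
      qed
      moreover have "I \<subseteq> N" unfolding I_def N_def B_def using r by fastforce
      ultimately show ?thesis unfolding A_def by blast
    qed
    have "open A" unfolding A_def N_def B_def
      using open_components[OF openW] ccW by (intro open_Un open_UN ballI \<phi>_open) auto
    moreover have "open A'" unfolding A'_def using open_components[OF openW] by auto
    moreover have "A \<inter> A' \<inter> U = {}"
    proof -
      have "I \<inter> W = {}" using e_I unfolding W_def by blast
      moreover have "A' \<subseteq> \<Union>(components W)" unfolding A'_def by blast
      then have "A' \<subseteq> W" by simp
      ultimately have "I \<inter> A' = {}" by blast
      have "cc s \<inter> A' = {}" if s: "\<bar>s\<bar> = 1" "cc s \<in> {cc 1, cc (-1)}" for s :: real
      proof -
        have "C \<inter> cc s = {}" if C: "C \<in> components W - {cc 1, cc (-1)}" for C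
          using components_nonoverlap[of C W "cc s"] C ccW[OF s(1)] s(2) by auto
        then show ?thesis unfolding A'_def by auto
      qed
      from this[of 1] this[of "-1"] have "cc 1 \<inter> A' = {}" "cc (-1) \<inter> A' = {}" by auto
      then show ?thesis using \<open>I \<inter> A' = {}\<close> unfolding A_eq by blast
    qed
    moreover have "U \<subseteq> A \<union> A'"
    proof
      fix x assume x: "x \<in> U"
      then have "x \<notin> K" using U in_components_subset by blast
      then consider "x \<in> I" | "x \<in> W" using e_I by (auto simp: W_def)
      then show "x \<in> A \<union> A'"
      proof cases
        case 2
        then have "x \<in> \<Union>(components W)" by simp
        then show ?thesis unfolding A_eq A'_def by blast
      qed (auto simp: A_eq)
    qed
    moreover have "A \<inter> U \<noteq> {}" using half IU A_eq by auto
    moreover have "A' \<inter> U \<noteq> {}" using no \<open>U \<subseteq> A \<union> A'\<close> unfolding A_eq by blast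
    moreover have "connected U" using U in_components_connected by blast
    ultimately show False using connectedD by blast
  qed
  have ccU: "cc s \<subseteq> U" if s: "s = 1 \<or> s = -1" for s
  proof -
    define t :: real where "t = 1/2"
    have t: "0 < t" "t < 1" by (auto simp: t_def)
    have "connected (\<phi> ` B t)" using cont connected_continuous_image B_def convex_connected convex_ball by metis
    moreover have "\<phi> ` B t \<subseteq> - K" using r[OF t] by (auto simp: B_def)
    moreover have "\<phi> (1/2) \<in> \<phi> ` B t" using r[OF t] by (auto simp: B_def t_def intro!: imageI)
    ultimately have "\<phi> ` B t \<subseteq> U" unfolding U_def by (intro connected_component_maximal)
    moreover have "pt s t \<in> \<phi> ` B t" using pt_in[OF t, of s] s by auto
    ultimately have "pt s t \<in> U" by blast
    moreover have "pt s t \<in> cc s" using cc[of s t] t ptW[OF t, of s] s by (metis abs_1 abs_minus_cancel connected_component_refl_eq mem_Collect_eq)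
    ultimately have "cc s \<inter> U \<noteq> {}" by blast
    then show ?thesis using comp_sub[of "cc s"] ccW[of s] s by auto
  qed
  have ne: "cc 1 \<noteq> cc (-1)"
  proof
    assume eq: "cc 1 = cc (-1)"
    define c where "c = g +++ linepath q p"
    have ce: "path_image c = path_image g \<union> ?e" unfolding c_def
      using g by (subst path_image_join) (auto simp: closed_segment_commute)
    have "simple_path c" unfolding c_def
    proof (rule simple_path_join_loop)
      show "path_image g \<inter> path_image (linepath q p) \<subseteq> {pathstart g, pathstart (linepath q p)}"
        using g e by (auto simp: closed_segment_commute)
    qed (use g pq in auto)
    moreover have "pathfinish c = pathstart c" unfolding c_def using g by simp
    ultimately have J: "open (inside (path_image c))" "open (outside (path_image c))"
      "inside (path_image c) \<inter> outside (path_image c) = {}"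
      "inside (path_image c) \<union> outside (path_image c) = - path_image c"
      "frontier (inside (path_image c)) = path_image c"
      "frontier (outside (path_image c)) = path_image c"
      using Jordan_inside_outside[of c] by auto
    have Wc: "W \<subseteq> - path_image c" unfolding W_def ce using g by auto
    define t :: real where "t = 1/2"
    have t: "0 < t" "t < 1" by (auto simp: t_def)
    have mc: "\<phi> (of_real t) \<in> path_image c" unfolding ce using e_in[of "of_real t"] t by auto
    have oB: "open (\<phi> ` B t)" "\<phi> (of_real t) \<in> \<phi> ` B t"
      using \<phi>_open r[OF t] by (auto simp: B_def)
    \<comment> \<open>A small disc around the midpoint of the segment meets both sides of the Jordan curve.\<close>
    have meet: "cc 1 \<inter> X \<noteq> {}" if X: "frontier X = path_image c" "X \<subseteq> - path_image c" for X
    proof -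
      have "\<phi> (of_real t) \<in> closure X" using mc X(1) by (auto simp: frontier_def)
      then have "\<phi> ` B t \<inter> X \<noteq> {}" using oB by (metis open_Int_closure_eq_empty disjoint_iff)
      then obtain w where w: "w \<in> B t" "\<phi> w \<in> X" by auto
      then have "\<phi> w \<notin> ?e" using X(2) ce by auto
      then have "\<phi> w \<notin> I" using e_I by blast
      then show ?thesis using Bcc[OF w(1) t] w(2) eq unfolding I_def by blast
    qed
    have "connected (cc 1)" using ccW[of 1] in_components_connected by auto
    have "cc 1 \<subseteq> W" using ccW[of 1] in_components_subset by auto
    then have "cc 1 \<subseteq> inside (path_image c) \<union> outside (path_image c)" using Wc J(4) by simp
    moreover have "inside (path_image c) \<inter> outside (path_image c) \<inter> cc 1 = {}" using J(3) by simp
    ultimately have "inside (path_image c) \<inter> cc 1 = {} \<or> outside (path_image c) \<inter> cc 1 = {}"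
      using connectedD[OF \<open>connected (cc 1)\<close> J(1,2)] by simp
    then show False
      using J(4) meet[OF J(5)] meet[OF J(6)] by (metis Int_commute sup.cobounded1 sup.cobounded2)
  qed
  have other: "V \<in> components W \<longleftrightarrow> V \<in> components (- K)" if "V \<inter> U = {}" for V
  proof
    assume V: "V \<in> components (- K)"
    then have "V \<inter> ?e = {}" using IU e_I that in_components_subset[OF V] by blast
    then have VW: "V \<subseteq> W" using in_components_subset[OF V] unfolding W_def by blast
    then show "V \<in> components W" using V components_intermediate_subset WK by metis
  next
    assume V: "V \<in> components W"
    then obtain x where x: "x \<in> V" using in_components_nonempty by blast
    then have xK: "x \<in> - K" using in_components_subset[OF V] WK by blast
    define V' where "V' = connected_component_set (- K) x"
    have V': "V' \<in> components (- K)" "x \<in> V'" using xK by (auto simp: V'_def componentsI)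
    have "V' \<noteq> U" using that x V' by blast
    then have "V' \<inter> U = {}" using components_nonoverlap[OF V'(1) U] by simp
    then have "V' \<inter> ?e = {}" using IU e_I in_components_subset[OF V'(1)] by blast
    then have "V' \<subseteq> W" using in_components_subset[OF V'(1)] unfolding W_def by blast
    then have "V' \<in> components W" using V' components_intermediate_subset WK by metis
    then show "V \<in> components (- K)" using V' V x components_nonoverlap by (metis disjoint_iff)
  qed
  have "components W = (components (- K) - {U}) \<union> {cc 1, cc (-1)}"
  proof (intro equalityI subsetI)
    fix V assume V: "V \<in> components W"
    show "V \<in> (components (- K) - {U}) \<union> {cc 1, cc (-1)}"
    proof (cases "V \<inter> U = {}")
      case True
      then have "V \<in> components (- K)" using other V by blast
      moreover have "V \<noteq> U" using True in_components_nonempty[OF V] by blast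
      ultimately show ?thesis by blast
    next
      case False
      then obtain x where x: "x \<in> V" "x \<in> U" by blast
      then have "x \<notin> I" using in_components_subset[OF V] e_I unfolding W_def by blast
      then have "x \<in> cc 1 \<or> x \<in> cc (-1)" using x UW by blast
      then show ?thesis
        using components_nonoverlap[OF V ccW[of 1]] components_nonoverlap[OF V ccW[of "-1"]] x by auto
    qed
  next
    fix V assume V: "V \<in> (components (- K) - {U}) \<union> {cc 1, cc (-1)}"
    show "V \<in> components W"
    proof (cases "V \<in> {cc 1, cc (-1)}")
      case False
      then have "V \<in> components (- K)" "V \<inter> U = {}" using V components_nonoverlap[OF _ U, of V] by auto
      then show ?thesis using other by blast
    qed (use ccW[of 1] ccW[of "-1"] in auto)
  qed
  moreover have "cc s \<notin> components (- K) - {U}" if s: "s = 1 \<or> s = -1" for s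
  proof
    assume a: "cc s \<in> components (- K) - {U}"
    then have "cc s \<inter> U = {}" using components_nonoverlap[OF _ U, of "cc s"] by auto
    then have "cc s = {}" using ccU[OF s] by blast
    then show False using ccW[of s] s in_components_nonempty by force
  qed
  ultimately show thesis using that[of U "cc 1" "cc (-1)"] U ne unfolding W_def by auto
qed

section \<open>Euler's formula for straight-line plane graphs\<close>

text \<open>Declaring \<open>p\<close> and \<open>q\<close> equivalent merges their two classes and keeps all others.\<close>

lemma card_quotient_merge:
  assumes fin: "finite V" and E: "equiv V R" and pq: "p \<in> V" "q \<in> V"
    and R': "\<And>x y. (x, y) \<in> R' \<longleftrightarrow> (x, y) \<in> R \<or> {x, y} \<subseteq> R `` {p} \<union> R `` {q}"
  shows "int (card (V // R')) = int (card (V // R)) - (if (p, q) \<in> R then 0 else 1)"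
proof (cases "(p, q) \<in> R")
  case True
  then have "R `` {p} = R `` {q}" using equiv_class_eq[OF E] by blast
  moreover have "(x, y) \<in> R" if "(p, x) \<in> R" "(p, y) \<in> R" for x y
    using that E by (meson equivE symE transE)
  ultimately have "(x, y) \<in> R' \<longleftrightarrow> (x, y) \<in> R" for x y
    using R'[of x y] by auto
  then have "R' = R" by auto
  then show ?thesis using True by simp
next
  case False
  let ?P = "R `` {p}" and ?Q = "R `` {q}"
  have cls: "R' `` {x} = (if x \<in> ?P \<union> ?Q then ?P \<union> ?Q else R `` {x})" for x
  proof (cases "x \<in> ?P \<union> ?Q")
    case True
    then have "R `` {x} \<subseteq> ?P \<union> ?Q" using E by (auto elim: equivE dest: transD)
    then show ?thesis using True R' by auto
  qed (use R' in auto)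
  have PQ: "?P \<in> V // R" "?Q \<in> V // R" "?P \<noteq> ?Q"
    using pq False E by (auto intro: quotientI dest: eq_equiv_class)
  have self: "x \<in> R `` {x}" if "x \<in> V" for x using E that by (metis equiv_class_self)
  have sub: "A \<subseteq> V" "A \<noteq> {}" if "A \<in> V // R" for A
    using that E in_quotient_imp_subset in_quotient_imp_non_empty by blast+
  have cls_eq: "A = R `` {x}" if "A \<in> V // R" "x \<in> A" for A x
    using that E by (metis Image_singleton_iff equiv_class_eq quotientE)
  have "V // R' = insert (?P \<union> ?Q) (V // R - {?P, ?Q})"
  proof (intro equalityI subsetI)
    fix A assume "A \<in> V // R'"
    then obtain x where x: "x \<in> V" "A = R' `` {x}" by (auto elim: quotientE)
    show "A \<in> insert (?P \<union> ?Q) (V // R - {?P, ?Q})"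
      using x self[OF x(1)] by (auto simp: cls intro: quotientI)
  next
    fix A assume A: "A \<in> insert (?P \<union> ?Q) (V // R - {?P, ?Q})"
    show "A \<in> V // R'"
    proof (cases "A = ?P \<union> ?Q")
      case True
      then have "A = R' `` {p}" using self[OF pq(1)] by (auto simp: cls)
      then show ?thesis using pq(1) by (auto intro: quotientI)
    next
      case F: False
      then have A: "A \<in> V // R" "A \<noteq> ?P" "A \<noteq> ?Q" using A by auto
      then obtain x where x: "x \<in> A" using sub by blast
      then have "A = R `` {x}" "x \<in> V" using cls_eq[OF A(1)] sub[OF A(1)] by auto
      moreover have "x \<notin> ?P \<union> ?Q" using A x cls_eq PQ \<open>A = R `` {x}\<close> by (metis UnE)
      ultimately show ?thesis by (metis cls quotientI)
    qed
  qed
  moreover have "?P \<union> ?Q \<notin> V // R"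
    using cls_eq[of "?P \<union> ?Q" p] cls_eq[of "?P \<union> ?Q" q] self pq PQ(3) by blast
  moreover have finR: "finite (V // R)" using fin E by (simp add: equiv_def finite_quotient refl_on_def)
  moreover have "card (V // R - {?P, ?Q}) = card (V // R) - 2"
    using PQ finR by (subst card_Diff_subset) auto
  moreover have "card {?P, ?Q} \<le> card (V // R)" using PQ finR by (intro card_mono) auto
  ultimately show ?thesis using False PQ(3) by simp
qed

text \<open>Connectedness within the graph with vertices \<open>V\<close> and edges \<open>G\<close>. Components of the graph are
counted as classes of this relation.\<close>

definition joined :: "'a::euclidean_space set \<Rightarrow> 'a set set \<Rightarrow> ('a \<times> 'a) set" where
  "joined V G = Restr (rtrancl {(x, y). closed_segment x y \<in> G}) V"

lemma equiv_joined: "equiv V (joined V G)"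
proof -
  have "sym (rtrancl {(x, y). closed_segment x y \<in> G})"
    by (intro sym_rtrancl) (auto simp: sym_def closed_segment_commute)
  then show ?thesis
    unfolding joined_def by (intro equivI) (auto simp: refl_on_def sym_def intro!: transI dest: rtrancl_trans)
qed

lemma joined_insert:
  assumes pq: "p \<in> V" "q \<in> V"
  shows "(x, y) \<in> joined V (insert (closed_segment p q) G) \<longleftrightarrow>
    (x, y) \<in> joined V G \<or> {x, y} \<subseteq> joined V G `` {p} \<union> joined V G `` {q}"
proof -
  let ?r = "{(x, y). closed_segment x y \<in> G}"
  let ?s = "{(x, y). closed_segment x y \<in> insert (closed_segment p q) G}"
  have sym: "(y, x) \<in> rtrancl ?r" if "(x, y) \<in> rtrancl ?r" for x y
    using that sym_rtrancl[of ?r] by (auto simp: sym_def closed_segment_commute)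
  have mono: "rtrancl ?r \<subseteq> rtrancl ?s" by (intro rtrancl_mono) auto
  have pqs: "(p, q) \<in> rtrancl ?s" "(q, p) \<in> rtrancl ?s"
    by (auto simp: closed_segment_commute)
  have new: "(x, y) \<in> rtrancl ?r \<or> {x, y} \<subseteq> rtrancl ?r `` {p} \<union> rtrancl ?r `` {q}"
    if "(x, y) \<in> rtrancl ?s" for x y
    using that
  proof (induction rule: rtrancl_induct)
    case (step y z)
    show ?case
    proof (cases "(y, z) \<in> ?r")
      case True
      then show ?thesis using step.IH by (auto intro: rtrancl_into_rtrancl)
    next
      case False
      then have "closed_segment y z = closed_segment p q" using step.hyps by simp
      then have "{y, z} = {p, q}" by (simp only: closed_segment_eq)
      then show ?thesis using step.IH sym by (auto simp: doubleton_eq_iff)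
    qed
  qed simp
  have old: "(x, y) \<in> rtrancl ?s" if "{x, y} \<subseteq> rtrancl ?r `` {p} \<union> rtrancl ?r `` {q}" for x y
  proof -
    have "(x, p) \<in> rtrancl ?s" "(p, y) \<in> rtrancl ?s"
      using that mono pqs sym by (auto intro: rtrancl_trans)
    then show ?thesis by (rule rtrancl_trans)
  qed
  show ?thesis
    using new[of x y] old[of x y] mono pq unfolding joined_def by auto
qed

lemma path_component_joined:
  assumes "(x, y) \<in> joined V G"
  shows "path_component (V \<union> \<Union>G) x y"
proof -
  have "(x, y) \<in> rtrancl {(x, y). closed_segment x y \<in> G}" and x: "x \<in> V"
    using assms by (auto simp: joined_def)
  from this(1) show ?thesis
  proof (induction rule: rtrancl_induct)
    case base
    then show ?case using x by (simp add: path_component_refl)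
  next
    case (step y z)
    then have "closed_segment y z \<in> G" by simp
    then have "path_component (V \<union> \<Union>G) y z"
      unfolding path_component_def by (intro exI[of _ "linepath y z"]) auto
    then show ?case using step.IH path_component_trans by blast
  qed
qed

text \<open>Induction on the number of edges. A new edge joins either two vertices of one component, and then
creates a face, or vertices of two components, and then merges them. In the second case the component
\<open>C\<close> of one end and the rest of the graph are the two compact parts of the bridge lemma.\<close>

lemma plane_graph_Euler_complex:
  fixes V :: "complex set"
  assumes "finite V" "finite G"
    and "\<And>e. e \<in> G \<Longrightarrow> \<exists>p q. p \<in> V \<and> q \<in> V \<and> p \<noteq> q \<and> e = closed_segment p q \<and> open_segment p q \<inter> V = {}"
    and "\<And>e e'. e \<in> G \<Longrightarrow> e' \<in> G \<Longrightarrow> e \<noteq> e' \<Longrightarrow> e \<inter> e' \<subseteq> V"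
  shows "finite (components (- (V \<union> \<Union>G))) \<and>
    int (card (components (- (V \<union> \<Union>G)))) + int (card V) = int (card (V // joined V G)) + int (card G) + 1"
  using assms(2-4)
proof (induction G rule: finite_induct)
  case empty
  have "connected (- V)"
    using connected_open_delete_finite[of "UNIV :: complex set" V] assms(1)
    by (simp add: Compl_eq_Diff_UNIV connected_UNIV)
  moreover have "- V \<noteq> {}"
    using assms(1) infinite_UNIV_char_0[where 'a=complex] by (metis Compl_empty_eq double_complement)
  ultimately have "components (- V) = {- V}" by (simp add: components_eq_sing_iff)
  moreover have "joined V {} = Id_on V" by (auto simp: joined_def)
  moreover have "V // Id_on V = (\<lambda>x. {x}) ` V" by (auto simp: quotient_def)
  ultimately show ?case by (simp add: card_image)
next
  case (insert e G)
  let ?K = "V \<union> \<Union>G" and ?R = "joined V G"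
  obtain p q where pq: "p \<in> V" "q \<in> V" "p \<noteq> q" and e: "e = closed_segment p q"
    and open_e: "open_segment p q \<inter> V = {}"
    using insert.prems(1)[of e] by blast
  have seg: "\<exists>p q. p \<in> V \<and> q \<in> V \<and> p \<noteq> q \<and> g = closed_segment p q \<and> open_segment p q \<inter> V = {}"
    if "g \<in> G" for g
    using insert.prems(1)[of g] that by simp
  have disj: "g \<inter> g' \<subseteq> V" if "g \<in> G" "g' \<in> G" "g \<noteq> g'" for g g'
    using insert.prems(2)[of g g'] that by simp
  have IH: "finite (components (- ?K))"
    "int (card (components (- ?K))) + int (card V) = int (card (V // ?R)) + int (card G) + 1"
    using insert.IH seg disj by auto
  have eV: "e \<inter> V = {p, q}"
    using pq open_e unfolding e open_segment_def by auto
  have "e \<inter> g \<subseteq> V" if "g \<in> G" for g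
    using insert.prems(2)[of e g] insert.hyps that by auto
  then have eK: "e \<inter> ?K = {p, q}" using eV by blast
  have comp_g: "compact g" if "g \<in> G" for g using seg[OF that] by auto
  have compK: "compact ?K"
    using assms(1) insert.hyps comp_g by (intro compact_Un compact_Union) (auto intro: finite_imp_compact)
  have K': "- (V \<union> \<Union>(insert e G)) = - (?K \<union> closed_segment p q)" unfolding e by auto
  have classes: "int (card (V // joined V (insert e G))) =
      int (card (V // ?R)) - (if (p, q) \<in> ?R then 0 else 1)"
    unfolding e using joined_insert[OF pq(1,2)] by (intro card_quotient_merge assms(1) equiv_joined pq)
  show ?case
  proof (cases "(p, q) \<in> ?R")
    case True
    then obtain \<gamma> where "path \<gamma>" "path_image \<gamma> \<subseteq> ?K" "pathstart \<gamma> = p" "pathfinish \<gamma> = q"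
      using path_component_joined[OF True] unfolding path_component_def by blast
    then obtain g where "arc g" "path_image g \<subseteq> ?K" "pathstart g = p" "pathfinish g = q"
      using path_contains_arc[of \<gamma> p q] pq(3) by (metis subset_trans)
    then obtain U U1 U2 where U: "U \<in> components (- ?K)"
      "components (- (?K \<union> closed_segment p q)) = (components (- ?K) - {U}) \<union> {U1, U2}"
      "U1 \<noteq> U2" "U1 \<notin> components (- ?K) - {U}" "U2 \<notin> components (- ?K) - {U}"
      using components_Compl_Un_chord[OF compK pq(3) eK[unfolded e]] by metis
    have "card (components (- (?K \<union> closed_segment p q))) = card (components (- ?K)) - 1 + 2"
      unfolding U(2) using U(1,3-5) IH(1) by (subst card_Un_disjoint) auto
    moreover have "card (components (- ?K)) > 0" using U(1) IH(1) card_gt_0_iff by blast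
    moreover have "finite (components (- (?K \<union> closed_segment p q)))" unfolding U(2) using IH(1) by simp
    ultimately show ?thesis
      using IH(2) classes True insert.hyps unfolding K' by simp
  next
    case False
    define C where "C = ?R `` {p}"
    define K1 where "K1 = C \<union> \<Union>{g \<in> G. g \<inter> C \<noteq> {}}"
    define K2 where "K2 = (V - C) \<union> \<Union>{g \<in> G. g \<inter> C = {}}"
    have CV: "C \<subseteq> V" unfolding C_def joined_def by auto
    have ends: "(u, v) \<in> ?R" if g: "g \<in> G" "u \<in> g \<inter> V" "v \<in> g \<inter> V" for g u v
    proof -
      obtain a b where ab: "a \<in> V" "b \<in> V" "g = closed_segment a b" "open_segment a b \<inter> V = {}"
        using seg[OF g(1)] by blast
      then have "u \<in> {a, b}" "v \<in> {a, b}" using g unfolding open_segment_def by auto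
      moreover have "(a, b) \<in> ?R" "(b, a) \<in> ?R"
        using ab g(1) by (auto simp: joined_def closed_segment_commute intro!: r_into_rtrancl)
      moreover have "(a, a) \<in> ?R" "(b, b) \<in> ?R" using ab by (auto simp: joined_def)
      ultimately show ?thesis by auto
    qed
    have in_C: "v \<in> C" if g: "g \<in> G" "g \<inter> C \<noteq> {}" "v \<in> g" "v \<in> V" for g v
    proof -
      obtain u where u: "u \<in> g" "u \<in> C" using g by blast
      then have "(u, v) \<in> ?R" using ends g CV by blast
      then show ?thesis using u(2) equiv_joined[of V G] unfolding C_def equiv_def trans_def by blast
    qed
    have K_split: "?K = K1 \<union> K2" using CV unfolding K1_def K2_def by blast
    have K12: "K1 \<inter> K2 = {}"
    proof (rule ccontr)
      assume "K1 \<inter> K2 \<noteq> {}"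
      then obtain x where x: "x \<in> K1" "x \<in> K2" by blast
      have "x \<in> V"
      proof (rule ccontr)
        assume "x \<notin> V"
        then obtain g g' where "g \<in> G" "g \<inter> C \<noteq> {}" "x \<in> g" "g' \<in> G" "g' \<inter> C = {}" "x \<in> g'"
          using x CV unfolding K1_def K2_def by auto
        then show False using disj[of g g'] \<open>x \<notin> V\<close> by auto
      qed
      then have "x \<in> C" using x(1) in_C unfolding K1_def by auto
      then show False using x(2) unfolding K2_def by auto
    qed
    have comp12: "compact K1" "compact K2"
      unfolding K1_def K2_def using assms(1) insert.hyps comp_g finite_subset[OF CV]
      by (auto intro!: compact_Un compact_Union intro: finite_imp_compact)
    have pK1: "p \<in> K1" unfolding K1_def C_def using pq by (auto simp: joined_def)
    have qK2: "q \<in> K2" unfolding K2_def C_def using pq False by auto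
    note bridge = components_Compl_Un_bridge[OF comp12 K12 pK1 qK2 eK[unfolded K_split e]]
    have "card (components (- (?K \<union> closed_segment p q))) = card (components (- ?K))"
      unfolding K_split bridge(1) by (intro card_image bridge(2))
    moreover have "finite (components (- (?K \<union> closed_segment p q)))"
      unfolding K_split bridge(1) using IH(1) K_split by simp
    ultimately show ?thesis using IH(2) classes False insert.hyps unfolding K' by simp
  qed
qed

lemma components_linear_image:
  fixes h :: "'a::euclidean_space \<Rightarrow> 'b::euclidean_space"
  assumes h: "linear h" "inj h"
  shows "components (h ` S) = (`) h ` components S"
proof -
  obtain k where k: "linear k" "k \<circ> h = id" using linear_injective_left_inverse[OF h] by blast
  have ch: "continuous_on T h" for T using h(1) linear_continuous_on linear_linear by blast
  have ck: "continuous_on T k" for T using k(1) linear_continuous_on linear_linear by blast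
  have kh: "k (h x) = x" for x using k(2) by (metis comp_apply id_apply)
  have eq: "connected_component_set (h ` S) (h x) = h ` connected_component_set S x" if x: "x \<in> S" for x
  proof
    have "connected (k ` connected_component_set (h ` S) (h x))"
      using ck by (intro connected_continuous_image) auto
    moreover have "x \<in> k ` connected_component_set (h ` S) (h x)"
      using x kh[of x] by (intro image_eqI[of _ _ "h x"]) (auto simp: connected_component_refl_eq)
    moreover have "k ` connected_component_set (h ` S) (h x) \<subseteq> S"
      using connected_component_subset[of "h ` S" "h x"] kh by fastforce
    ultimately have sub: "k ` connected_component_set (h ` S) (h x) \<subseteq> connected_component_set S x"
      by (simp add: connected_component_maximal)
    show "connected_component_set (h ` S) (h x) \<subseteq> h ` connected_component_set S x"
    proof
      fix y assume y: "y \<in> connected_component_set (h ` S) (h x)"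
      then obtain z where "y = h z" using connected_component_subset by blast
      then show "y \<in> h ` connected_component_set S x" using sub y kh by (metis image_eqI subsetD)
    qed
    show "h ` connected_component_set S x \<subseteq> connected_component_set (h ` S) (h x)"
      using x ch connected_component_subset[of S x]
      by (intro connected_component_maximal connected_continuous_image) (auto simp: connected_component_refl_eq)
  qed
  show ?thesis
  proof (intro equalityI subsetI)
    fix C assume "C \<in> components (h ` S)"
    then obtain x where "x \<in> S" "C = connected_component_set (h ` S) (h x)" by (auto elim: componentsE)
    then show "C \<in> (`) h ` components S" using eq by (auto intro: componentsI)
  next
    fix C assume "C \<in> (`) h ` components S"
    then obtain x where x: "x \<in> S" "C = h ` connected_component_set S x" by (auto elim: componentsE)
    then have "C = connected_component_set (h ` S) (h x)" using eq by simp
    then show "C \<in> components (h ` S)" using x by (auto intro: componentsI)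
  qed
qed

text \<open>The formula for bounded faces, transferred from the complex plane: exactly one face is unbounded.\<close>

theorem plane_graph_Euler:
  fixes V :: "(real \<times> real) set"
  assumes fin: "finite V" "finite G"
    and seg: "\<And>e. e \<in> G \<Longrightarrow> \<exists>p q. p \<in> V \<and> q \<in> V \<and> p \<noteq> q \<and> e = closed_segment p q \<and> open_segment p q \<inter> V = {}"
    and disj: "\<And>e e'. e \<in> G \<Longrightarrow> e' \<in> G \<Longrightarrow> e \<noteq> e' \<Longrightarrow> e \<inter> e' \<subseteq> V"
  shows "int (card V) + int (card {C \<in> components (- (V \<union> \<Union>G)). bounded C}) =
    int (card (V // joined V G)) + int (card G)"
proof -
  define h :: "real \<times> real \<Rightarrow> complex" where "h = (\<lambda>(x, y). Complex x y)"
  have lin: "linear h"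
    by (rule linearI) (auto simp: h_def complex_eq_iff)
  have inj: "inj h" by (auto simp: inj_def h_def)
  have surj: "surj h"
  proof (rule surjI)
    fix z show "h (Re z, Im z) = z" by (simp add: h_def)
  qed
  have closed_h: "h ` closed_segment p q = closed_segment (h p) (h q)" for p q
    using closed_segment_linear_image[OF lin, of p q] by simp
  have open_h: "h ` open_segment p q = open_segment (h p) (h q)" for p q
    using open_segment_linear_image[OF lin inj, of p q] by simp
  define V' where "V' = h ` V"
  define G' where "G' = (`) h ` G"
  have injG: "inj_on ((`) h) A" for A using inj by (meson inj_image_eq_iff inj_onI)
  have Un': "- (V' \<union> \<Union>G') = h ` (- (V \<union> \<Union>G))"
    unfolding V'_def G'_def using bij_image_Compl_eq[of h "V \<union> \<Union>G"] inj surj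
    by (simp add: bij_def image_Un image_Union)
  have comps: "components (- (V' \<union> \<Union>G')) = (`) h ` components (- (V \<union> \<Union>G))"
    unfolding Un' by (rule components_linear_image[OF lin inj])
  have E': "finite (components (- (V' \<union> \<Union>G'))) \<and>
    int (card (components (- (V' \<union> \<Union>G')))) + int (card V') = int (card (V' // joined V' G')) + int (card G') + 1"
  proof (rule plane_graph_Euler_complex)
    show "finite V'" "finite G'" unfolding V'_def G'_def using fin by auto
    fix e assume "e \<in> G'"
    then obtain g where g: "g \<in> G" "e = h ` g" unfolding G'_def by blast
    obtain p q where "p \<in> V" "q \<in> V" "p \<noteq> q" "g = closed_segment p q" "open_segment p q \<inter> V = {}"
      using seg[OF g(1)] by blast
    then show "\<exists>p q. p \<in> V' \<and> q \<in> V' \<and> p \<noteq> q \<and> e = closed_segment p q \<and> open_segment p q \<inter> V' = {}"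
      using inj unfolding V'_def g(2)
      by (intro exI[of _ "h p"] exI[of _ "h q"])
        (simp add: closed_h inj_eq image_Int[symmetric] flip: open_h)
  next
    fix e e' assume "e \<in> G'" "e' \<in> G'" "e \<noteq> e'"
    then obtain g g' where "g \<in> G" "e = h ` g" "g' \<in> G" "e' = h ` g'" "g \<noteq> g'" unfolding G'_def by blast
    then show "e \<inter> e' \<subseteq> V'" using disj[of g g'] inj unfolding V'_def by (auto simp flip: image_Int)
  qed
  have joined_h: "(h x, h y) \<in> joined V' G' \<longleftrightarrow> (x, y) \<in> joined V G" for x y
  proof -
    have rel: "{(x, y). closed_segment x y \<in> G'} = map_prod h h ` {(x, y). closed_segment x y \<in> G}"
    proof -
      have "closed_segment (h a) (h b) \<in> G' \<longleftrightarrow> closed_segment a b \<in> G" for a b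
        unfolding G'_def closed_h[symmetric] using inj by (simp add: inj_image_eq_iff image_iff)
      moreover have "\<exists>a b. x = h a \<and> y = h b" for x y using surj by (metis surjD)
      ultimately show ?thesis by (auto simp: image_iff) (metis)+
    qed
    have a: "(h x, h y) \<in> rtrancl (map_prod h h ` r)" if "(x, y) \<in> rtrancl r" for r x y
      using that by (induction rule: rtrancl_induct) (auto intro: rtrancl_into_rtrancl)
    have b: "(x, y) \<in> rtrancl r" if "(h x, u) \<in> rtrancl (map_prod h h ` r)" "u = h y" for r x y u
      using that
    proof (induction arbitrary: y rule: rtrancl_induct)
      case base
      then show ?case using inj by (simp add: inj_eq)
    next
      case (step v w)
      then obtain c d where "(c, d) \<in> r" "v = h c" "w = h d" by auto
      then show ?case using step inj by (metis inj_eq rtrancl_into_rtrancl)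
    qed
    have "(h x, h y) \<in> rtrancl (map_prod h h ` {(x, y). closed_segment x y \<in> G}) \<longleftrightarrow>
        (x, y) \<in> rtrancl {(x, y). closed_segment x y \<in> G}"
      using a[of x y] b[of x "h y" _ y] by blast
    moreover have "h x \<in> h ` V \<longleftrightarrow> x \<in> V" for x using inj by (rule inj_image_mem_iff)
    ultimately show ?thesis unfolding joined_def rel V'_def by simp
  qed
  have "V' // joined V' G' = (`) h ` (V // joined V G)"
  proof -
    have "joined V' G' `` {h x} = h ` (joined V G `` {x})" for x
    proof -
      have "y \<in> joined V' G' `` {h x} \<longleftrightarrow> y \<in> h ` (joined V G `` {x})" for y
      proof -
        obtain z where "y = h z" using surj by (metis surjD)
        then show ?thesis using joined_h inj by (simp add: inj_image_mem_iff)
      qed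
      then show ?thesis by blast
    qed
    then show ?thesis unfolding quotient_def V'_def by (auto simp: image_iff)
  qed
  then have card_q: "card (V' // joined V' G') = card (V // joined V G)"
    using injG by (simp add: card_image)
  have cardV: "card V' = card V" unfolding V'_def using inj by (simp add: card_image inj_on_subset)
  have cardG: "card G' = card G" unfolding G'_def using injG by (simp add: card_image)
  let ?C = "components (- (V \<union> \<Union>G))"
  have cardC: "card (components (- (V' \<union> \<Union>G'))) = card ?C"
    unfolding comps using injG by (simp add: card_image)
  have finC: "finite ?C" using E' comps injG finite_imageD by metis
  have "bounded (V \<union> \<Union>G)"
  proof -
    have "bounded e" if "e \<in> G" for e using seg[OF that] bounded_closed_segment by auto
    then show ?thesis using fin by (auto simp: finite_imp_bounded intro!: bounded_Union)
  qed
  then have bd: "bounded (- (- (V \<union> \<Union>G)))" by simp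
  obtain C0 where C0: "C0 \<in> ?C" "\<not> bounded C0"
    using cobounded_unbounded_components[OF bd] by blast
  have "{C \<in> ?C. bounded C} = ?C - {C0}"
  proof -
    have "C = C0" if "C \<in> ?C" "\<not> bounded C" for C
      using cobounded_unique_unbounded_components[OF bd C0 that] by simp
    then show ?thesis using C0 by blast
  qed
  then have "card ?C = card {C \<in> ?C. bounded C} + 1"
    using C0(1) finC card.remove[of ?C C0] by simp
  then show ?thesis using E' cardC cardV cardG card_q by simp
qed

section \<open>Arrangements of axis-parallel segments\<close>

declare split_paired_All [simp del] split_paired_Ex [simp del]

text \<open>Directions are Booleans: \<open>co d\<close> is the coordinate that varies along direction \<open>d\<close>, and
\<open>mk d s t\<close> is the point with coordinate \<open>s\<close> along \<open>d\<close> and \<open>t\<close> across it.\<close>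

definition co :: "bool \<Rightarrow> real \<times> real \<Rightarrow> real" where
  "co d p = (if d then fst p else snd p)"

definition mk :: "bool \<Rightarrow> real \<Rightarrow> real \<Rightarrow> real \<times> real" where
  "mk d s t = (if d then (s, t) else (t, s))"

lemma co_mk [simp]: "co d (mk d s t) = s" "co (\<not> d) (mk d s t) = t"
  by (auto simp: co_def mk_def)

lemma mk_co [simp]: "mk d (co d p) (co (\<not> d) p) = p"
  by (auto simp: co_def mk_def)

lemma mk_flip: "mk (\<not> d) s t = mk d t s"
  by (auto simp: mk_def)

lemma mk_eq_iff [simp]: "mk d s t = mk d s' t' \<longleftrightarrow> s = s' \<and> t = t'"
  by (auto simp: mk_def)

lemma co_eqI: "co d p = co d q \<Longrightarrow> co (\<not> d) p = co (\<not> d) q \<Longrightarrow> p = q"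
  by (metis mk_co)

lemma eq_mk_iff: "p = mk d s t \<longleftrightarrow> co d p = s \<and> co (\<not> d) p = t"
  by (metis co_mk mk_co)

lemma closed_segment_mk:
  "closed_segment (mk d a t) (mk d b t) = (\<lambda>s. mk d s t) ` closed_segment a b"
  by (cases d) (auto simp: mk_def closed_segment_same_snd closed_segment_same_fst)

lemma in_closed_segment_mk:
  "p \<in> closed_segment (mk d a t) (mk d b t) \<longleftrightarrow> co (\<not> d) p = t \<and> co d p \<in> closed_segment a b"
  unfolding closed_segment_mk by (auto simp: image_iff eq_mk_iff)

lemma in_closed_segment_mk_le:
  "a \<le> b \<Longrightarrow> p \<in> closed_segment (mk d a t) (mk d b t) \<longleftrightarrow> co (\<not> d) p = t \<and> a \<le> co d p \<and> co d p \<le> b"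
  by (auto simp: in_closed_segment_mk closed_segment_eq_real_ivl)

lemma in_open_segment_mk:
  "a < b \<Longrightarrow> p \<in> open_segment (mk d a t) (mk d b t) \<longleftrightarrow> co (\<not> d) p = t \<and> a < co d p \<and> co d p < b"
  unfolding open_segment_def
  by (auto simp: in_closed_segment_mk_le eq_mk_iff)

lemma continuous_on_co [continuous_intros]: "continuous_on S (co d)"
  by (cases d) (auto simp: co_def intro!: continuous_intros)

lemma continuous_on_mk [continuous_intros]:
  "continuous_on S f \<Longrightarrow> continuous_on S g \<Longrightarrow> continuous_on S (\<lambda>x. mk d (f x) (g x))"
  by (cases d) (auto simp: mk_def intro!: continuous_intros)

text \<open>In an arrangement, \<open>H d\<close> is the union of the segments in direction \<open>d\<close>. From a point one can
proceed in direction \<open>d\<close> along \<open>H d\<close> forwards, backwards or both ways (\<open>thru\<close>).\<close>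

definition covers :: "(bool \<Rightarrow> (real \<times> real) set) \<Rightarrow> bool \<Rightarrow> real \<Rightarrow> real \<Rightarrow> real \<Rightarrow> bool" where
  "covers H d t a b \<longleftrightarrow> (\<forall>s. a \<le> s \<and> s \<le> b \<longrightarrow> mk d s t \<in> H d)"

definition fwd :: "(bool \<Rightarrow> (real \<times> real) set) \<Rightarrow> bool \<Rightarrow> real \<times> real \<Rightarrow> bool" where
  "fwd H d p \<longleftrightarrow> (\<exists>b > co d p. covers H d (co (\<not> d) p) (co d p) b)"

definition bwd :: "(bool \<Rightarrow> (real \<times> real) set) \<Rightarrow> bool \<Rightarrow> real \<times> real \<Rightarrow> bool" where
  "bwd H d p \<longleftrightarrow> (\<exists>a < co d p. covers H d (co (\<not> d) p) a (co d p))"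

definition thru :: "(bool \<Rightarrow> (real \<times> real) set) \<Rightarrow> bool \<Rightarrow> real \<times> real \<Rightarrow> bool" where
  "thru H d p \<longleftrightarrow> bwd H d p \<and> fwd H d p"

definition adj :: "(bool \<Rightarrow> (real \<times> real) set) \<Rightarrow> bool \<Rightarrow> real \<times> real \<Rightarrow> real \<times> real \<Rightarrow> bool" where
  "adj H d p q \<longleftrightarrow> co (\<not> d) p = co (\<not> d) q \<and>
     covers H d (co (\<not> d) p) (min (co d p) (co d q)) (max (co d p) (co d q))"

definition inside_box :: "(bool \<Rightarrow> real) \<Rightarrow> (bool \<Rightarrow> real) \<Rightarrow> real \<times> real \<Rightarrow> bool" where
  "inside_box A B p \<longleftrightarrow> (\<forall>d. A d < co d p \<and> co d p < B d)"

lemma inside_box_dirI: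
  "A d < co d p \<and> co d p < B d \<Longrightarrow> A (\<not> d) < co (\<not> d) p \<and> co (\<not> d) p < B (\<not> d) \<Longrightarrow> inside_box A B p"
  unfolding inside_box_def all_bool_eq by (cases d) auto

text \<open>These turn out to be the crossing vertices, and \<open>linked\<close> the connectedness of the
crossing-vertex-relationship graph.\<close>

definition crossings :: "(bool \<Rightarrow> (real \<times> real) set) \<Rightarrow> (bool \<Rightarrow> real) \<Rightarrow> (bool \<Rightarrow> real) \<Rightarrow> (real \<times> real) set" where
  "crossings H A B = {p. inside_box A B p \<and> (\<forall>d. thru H d p)}"

definition linked :: "(bool \<Rightarrow> (real \<times> real) set) \<Rightarrow> (real \<times> real) set \<Rightarrow> ((real \<times> real) \<times> (real \<times> real)) set" where
  "linked H X = Restr (rtrancl {(p, q). p \<in> X \<and> q \<in> X \<and> (\<exists>d. adj H d p q)}) X"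

lemma covers_subset: "covers H d t a b \<Longrightarrow> a \<le> a' \<Longrightarrow> b' \<le> b \<Longrightarrow> covers H d t a' b'"
  unfolding covers_def by auto

lemma covers_join: "covers H d t a b \<Longrightarrow> covers H d t b c \<Longrightarrow> covers H d t a c"
  unfolding covers_def by (meson linear)

lemma adj_sym: "adj H d p q \<Longrightarrow> adj H d q p"
  unfolding adj_def by (metis min.commute max.commute)

lemma adj_trans: "adj H d p q \<Longrightarrow> adj H d q r \<Longrightarrow> adj H d p r"
  unfolding adj_def covers_def by (auto simp: min_le_iff_disj le_max_iff_disj) (meson linear)+

lemma adj_refl: "p \<in> H d \<Longrightarrow> adj H d p p"
  unfolding adj_def covers_def by auto

lemma adj_in: "adj H d p q \<Longrightarrow> p \<in> H d \<and> q \<in> H d"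
  unfolding adj_def covers_def
  by (metis linear max.cobounded1 max.cobounded2 min.cobounded1 min.cobounded2 mk_co)

lemma adj_le: "co d p \<le> co d q \<Longrightarrow> adj H d p q \<longleftrightarrow>
    co (\<not> d) p = co (\<not> d) q \<and> covers H d (co (\<not> d) p) (co d p) (co d q)"
  by (simp add: adj_def)

lemma thru_in: "thru H d p \<Longrightarrow> p \<in> H d"
  unfolding thru_def fwd_def covers_def by (metis mk_co order_refl less_imp_le)

lemma covers_mono: "covers H d t a b \<Longrightarrow> H d \<subseteq> H' d \<Longrightarrow> covers H' d t a b"
  unfolding covers_def by blast

lemma thru_mono: "thru H d p \<Longrightarrow> H d \<subseteq> H' d \<Longrightarrow> thru H' d p"
  unfolding thru_def fwd_def bwd_def using covers_mono by blast

lemma adj_mono: "adj H d p q \<Longrightarrow> H d \<subseteq> H' d \<Longrightarrow> adj H' d p q"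
  unfolding adj_def using covers_mono by blast

lemma crossings_mono: "(\<And>d. H d \<subseteq> H' d) \<Longrightarrow> crossings H A B \<subseteq> crossings H' A B"
  unfolding crossings_def using thru_mono by blast

text \<open>The geometric content of being a T-mesh, phrased for the union of all edges of each direction. The
box with corners \<open>A\<close> and \<open>B\<close> is the region. \<open>ends\<close> says that a segment stops only on
the boundary or in the relative interior of a segment of the other direction, which excludes L-shaped
and dangling ends; \<open>hit\<close> says that every segment off the boundary carries a crossing.\<close>

locale arrangement =
  fixes H :: "bool \<Rightarrow> (real \<times> real) set" and A B :: "bool \<Rightarrow> real"
  assumes closed_H: "closed (H d)"
    and finite_rows: "finite (co (\<not> d) ` H d)"
    and in_box: "p \<in> H d \<Longrightarrow> A e \<le> co e p \<and> co e p \<le> B e"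
    and A_less_B: "A d < B d"
    and sides: "t = A (\<not> d) \<or> t = B (\<not> d) \<Longrightarrow> A d \<le> s \<Longrightarrow> s \<le> B d \<Longrightarrow> mk d s t \<in> H d"
    and ends: "p \<in> H d \<Longrightarrow> thru H d p \<or> co d p = A d \<or> co d p = B d \<or> thru H (\<not> d) p"
    and hit: "p \<in> H d \<Longrightarrow> A (\<not> d) < co (\<not> d) p \<Longrightarrow> co (\<not> d) p < B (\<not> d) \<Longrightarrow>
      \<exists>z \<in> crossings H A B. adj H d p z"
begin

abbreviation X where "X \<equiv> crossings H A B"

definition nodes where "nodes = H True \<inter> H False"

lemma nodes_iff: "p \<in> nodes \<longleftrightarrow> p \<in> H d \<and> p \<in> H (\<not> d)"
  unfolding nodes_def by (cases d) auto

lemma nodes_in: "p \<in> nodes \<Longrightarrow> p \<in> H d"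
  using nodes_iff by blast

lemma finite_nodes: "finite nodes"
proof (rule finite_subset)
  show "nodes \<subseteq> co True ` H False \<times> co False ` H True"
    unfolding nodes_def co_def by (auto simp: image_iff) (metis IntI fst_conv snd_conv)+
  show "finite (co True ` H False \<times> co False ` H True)"
    using finite_rows[of True] finite_rows[of False] by auto
qed

lemma X_nodes: "X \<subseteq> nodes"
  unfolding crossings_def nodes_def using thru_in by blast

lemma finite_X: "finite X"
  using finite_nodes X_nodes finite_subset by blast

lemma X_in: "z \<in> X \<Longrightarrow> z \<in> H d"
  unfolding crossings_def using thru_in by blast

text \<open>By \<open>ends\<close> such a point is on the boundary or on a segment of the other direction. This applies to
the ends of maximal segments.\<close>

lemma not_thru_in_nodes: "p \<in> H d \<Longrightarrow> \<not> thru H d p \<Longrightarrow> p \<in> nodes"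
  using ends[of p d] in_box[of p d "\<not> d"] sides[of "co d p" "\<not> d" "co (\<not> d) p"] thru_in[of H "\<not> d" p]
  by (auto simp: nodes_iff[of p d] mk_flip)

text \<open>The maximal segment through a point is a component of a compact subset of the line, hence a compact
interval.\<close>

lemma extent:
  assumes p: "p \<in> H d"
  obtains a b where "a \<le> co d p" "co d p \<le> b"
    "\<forall>q. adj H d p q \<longleftrightarrow> co (\<not> d) q = co (\<not> d) p \<and> a \<le> co d q \<and> co d q \<le> b"
    "mk d a (co (\<not> d) p) \<in> H d" "\<not> bwd H d (mk d a (co (\<not> d) p))"
    "mk d b (co (\<not> d) p) \<in> H d" "\<not> fwd H d (mk d b (co (\<not> d) p))"
proof -
  define t where "t = co (\<not> d) p"
  define R where "R = (\<lambda>s. mk d s t) -` H d"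
  have closed_R: "closed R" unfolding R_def
    using closed_H by (intro closed_vimage) (auto intro!: continuous_intros)
  have "R \<subseteq> {A d..B d}" using in_box[of "mk d _ t" d d] unfolding R_def by auto
  then have bdd: "bounded R" using bounded_closed_interval bounded_subset by (metis cbox_interval bounded_cbox)
  have pR: "co d p \<in> R" using p unfolding R_def t_def by simp
  define C where "C = connected_component_set R (co d p)"
  have "compact C" "connected C" "C \<subseteq> R" "co d p \<in> C"
    unfolding C_def using closed_R bdd pR
    by (auto simp: compact_eq_bounded_closed closed_connected_component connected_component_subset
        connected_component_refl_eq intro: bounded_subset[OF _ connected_component_subset])
  then obtain a b where ab: "C = {a..b}" using connected_compact_interval_1[of C] by (auto simp: cbox_interval)
  have in_C: "s \<in> C" if "closed_segment (co d p) s \<subseteq> R" for s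
  proof -
    have "closed_segment (co d p) s \<subseteq> C" unfolding C_def
      using that by (intro connected_component_maximal) auto
    then show ?thesis by auto
  qed
  have cov: "covers H d t a b" using ab \<open>C \<subseteq> R\<close> unfolding covers_def R_def by auto
  have cp: "a \<le> co d p" "co d p \<le> b" using \<open>co d p \<in> C\<close> ab by auto
  have ext: "a \<le> s" "s \<le> b" if "covers H d t (min (co d p) s) (max (co d p) s)" for s
  proof -
    have "closed_segment (co d p) s \<subseteq> R"
      using that unfolding covers_def R_def closed_segment_eq_real_ivl by (auto split: if_splits)
    then show "a \<le> s" "s \<le> b" using in_C ab by auto
  qed
  have adj: "adj H d p q \<longleftrightarrow> co (\<not> d) q = t \<and> a \<le> co d q \<and> co d q \<le> b" for q
    using ext[of "co d q"] cp cov unfolding adj_def t_def[symmetric]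
    by (auto intro: covers_subset)
  have nb: "\<not> bwd H d (mk d a t)"
  proof
    assume "bwd H d (mk d a t)"
    then obtain a' where "a' < a" "covers H d t a' a" unfolding bwd_def by auto
    then have "covers H d t a' b" using cov covers_join by blast
    then have "covers H d t (min (co d p) a') (max (co d p) a')"
      using cp \<open>a' < a\<close> by (auto intro: covers_subset)
    then show False using ext \<open>a' < a\<close> by fastforce
  qed
  have nf: "\<not> fwd H d (mk d b t)"
  proof
    assume "fwd H d (mk d b t)"
    then obtain b' where "b < b'" "covers H d t b b'" unfolding fwd_def by auto
    then have "covers H d t a b'" using cov covers_join by blast
    then have "covers H d t (min (co d p) b') (max (co d p) b')"
      using cp \<open>b < b'\<close> by (auto intro: covers_subset)
    then show False using ext \<open>b < b'\<close> by fastforce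
  qed
  have "mk d a t \<in> H d" "mk d b t \<in> H d" using cov cp unfolding covers_def by auto
  then show thesis using that[of a b] cp adj nb nf unfolding t_def by blast
qed

definition consec :: "bool \<Rightarrow> real \<Rightarrow> real \<Rightarrow> real \<Rightarrow> bool" where
  "consec d t a b \<longleftrightarrow> a < b \<and> mk d a t \<in> nodes \<and> mk d b t \<in> nodes \<and> covers H d t a b \<and>
     (\<forall>s. a < s \<and> s < b \<longrightarrow> mk d s t \<notin> nodes)"

lemma consec_right_unique: "consec d t a b \<Longrightarrow> consec d t a b' \<Longrightarrow> b = b'"
  unfolding consec_def by (metis linorder_neqE_linordered_idom)

lemma consec_left_unique: "consec d t a b \<Longrightarrow> consec d t a' b \<Longrightarrow> a = a'"
  unfolding consec_def by (metis linorder_neqE_linordered_idom)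

lemma finite_row_nodes: "finite {s. mk d s t \<in> nodes \<and> P s}"
proof (rule finite_subset)
  show "{s. mk d s t \<in> nodes \<and> P s} \<subseteq> co d ` nodes" by (auto simp: image_iff) (metis co_mk(1))
qed (use finite_nodes in auto)

text \<open>The maximal segment to the right of the vertex ends in a vertex, so there is a first vertex on it.\<close>

lemma fwd_iff_consec:
  assumes v: "mk d s t \<in> nodes"
  shows "fwd H d (mk d s t) \<longleftrightarrow> (\<exists>b. consec d t s b)"
proof
  assume "\<exists>b. consec d t s b"
  then show "fwd H d (mk d s t)" unfolding consec_def fwd_def by auto
next
  assume f: "fwd H d (mk d s t)"
  then obtain c where c: "s < c" "covers H d t s c" unfolding fwd_def by auto
  have vH: "mk d s t \<in> H d" using v nodes_iff by blast
  obtain a b where ab: "a \<le> s" "s \<le> b"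
    "\<forall>q. adj H d (mk d s t) q \<longleftrightarrow> co (\<not> d) q = t \<and> a \<le> co d q \<and> co d q \<le> b"
    "mk d a t \<in> H d" "\<not> bwd H d (mk d a t)" "mk d b t \<in> H d" "\<not> fwd H d (mk d b t)"
    using extent[OF vH] unfolding co_mk by blast
  define e where "e = b"
  have e: "s \<le> e" "\<And>q. adj H d (mk d s t) q \<Longrightarrow> co d q \<le> e" "adj H d (mk d s t) (mk d e t)"
    "mk d e t \<in> H d" "\<not> fwd H d (mk d e t)"
    using ab by (auto simp: e_def simp del: split_paired_All)
  have "adj H d (mk d s t) (mk d c t)" using c by (simp add: adj_le)
  then have "c \<le> e" using e(2) by fastforce
  then have se: "s < e" using c by simp
  have "mk d e t \<in> nodes" using not_thru_in_nodes[OF e(4)] e(5) by (simp add: thru_def)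
  define Q where "Q = {u. mk d u t \<in> nodes \<and> s < u \<and> u \<le> e}"
  have Q: "finite Q" "Q \<noteq> {}" unfolding Q_def using finite_row_nodes \<open>mk d e t \<in> nodes\<close> se by auto
  have M: "Min Q \<in> Q" "\<And>u. u \<in> Q \<Longrightarrow> Min Q \<le> u" using Q by auto
  have "covers H d t s e" using e(3) se by (simp add: adj_le)
  then have "consec d t s (Min Q)"
    using M v unfolding consec_def Q_def by (force intro: covers_subset)
  then show "\<exists>b. consec d t s b" by blast
qed

lemma bwd_iff_consec:
  assumes v: "mk d s t \<in> nodes"
  shows "bwd H d (mk d s t) \<longleftrightarrow> (\<exists>a. consec d t a s)"
proof
  assume "\<exists>a. consec d t a s"
  then show "bwd H d (mk d s t)" unfolding consec_def bwd_def by auto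
next
  assume f: "bwd H d (mk d s t)"
  then obtain c where c: "c < s" "covers H d t c s" unfolding bwd_def by auto
  have vH: "mk d s t \<in> H d" using v nodes_iff by blast
  obtain a b where ab: "a \<le> s" "s \<le> b"
    "\<forall>q. adj H d (mk d s t) q \<longleftrightarrow> co (\<not> d) q = t \<and> a \<le> co d q \<and> co d q \<le> b"
    "mk d a t \<in> H d" "\<not> bwd H d (mk d a t)" "mk d b t \<in> H d" "\<not> fwd H d (mk d b t)"
    using extent[OF vH] unfolding co_mk by blast
  define e where "e = a"
  have e: "e \<le> s" "\<And>q. adj H d (mk d s t) q \<Longrightarrow> e \<le> co d q" "adj H d (mk d s t) (mk d e t)"
    "mk d e t \<in> H d" "\<not> bwd H d (mk d e t)"
    using ab by (auto simp: e_def simp del: split_paired_All)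
  have "adj H d (mk d s t) (mk d c t)" using c by (simp add: adj_def)
  then have "e \<le> c" using e(2) by fastforce
  then have se: "e < s" using c by simp
  have "mk d e t \<in> nodes" using not_thru_in_nodes[OF e(4)] e(5) by (simp add: thru_def)
  define Q where "Q = {u. mk d u t \<in> nodes \<and> e \<le> u \<and> u < s}"
  have Q: "finite Q" "Q \<noteq> {}" unfolding Q_def using finite_row_nodes \<open>mk d e t \<in> nodes\<close> se by auto
  have M: "Max Q \<in> Q" "\<And>u. u \<in> Q \<Longrightarrow> u \<le> Max Q" using Q by auto
  have "covers H d t e s" using e(3) se by (simp add: adj_def)
  then have "consec d t (Max Q) s"
    using M v unfolding consec_def Q_def by (force intro: covers_subset)
  then show "\<exists>a. consec d t a s" by blast
qed

text \<open>The horizontal edges for \<open>d = True\<close> and the vertical edges for \<open>d = False\<close>.\<close>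

definition dedges where
  "dedges d = {closed_segment (mk d a t) (mk d b t) | a b t. consec d t a b}"

lemma consec_mem_end:
  assumes "consec d t a b" "v \<in> closed_segment (mk d a t) (mk d b t)" "v \<in> nodes"
  shows "co (\<not> d) v = t \<and> (co d v = a \<or> co d v = b)"
proof -
  have "co (\<not> d) v = t" "a \<le> co d v" "co d v \<le> b"
    using assms by (auto simp: consec_def in_closed_segment_mk_le)
  moreover have "mk d (co d v) t = v" using calculation(1) by (metis mk_co)
  ultimately show ?thesis using assms unfolding consec_def by (metis less_eq_real_def)
qed

text \<open>An edge at a vertex leads forwards or backwards to the next vertex. So the degree of a vertex can be
read off from the arrangement.\<close>

lemma dedges_at:
  assumes v: "v \<in> nodes"
  shows "finite {e \<in> dedges d. v \<in> e} \<and>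
    card {e \<in> dedges d. v \<in> e} = of_bool (fwd H d v) + of_bool (bwd H d v)"
proof -
  define s t where "s = co d v" and "t = co (\<not> d) v"
  have v_eq: "v = mk d s t" by (simp add: s_def t_def)
  define P where "P = {closed_segment (mk d s t) (mk d b t) | b. consec d t s b}"
  define Q where "Q = {closed_segment (mk d a t) (mk d s t) | a. consec d t a s}"
  have "{e \<in> dedges d. v \<in> e} = P \<union> Q"
  proof (intro equalityI subsetI)
    fix e assume "e \<in> {e \<in> dedges d. v \<in> e}"
    then obtain a b t' where e: "e = closed_segment (mk d a t') (mk d b t')" "consec d t' a b" "v \<in> e"
      unfolding dedges_def by blast
    then show "e \<in> P \<union> Q" using consec_mem_end[of d t' a b v] v unfolding P_def Q_def s_def t_def by auto
  next
    fix e assume "e \<in> P \<union> Q"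
    then show "e \<in> {e \<in> dedges d. v \<in> e}" unfolding P_def Q_def dedges_def v_eq by auto
  qed
  moreover have "P \<inter> Q = {}"
  proof -
    have False if "consec d t s b" "consec d t a s" "{mk d s t, mk d b t} = {mk d a t, mk d s t}" for a b
      using that by (auto simp: doubleton_eq_iff consec_def)
    then show ?thesis unfolding P_def Q_def by auto
  qed
  moreover have "finite P \<and> card P = of_bool (fwd H d v)"
  proof (cases "fwd H d v")
    case True
    then obtain b where "consec d t s b" using fwd_iff_consec v v_eq by metis
    then have "P = {closed_segment (mk d s t) (mk d b t)}"
      unfolding P_def using consec_right_unique by blast
    then show ?thesis using True by simp
  next
    case False
    then have "P = {}" using fwd_iff_consec v v_eq unfolding P_def by auto
    then show ?thesis using False by simp
  qed
  moreover have "finite Q \<and> card Q = of_bool (bwd H d v)"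
  proof (cases "bwd H d v")
    case True
    then obtain a where "consec d t a s" using bwd_iff_consec v v_eq by metis
    then have "Q = {closed_segment (mk d a t) (mk d s t)}"
      unfolding Q_def using consec_left_unique by blast
    then show ?thesis using True by simp
  next
    case False
    then have "Q = {}" using bwd_iff_consec v v_eq unfolding Q_def by auto
    then show ?thesis using False by simp
  qed
  ultimately show ?thesis by (simp add: card_Un_disjoint)
qed

lemma dedges_disjoint: "dedges True \<inter> dedges False = {}"
proof -
  have False if "consec True t a b" "consec False t' a' b'"
    "{mk True a t, mk True b t} = {mk False a' t', mk False b' t'}" for a b t a' b' t'
    using that by (auto simp: doubleton_eq_iff consec_def mk_def)
  then show ?thesis unfolding dedges_def by auto
qed

text \<open>A segment in direction \<open>d\<close> meets the finitely many lines of the other direction in finitely many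
points, so its part outside \<open>H d\<close>, being relatively open, cannot be covered by \<open>H (\<not> d)\<close>.\<close>

lemma skeleton_covers:
  assumes ab: "a < b" and sk: "\<And>s. a \<le> s \<Longrightarrow> s \<le> b \<Longrightarrow> mk d s t \<in> H d \<union> H (\<not> d)"
  shows "covers H d t a b"
  unfolding covers_def
proof (intro allI impI, rule ccontr)
  fix s assume s: "a \<le> s \<and> s \<le> b" and no: "mk d s t \<notin> H d"
  have "open ((\<lambda>s. mk d s t) -` (- H d))"
    using closed_H by (intro open_vimage) (auto intro!: continuous_intros)
  then obtain r where r: "r > 0" "ball s r \<subseteq> (\<lambda>s. mk d s t) -` (- H d)"
    using no openE[of "(\<lambda>s. mk d s t) -` (- H d)" s] by auto
  define J where "J = {max a (s - r) <..< min b (s + r)}"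
  have J: "u \<in> co d ` H (\<not> d)" if "u \<in> J" for u
  proof -
    have "u \<in> ball s r" using that unfolding J_def by (auto simp: dist_real_def)
    then have "mk d u t \<notin> H d" using r by blast
    then have "mk d u t \<in> H (\<not> d)" using sk[of u] that unfolding J_def by auto
    then show ?thesis by (metis co_mk(1) imageI)
  qed
  have "infinite J" unfolding J_def using r ab s by (intro infinite_Ioo) auto
  moreover have "finite (co d ` H (\<not> d))" using finite_rows[of "\<not> d"] by simp
  moreover have "J \<subseteq> co d ` H (\<not> d)" using J by blast
  ultimately show False using finite_subset by blast
qed

end

section \<open>Edges, vertices and l-edges of a T-mesh\<close>

text \<open>The interface between cells and arrangements: from here on, all notions defined through the cells of
\<open>T\<close> are expressed through \<open>H\<close>.\<close>

locale tmesh = arrangement +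
  fixes T :: "cell set"
  assumes vertices_eq: "vertices T = H True \<inter> H False"
    and skeleton_eq: "skeleton T = H True \<union> H False"
    and region_eq: "region T = cbox (A True, A False) (B True, B False)"
begin

lemma vertices_nodes: "vertices T = nodes"
  by (simp add: vertices_eq nodes_def)

lemma co_True [simp]: "co True p = fst p" and co_False [simp]: "co False p = snd p"
  by (auto simp: co_def)

lemma in_region: "p \<in> region T \<longleftrightarrow> (\<forall>d. A d \<le> co d p \<and> co d p \<le> B d)"
  unfolding region_eq all_bool_eq by (cases p) (auto simp: cbox_Pair_eq)

lemma in_interior: "p \<in> interior (region T) \<longleftrightarrow> inside_box A B p"
  unfolding region_eq inside_box_def all_bool_eq
  by (cases p) (auto simp: cbox_Pair_eq interior_Times)

lemma in_frontier: "p \<in> frontier (region T) \<longleftrightarrow> p \<in> region T \<and> \<not> inside_box A B p"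
  using in_interior[of p] unfolding frontier_def by (simp add: region_eq)

lemma nodes_in_region: "v \<in> nodes \<Longrightarrow> v \<in> region T"
  unfolding nodes_def in_region using in_box by blast

lemma covers_skeleton_iff:
  assumes "a < b"
  shows "closed_segment (mk d a t) (mk d b t) \<subseteq> skeleton T \<longleftrightarrow> covers H d t a b"
proof -
  have sk: "skeleton T = H d \<union> H (\<not> d)" unfolding skeleton_eq by (cases d) auto
  have ivl: "closed_segment a b = {a..b}" using assms by (simp add: closed_segment_eq_real_ivl)
  show ?thesis
  proof
    assume sub: "closed_segment (mk d a t) (mk d b t) \<subseteq> skeleton T"
    show "covers H d t a b"
    proof (rule skeleton_covers[OF assms])
      fix s assume "a \<le> s" "s \<le> b"
      then have "mk d s t \<in> closed_segment (mk d a t) (mk d b t)"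
        unfolding closed_segment_mk ivl by simp
      then show "mk d s t \<in> H d \<union> H (\<not> d)" using sub unfolding sk by (rule rev_subsetD)
    qed
  next
    assume "covers H d t a b"
    then show "closed_segment (mk d a t) (mk d b t) \<subseteq> skeleton T"
      unfolding closed_segment_mk ivl sk covers_def by auto
  qed
qed

lemma consec_iff:
  "consec d t a b \<longleftrightarrow> a < b \<and> mk d a t \<in> vertices T \<and> mk d b t \<in> vertices T \<and>
     closed_segment (mk d a t) (mk d b t) \<subseteq> skeleton T \<and>
     open_segment (mk d a t) (mk d b t) \<inter> vertices T = {}"
proof (cases "a < b")
  case True
  have "open_segment (mk d a t) (mk d b t) = (\<lambda>s. mk d s t) ` {a<..<b}"
    using in_open_segment_mk[OF True] by (auto simp: image_iff eq_mk_iff)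
  then show ?thesis
    using True unfolding consec_def vertices_nodes covers_skeleton_iff[OF True]
    by (auto simp: disjoint_iff)
qed (simp add: consec_def)

lemma h_edges_eq: "h_edges T = dedges True"
  unfolding h_edges_def dedges_def consec_iff mk_def by auto

lemma v_edges_eq: "v_edges T = dedges False"
  unfolding v_edges_def dedges_def consec_iff mk_def by auto

lemma edges_at:
  assumes v: "v \<in> nodes"
  shows "card {e \<in> edges T. v \<in> e} =
    (\<Sum>d\<in>UNIV. of_bool (fwd H d v) + of_bool (bwd H d v))"
proof -
  have "{e \<in> edges T. v \<in> e} = {e \<in> dedges True. v \<in> e} \<union> {e \<in> dedges False. v \<in> e}"
    unfolding edges_def h_edges_eq v_edges_eq by auto
  moreover have "{e \<in> dedges True. v \<in> e} \<inter> {e \<in> dedges False. v \<in> e} = {}"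
    using dedges_disjoint by auto
  ultimately show ?thesis
    using dedges_at[OF v, of True] dedges_at[OF v, of False]
    by (simp add: card_Un_disjoint UNIV_bool)
qed

lemma crossing_vertices_eq: "crossing_vertices T = X"
proof (intro equalityI subsetI)
  fix v assume "v \<in> crossing_vertices T"
  then have v: "v \<in> nodes" "inside_box A B v" "card {e \<in> edges T. v \<in> e} = 4"
    unfolding crossing_vertices_def interior_vertices_def vertices_nodes using in_interior by auto
  then have "\<forall>d. thru H d v"
    unfolding edges_at[OF v(1)] UNIV_bool thru_def all_bool_eq
    by (cases "fwd H True v"; cases "bwd H True v"; cases "fwd H False v"; cases "bwd H False v") simp_all
  then show "v \<in> X" using v unfolding crossings_def by auto
next
  fix v assume v: "v \<in> X"
  then have "v \<in> nodes" "inside_box A B v" "\<forall>d. thru H d v" using X_nodes unfolding crossings_def by auto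
  then show "v \<in> crossing_vertices T"
    unfolding crossing_vertices_def interior_vertices_def vertices_nodes
    using in_interior edges_at[of v] by (auto simp: UNIV_bool thru_def)
qed

text \<open>The T-vertices of direction \<open>d\<close> in terms of the arrangement.\<close>

definition Tv where
  "Tv d = {v \<in> nodes. inside_box A B v \<and> thru H (\<not> d) v \<and> fwd H d v \<noteq> bwd H d v}"

text \<open>By \<open>ends\<close> an interior vertex can be passed in at least one direction; degree three leaves exactly
one possibility for the other direction.\<close>

lemma T_vertices_dir:
  "{v \<in> T_vertices T. card {e \<in> dedges d. v \<in> e} = 1} = Tv d"
proof -
  have "v \<in> interior_vertices T \<and> card {e \<in> edges T. v \<in> e} = 3 \<and> card {e \<in> dedges d. v \<in> e} = 1 \<longleftrightarrow> v \<in> Tv d" for v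
  proof (cases "v \<in> nodes")
    case True
    have "(\<Sum>d\<in>UNIV. of_bool (fwd H d v) + of_bool (bwd H d v)) =
      (of_bool (fwd H d v) + of_bool (bwd H d v) + (of_bool (fwd H (\<not>d) v) + of_bool (bwd H (\<not>d) v)) :: nat)"
      by (cases d) (auto simp: UNIV_bool)
    then show ?thesis
      using True dedges_at[OF True, of d] edges_at[OF True] in_interior[of v]
      unfolding Tv_def interior_vertices_def vertices_nodes thru_def
      by (cases "fwd H d v"; cases "bwd H d v"; cases "fwd H (\<not> d) v"; cases "bwd H (\<not> d) v") auto
  qed (auto simp: Tv_def interior_vertices_def vertices_nodes)
  then show ?thesis unfolding T_vertices_def by auto
qed

definition dledges where
  "dledges d = {closed_segment (mk d a t) (mk d b t) | a b t. a < b \<and>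
     mk d a t \<in> boundary_vertices T \<union> Tv d \<and> mk d b t \<in> boundary_vertices T \<union> Tv d \<and>
     (\<exists>A \<subseteq> {e \<in> dedges d. interior_edge T e}. closed_segment (mk d a t) (mk d b t) = \<Union>A)}"

lemma h_l_edges_eq: "h_l_edges T = dledges True"
  using T_vertices_dir[of True]
  unfolding h_l_edges_def dledges_def h_T_vertices_def h_edges_eq by (auto simp: mk_def)

lemma v_l_edges_eq: "v_l_edges T = dledges False"
  using T_vertices_dir[of False]
  unfolding v_l_edges_def dledges_def v_T_vertices_def v_edges_eq by (auto simp: mk_def)

definition l_edge where "l_edge d p = {q. adj H d p q}"

lemma l_edge_seg:
  assumes z: "z \<in> X"
  obtains a b t where "a < co d z" "co d z < b" "t = co (\<not> d) z" "l_edge d z = closed_segment (mk d a t) (mk d b t)"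
    "mk d a t \<in> nodes" "mk d b t \<in> nodes" "\<not> bwd H d (mk d a t)" "\<not> fwd H d (mk d b t)" "covers H d t a b"
proof -
  define t where "t = co (\<not> d) z"
  obtain a b where ab: "a \<le> co d z" "co d z \<le> b"
    "\<forall>q. adj H d z q \<longleftrightarrow> co (\<not> d) q = t \<and> a \<le> co d q \<and> co d q \<le> b"
    "mk d a t \<in> H d" "\<not> bwd H d (mk d a t)" "mk d b t \<in> H d" "\<not> fwd H d (mk d b t)"
    using extent[OF X_in[OF z, of d]] unfolding t_def by blast
  have th: "thru H d z" using z by (auto simp: crossings_def)
  have "mk d a t \<noteq> z" "mk d b t \<noteq> z" using th ab by (auto simp: thru_def)
  then have lt: "a < co d z" "co d z < b" using ab(1,2) by (auto simp: t_def eq_mk_iff less_le)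
  have "adj H d z (mk d a t)" "adj H d z (mk d b t)" using ab(1-3) by (auto simp del: split_paired_All)
  then have "covers H d t a b"
    using lt covers_join[of H d t a "co d z" b] by (auto simp: adj_def t_def)
  moreover have "l_edge d z = closed_segment (mk d a t) (mk d b t)"
    unfolding l_edge_def using ab(3) in_closed_segment_mk_le[of a b] lt by auto
  moreover have "mk d a t \<in> nodes" "mk d b t \<in> nodes" using not_thru_in_nodes ab(4-7) by (auto simp: thru_def)
  ultimately show thesis using that[of a b t] lt ab by (auto simp: t_def)
qed

lemma l_edge_eq: "adj H d p q \<Longrightarrow> l_edge d p = l_edge d q"
  unfolding l_edge_def using adj_sym adj_trans by blast

text \<open>Between the vertices \<open>a\<close> and \<open>b\<close>, the edge over \<open>s\<close> starts at the last vertex up to \<open>s\<close>.\<close>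

lemma segment_cover:
  assumes "a < b" "covers H d t a b" "mk d a t \<in> nodes" "mk d b t \<in> nodes" "a \<le> s" "s \<le> b"
  shows "\<exists>u w. consec d t u w \<and> a \<le> u \<and> u \<le> s \<and> s \<le> w \<and> w \<le> b"
proof (cases "s < b")
  case True
  define Q where "Q = {u. mk d u t \<in> nodes \<and> (a \<le> u \<and> u \<le> s)}"
  have Q: "finite Q" "Q \<noteq> {}" unfolding Q_def using finite_row_nodes assms by auto
  have M: "Max Q \<in> Q" "\<And>u. u \<in> Q \<Longrightarrow> u \<le> Max Q" using Q by auto
  have "covers H d t (Max Q) b" using assms(2) M(1) by (auto simp: Q_def intro: covers_subset)
  moreover have "Max Q < b" using M(1) True unfolding Q_def by simp
  ultimately have "fwd H d (mk d (Max Q) t)" unfolding fwd_def by auto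
  then obtain w where w: "consec d t (Max Q) w" using fwd_iff_consec M(1) unfolding Q_def by blast
  have "s < w"
  proof (rule ccontr)
    assume "\<not> s < w"
    moreover have "Max Q < w" "mk d w t \<in> nodes" using w by (auto simp: consec_def)
    moreover have "a \<le> Max Q" using M(1) unfolding Q_def by simp
    ultimately have "w \<in> Q" unfolding Q_def by simp
    then show False using M(2)[of w] \<open>Max Q < w\<close> by simp
  qed
  moreover have MQ: "a \<le> Max Q" "Max Q \<le> s" using M(1) unfolding Q_def by simp_all
  moreover have "w \<le> b" using w assms(4) True MQ unfolding consec_def by (meson leI order.strict_trans1)
  ultimately show ?thesis using w by (intro exI[of _ "Max Q"] exI[of _ w]) simp
next
  case False
  then have s: "s = b" using assms by simp
  have "bwd H d (mk d b t)" using assms unfolding bwd_def by auto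
  then obtain u where u: "consec d t u b" using bwd_iff_consec assms(4) by blast
  have "a \<le> u" using u assms(1,3) unfolding consec_def by (meson leI)
  moreover have "u \<le> b" using u unfolding consec_def by simp
  ultimately show ?thesis using u s by blast
qed

lemma interior_edge_consec:
  assumes c: "consec d t a b" and t: "A (\<not> d) < t" "t < B (\<not> d)"
  shows "interior_edge T (closed_segment (mk d a t) (mk d b t))"
proof -
  let ?e = "closed_segment (mk d a t) (mk d b t)"
  have "?e \<in> edges T" unfolding edges_def h_edges_eq v_edges_eq dedges_def using c by (cases d) auto
  moreover have "\<not> ?e \<subseteq> frontier (region T)"
  proof -
    have ab: "a < b" "mk d a t \<in> H d" "mk d b t \<in> H d" using c nodes_in by (auto simp: consec_def simp del: split_paired_All)
    let ?m = "mk d ((a + b) / 2) t"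
    have "A d \<le> a" "b \<le> B d" using in_box[OF ab(2), of d] in_box[OF ab(3), of d] by auto
    then have "A d < co d ?m \<and> co d ?m < B d" "A (\<not> d) < co (\<not> d) ?m \<and> co (\<not> d) ?m < B (\<not> d)"
      using ab t by (auto simp: field_simps)
    then have "inside_box A B ?m" by (intro inside_box_dirI[where d=d])
    moreover have "?m \<in> ?e" using ab by (auto simp: in_closed_segment_mk_le field_simps)
    ultimately show ?thesis using in_frontier by blast
  qed
  ultimately show ?thesis unfolding interior_edge_def by blast
qed

lemma boundary_edge_consec:
  assumes c: "consec d t a b" and t: "t = A (\<not> d) \<or> t = B (\<not> d)"
  shows "\<not> interior_edge T (closed_segment (mk d a t) (mk d b t))"
proof -
  have ab: "a < b" "covers H d t a b" using c by (auto simp: consec_def)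
  have "p \<in> frontier (region T)" if "p \<in> closed_segment (mk d a t) (mk d b t)" for p
  proof -
    have "co (\<not> d) p = t" "a \<le> co d p" "co d p \<le> b" using that ab by (auto simp: in_closed_segment_mk_le)
    then have "p \<in> H d" using ab(2) unfolding covers_def by (metis mk_co)
    then have "p \<in> region T" using in_box in_region by blast
    moreover have "\<not> inside_box A B p" using t \<open>co (\<not> d) p = t\<close> unfolding inside_box_def by (metis less_irrefl)
    ultimately show ?thesis using in_frontier by blast
  qed
  then show ?thesis unfolding interior_edge_def by blast
qed

text \<open>An l-edge cannot be prolonged, because a boundary vertex or a T-vertex of its direction has no
continuation; so it is a maximal segment, and by \<open>hit\<close> it is determined by any crossing on it.
Conversely, the end of a maximal segment through a crossing cannot be passed in direction \<open>d\<close>, so by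
\<open>ends\<close> it is a boundary vertex or a T-vertex.\<close>

lemma dledges_eq: "dledges d = l_edge d ` X"
proof (intro equalityI subsetI)
  fix l assume "l \<in> dledges d"
  then obtain a b t where l: "l = closed_segment (mk d a t) (mk d b t)" "a < b"
    and ends: "mk d a t \<in> boundary_vertices T \<union> Tv d" "mk d b t \<in> boundary_vertices T \<union> Tv d"
    and ex: "\<exists>A \<subseteq> {e \<in> dedges d. interior_edge T e}. closed_segment (mk d a t) (mk d b t) = \<Union>A"
    unfolding dledges_def by blast
  from ex obtain E where E: "E \<subseteq> {e \<in> dedges d. interior_edge T e}" "l = \<Union>E" unfolding l(1) by blast
  have E1: "\<exists>u w. consec d t u w \<and> e = closed_segment (mk d u t) (mk d w t) \<and> t \<noteq> A (\<not> d) \<and> t \<noteq> B (\<not> d)"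
    if e: "e \<in> E" for e
  proof -
    obtain u w t' where e': "e = closed_segment (mk d u t') (mk d w t')" "consec d t' u w" "interior_edge T e"
      using E(1) e unfolding dedges_def by blast
    have "mk d u t' \<in> l" using e e'(1) E(2) by auto
    then have "t' = t" using l by (auto simp: in_closed_segment_mk)
    then show ?thesis using e' boundary_edge_consec by blast
  qed
  have cov: "covers H d t a b"
    unfolding covers_def
  proof (intro allI impI)
    fix s assume "a \<le> s \<and> s \<le> b"
    then have "mk d s t \<in> l" using l by (simp add: in_closed_segment_mk_le)
    then obtain e where "e \<in> E" "mk d s t \<in> e" using E by blast
    then obtain u w where "consec d t u w" "mk d s t \<in> closed_segment (mk d u t) (mk d w t)" using E1 by blast
    then show "mk d s t \<in> H d" by (auto simp: consec_def covers_def in_closed_segment_mk_le)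
  qed
  have aH: "mk d a t \<in> H d" using cov l by (auto simp: covers_def)
  have "l \<noteq> {}" using l by auto
  then obtain e where "e \<in> E" using E by blast
  then have "t \<noteq> A (\<not> d)" "t \<noteq> B (\<not> d)" using E1 by blast+
  then have t: "A (\<not> d) < t" "t < B (\<not> d)" using in_box[OF aH, of "\<not> d"] by auto
  then obtain z where z: "z \<in> X" "adj H d (mk d a t) z" using hit[OF aH] by auto
  obtain a' b' t' where z': "a' < co d z" "co d z < b'" "t' = co (\<not> d) z"
    "l_edge d z = closed_segment (mk d a' t') (mk d b' t')" "mk d a' t' \<in> nodes" "mk d b' t' \<in> nodes"
    "\<not> bwd H d (mk d a' t')" "\<not> fwd H d (mk d b' t')" "covers H d t' a' b'"
    using l_edge_seg[OF z(1), of d] by blast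
  have t': "t' = t" using z z' by (auto simp: adj_def)
  have "adj H d z (mk d a t)" using z adj_sym by blast
  moreover have "adj H d (mk d a t) (mk d b t)" using cov l by (simp add: adj_def)
  ultimately have "mk d a t \<in> l_edge d z" "mk d b t \<in> l_edge d z" unfolding l_edge_def using adj_trans by blast+
  then have aabb: "a' \<le> a" "b \<le> b'" using z' by (auto simp: in_closed_segment_mk_le)
  have bd: "s = A d \<or> s = B d" if "mk d s t \<in> boundary_vertices T" for s
  proof -
    have "\<not> inside_box A B (mk d s t)" "mk d s t \<in> nodes"
      using that in_frontier unfolding boundary_vertices_def vertices_nodes by auto
    moreover have "A d \<le> s \<and> s \<le> B d" using in_box[OF nodes_in[OF calculation(2), of d], of d] by simp
    ultimately show ?thesis
    proof -
      assume "\<not> inside_box A B (mk d s t)" and "A d \<le> s \<and> s \<le> B d"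
      moreover have "inside_box A B (mk d s t)" if "A d < s" "s < B d"
        using that t by (intro inside_box_dirI[where d=d]) auto
      ultimately show ?thesis by force
    qed
  qed
  have box': "A d \<le> a'" "b' \<le> B d"
    using in_box[OF nodes_in[OF z'(5), of d], of d] in_box[OF nodes_in[OF z'(6), of d], of d] by auto
  have "a = a'"
  proof (rule ccontr)
    assume "a \<noteq> a'"
    then have "a' < a" using aabb by simp
    moreover have "covers H d t a' a"
      using z'(9) t' l(2) aabb by (auto intro: covers_subset[of H d t a' b'])
    ultimately have "bwd H d (mk d a t)" unfolding bwd_def by auto
    moreover have "fwd H d (mk d a t)" unfolding fwd_def using cov l(2) by auto
    ultimately have "mk d a t \<notin> Tv d" by (simp add: Tv_def)
    then have "a = A d \<or> a = B d" using ends bd by blast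
    then show False using \<open>a' < a\<close> l(2) aabb box' by auto
  qed
  moreover have "b = b'"
  proof (rule ccontr)
    assume "b \<noteq> b'"
    then have "b < b'" using aabb by simp
    moreover have "covers H d t b b'"
      using z'(9) t' l(2) aabb by (auto intro: covers_subset[of H d t a' b'])
    ultimately have "fwd H d (mk d b t)" unfolding fwd_def by auto
    moreover have "bwd H d (mk d b t)" unfolding bwd_def using cov l(2) by auto
    ultimately have "mk d b t \<notin> Tv d" by (simp add: Tv_def)
    then have "b = A d \<or> b = B d" using ends bd by blast
    then show False using \<open>b < b'\<close> l(2) aabb box' by auto
  qed
  ultimately have "l = l_edge d z" using l(1) z'(4) t' by simp
  then show "l \<in> l_edge d ` X" using z(1) by blast
next
  fix l assume "l \<in> l_edge d ` X"
  then obtain z where z: "z \<in> X" "l = l_edge d z" by blast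
  obtain a b t where l: "a < co d z" "co d z < b" "t = co (\<not> d) z"
    "l_edge d z = closed_segment (mk d a t) (mk d b t)" "mk d a t \<in> nodes" "mk d b t \<in> nodes"
    "\<not> bwd H d (mk d a t)" "\<not> fwd H d (mk d b t)" "covers H d t a b"
    using l_edge_seg[OF z(1), of d] by blast
  have t: "A (\<not> d) < t" "t < B (\<not> d)" using z(1) l(3) by (auto simp: crossings_def inside_box_def)
  have f: "fwd H d (mk d a t)" "bwd H d (mk d b t)"
    using l by (auto simp: fwd_def bwd_def intro: less_trans)
  have end': "mk d s t \<in> boundary_vertices T \<union> Tv d"
    if s: "mk d s t \<in> nodes" "fwd H d (mk d s t) \<noteq> bwd H d (mk d s t)" for s
  proof (cases "inside_box A B (mk d s t)")
    case True
    have "\<not> thru H d (mk d s t)" using s(2) by (auto simp: thru_def)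
    moreover have "co d (mk d s t) \<noteq> A d" "co d (mk d s t) \<noteq> B d"
      using True unfolding inside_box_def by (metis less_irrefl)+
    ultimately have "thru H (\<not> d) (mk d s t)" using arrangement.ends[OF arrangement_axioms nodes_in[OF s(1)], of d] by blast
    then show ?thesis using True s unfolding Tv_def by blast
  next
    case False
    then have "mk d s t \<in> boundary_vertices T"
      unfolding boundary_vertices_def vertices_nodes using s(1) nodes_in_region in_frontier by blast
    then show ?thesis by blast
  qed
  define E where "E = {closed_segment (mk d u t) (mk d w t) | u w. consec d t u w \<and> a \<le> u \<and> w \<le> b}"
  have ab: "a < b" using l by simp
  have "E \<subseteq> {e \<in> dedges d. interior_edge T e}"
    unfolding E_def dedges_def using interior_edge_consec t by blast
  moreover have "l = \<Union>E"
  proof (intro equalityI subsetI)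
    fix p assume "p \<in> l"
    then have p: "co (\<not> d) p = t" "a \<le> co d p" "co d p \<le> b" using z(2) l(4) ab by (auto simp: in_closed_segment_mk_le)
    obtain u w where uw: "consec d t u w" "a \<le> u" "u \<le> co d p" "co d p \<le> w" "w \<le> b"
      using segment_cover[OF ab l(9,5,6) p(2,3)] by blast
    then have "p \<in> closed_segment (mk d u t) (mk d w t)" using p(1) by (simp add: in_closed_segment_mk_le)
    then show "p \<in> \<Union>E" using uw unfolding E_def by blast
  next
    fix p assume "p \<in> \<Union>E"
    then obtain u w where "consec d t u w" "a \<le> u" "w \<le> b" "p \<in> closed_segment (mk d u t) (mk d w t)"
      unfolding E_def by blast
    then show "p \<in> l" using z(2) l(4) ab by (auto simp: in_closed_segment_mk_le consec_def)
  qed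
  ultimately have "\<exists>A \<subseteq> {e \<in> dedges d. interior_edge T e}. closed_segment (mk d a t) (mk d b t) = \<Union>A"
    using z(2) l(4) by auto
  moreover have "mk d a t \<in> boundary_vertices T \<union> Tv d" "mk d b t \<in> boundary_vertices T \<union> Tv d"
    using end' l f by blast+
  ultimately show "l \<in> dledges d"
    unfolding dledges_def z(2) l(4) mem_Collect_eq using ab
    by (rule_tac exI[of _ a], rule_tac exI[of _ b], rule_tac exI[of _ t], intro conjI) (rule refl | assumption)+
qed

end

section \<open>Euler's formula for the crossing-vertex-relationship graph\<close>

context tmesh begin

lemma interior_l_edges_eq: "interior_l_edges T = l_edge True ` X \<union> l_edge False ` X"
  by (simp add: interior_l_edges_def h_l_edges_eq v_l_edges_eq dledges_eq)

lemma l_edge_nondegenerate: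
  assumes "z \<in> X"
  shows "\<exists>a b t. a < b \<and> l_edge d z = closed_segment (mk d a t) (mk d b t)"
proof -
  obtain a b t where "a < co d z" "co d z < b" "t = co (\<not> d) z"
    "l_edge d z = closed_segment (mk d a t) (mk d b t)" "mk d a t \<in> nodes" "mk d b t \<in> nodes"
    "\<not> bwd H d (mk d a t)" "\<not> fwd H d (mk d b t)" "covers H d t a b"
    using l_edge_seg[OF assms, of d] by blast
  then show ?thesis by (intro exI[of _ a] exI[of _ b] exI[of _ t]) simp
qed

lemma l_edges_disjoint: "l_edge True ` X \<inter> l_edge False ` X = {}"
proof -
  have False if z: "z \<in> X" "z' \<in> X" and eq: "l_edge True z = l_edge False z'" for z z'
  proof -
    obtain a b t where 1: "a < b" "l_edge True z = closed_segment (mk True a t) (mk True b t)"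
      using l_edge_nondegenerate[OF z(1), of True] by metis
    obtain a' b' t' where 2: "l_edge False z' = closed_segment (mk False a' t') (mk False b' t')"
      using l_edge_nondegenerate[OF z(2), of False] by metis
    have "{mk True a t, mk True b t} = {mk False a' t', mk False b' t'}" using 1 2 eq by simp
    then show False using 1(1) by (auto simp: doubleton_eq_iff mk_def)
  qed
  then show ?thesis by auto
qed

lemma open_segment_adj:
  assumes "adj H d p q" "co d p < co d q"
  shows "z \<in> open_segment p q \<longleftrightarrow> co (\<not> d) z = co (\<not> d) p \<and> co d p < co d z \<and> co d z < co d q"
proof -
  have eq: "open_segment p q = open_segment (mk d (co d p) (co (\<not> d) p)) (mk d (co d q) (co (\<not> d) p))"
    using assms(1) unfolding adj_def by (metis mk_co)
  show ?thesis by (subst eq) (rule in_open_segment_mk[OF assms(2)])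
qed

lemma adj_between:
  assumes "adj H d p q" "co d p < co d q" "co (\<not> d) z = co (\<not> d) p" "co d p \<le> co d z" "co d z \<le> co d q"
  shows "adj H d p z" "adj H d z q"
  using assms by (auto simp: adj_def intro: covers_subset)

text \<open>Consecutive crossings on an l-edge; these pairs are the edges of the graph.\<close>

definition succ where
  "succ d p q \<longleftrightarrow> p \<in> X \<and> q \<in> X \<and> adj H d p q \<and> co d p < co d q \<and> open_segment p q \<inter> X = {}"

definition cedges where
  "cedges d = {closed_segment p q | p q. succ d p q}"

lemma cvr_edges_eq: "cvr_edges T = cedges True \<union> cedges False"
proof -
  have "e \<in> cvr_edges T \<longleftrightarrow> (\<exists>d. e \<in> cedges d)" for e
  proof
    assume "e \<in> cvr_edges T"
    then obtain p q l where e: "e = closed_segment p q" "p \<noteq> q" "p \<in> X" "q \<in> X"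
      "l \<in> interior_l_edges T" "p \<in> l" "q \<in> l" "open_segment p q \<inter> X = {}"
      unfolding cvr_edges_def crossing_vertices_eq by blast
    then obtain d z where "l = l_edge d z" unfolding interior_l_edges_eq by blast
    then have pq: "adj H d p q" "adj H d q p"
      using e(6,7) adj_sym adj_trans unfolding l_edge_def by blast+
    then have "co d p \<noteq> co d q" using e(2) co_eqI unfolding adj_def by blast
    then have "succ d p q \<or> succ d q p"
      using e pq unfolding succ_def by (auto simp: open_segment_commute)
    then show "\<exists>d. e \<in> cedges d" unfolding cedges_def e(1) using closed_segment_commute by blast
  next
    assume "\<exists>d. e \<in> cedges d"
    then obtain d p q where e: "e = closed_segment p q" "succ d p q" unfolding cedges_def by blast
    have "p \<in> l_edge d p" "q \<in> l_edge d p" "p \<noteq> q" "l_edge d p \<in> interior_l_edges T"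
      using e(2) adj_refl X_in unfolding succ_def l_edge_def interior_l_edges_eq by (cases d; auto)+
    then show "e \<in> cvr_edges T"
      using e unfolding cvr_edges_def crossing_vertices_eq succ_def by blast
  qed
  then show ?thesis by (auto simp: ex_bool_eq)
qed

lemma succ_ex:
  assumes "p \<in> X" "q \<in> X" "adj H d p q" "co d p < co d q"
  obtains r where "succ d p r" "co d r \<le> co d q"
proof -
  define Q where "Q = {z \<in> X. adj H d p z \<and> co d p < co d z}"
  have Q: "finite Q" "q \<in> Q" using finite_X assms by (auto simp: Q_def)
  obtain r where r: "r \<in> Q" "\<And>z. z \<in> Q \<Longrightarrow> co d r \<le> co d z"
  proof -
    have "Min (co d ` Q) \<in> co d ` Q" using Q by (intro Min_in) auto
    then obtain r where "r \<in> Q" "Min (co d ` Q) = co d r" by blast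
    moreover have "Min (co d ` Q) \<le> co d z" if "z \<in> Q" for z using Q that by simp
    ultimately show thesis using that by metis
  qed
  have "z \<notin> X" if "z \<in> open_segment p r" for z
  proof
    assume "z \<in> X"
    have pr: "adj H d p r" "co d p < co d r" using r(1) by (auto simp: Q_def)
    have z: "co (\<not> d) z = co (\<not> d) p" "co d p < co d z" "co d z < co d r"
      using that open_segment_adj[OF pr] by auto
    then have "z \<in> Q" using adj_between(1)[OF pr z(1)] \<open>z \<in> X\<close> unfolding Q_def by simp
    then show False using r(2)[of z] z(3) by simp
  qed
  then have "succ d p r" using r(1) assms(1) unfolding succ_def Q_def by auto
  then show thesis using that r(2) Q(2) by blast
qed

lemma succ_unique:
  assumes "succ d p q" "succ d p q'"
  shows "q = q'"
proof (rule co_eqI)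
  have no: "\<not> co d q < co d q'" if pq: "succ d p q" "succ d p q'" for q q'
  proof
    assume "co d q < co d q'"
    then have "q \<in> open_segment p q'"
      using pq open_segment_adj[of d p q' q] unfolding succ_def by (auto simp: adj_def)
    then show False using pq unfolding succ_def by blast
  qed
  show "co d q = co d q'" using no[OF assms] no[OF assms(2,1)] by simp
  show "co (\<not> d) q = co (\<not> d) q'" using assms unfolding succ_def adj_def by simp
qed

text \<open>Every crossing except the last one on its l-edge has a successor.\<close>

lemma card_cedges: "finite (cedges d)" "card (cedges d) + card (l_edge d ` X) = card X"
proof -
  define N where "N = {p \<in> X. \<exists>q. succ d p q}"
  define f where "f p = closed_segment p (SOME q. succ d p q)" for p
  have f: "f p = closed_segment p q" if "succ d p q" for p q
  proof -
    have "(SOME q. succ d p q) = q" using that succ_unique by blast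
    then show ?thesis by (simp add: f_def)
  qed
  have "cedges d = f ` N"
    unfolding cedges_def N_def using f by (auto simp: image_iff) (metis succ_def)+
  moreover have "inj_on f N"
  proof (rule inj_onI)
    fix p p' assume "p \<in> N" "p' \<in> N" "f p = f p'"
    then obtain q q' where q: "succ d p q" "succ d p' q'" unfolding N_def by blast
    then have "closed_segment p q = closed_segment p' q'" using f[of p q] f[of p' q'] \<open>f p = f p'\<close> by simp
    then have "{p, q} = {p', q'}" by simp
    then show "p = p'" using q(1,2) by (auto simp: doubleton_eq_iff succ_def)
  qed
  moreover have "finite N" unfolding N_def using finite_X by simp
  ultimately have cN: "card (cedges d) = card N" and "finite (cedges d)" by (simp_all add: card_image)
  have "l_edge d ` X = l_edge d ` (X - N)"
  proof (intro equalityI subsetI)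
    fix l assume "l \<in> l_edge d ` X"
    then obtain z where z: "z \<in> X" "l = l_edge d z" by blast
    define Q where "Q = {p \<in> X. adj H d z p}"
    have Q: "finite Q" "z \<in> Q" using finite_X z adj_refl X_in by (auto simp: Q_def)
    obtain r where r: "r \<in> Q" "\<And>p. p \<in> Q \<Longrightarrow> co d p \<le> co d r"
    proof -
      have "Max (co d ` Q) \<in> co d ` Q" using Q by (intro Max_in) auto
      then obtain r where "r \<in> Q" "Max (co d ` Q) = co d r" by blast
      moreover have "co d p \<le> Max (co d ` Q)" if "p \<in> Q" for p using Q that by simp
      ultimately show thesis using that by metis
    qed
    have "r \<notin> N"
    proof
      assume "r \<in> N"
      then obtain q where q: "succ d r q" unfolding N_def by blast
      then have "q \<in> Q" using r(1) adj_trans unfolding Q_def succ_def by blast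
      then show False using r(2)[of q] q unfolding succ_def by simp
    qed
    moreover have "l_edge d r = l" using r(1) z l_edge_eq unfolding Q_def by blast
    ultimately show "l \<in> l_edge d ` (X - N)" using r(1) unfolding Q_def by blast
  qed auto
  moreover have "inj_on (l_edge d) (X - N)"
  proof (rule inj_onI)
    fix p q assume pq: "p \<in> X - N" "q \<in> X - N" "l_edge d p = l_edge d q"
    then have "q \<in> l_edge d p" using adj_refl X_in unfolding l_edge_def by blast
    then have a: "adj H d p q" "adj H d q p" using adj_sym unfolding l_edge_def by auto
    have "\<not> co d p < co d q" using pq a succ_ex[of p q d] unfolding N_def by blast
    moreover have "\<not> co d q < co d p" using pq a succ_ex[of q p d] unfolding N_def by blast
    ultimately have "co d p = co d q" by simp
    then show "p = q" using a(1) co_eqI unfolding adj_def by blast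
  qed
  ultimately have "card (l_edge d ` X) = card (X - N)" by (simp add: card_image)
  then show "card (cedges d) + card (l_edge d ` X) = card X"
    using cN finite_X card_Diff_subset[of N X] card_mono[of X N] \<open>finite N\<close> unfolding N_def by auto
  show "finite (cedges d)" by fact
qed

text \<open>A common point of two edges of different directions that is an end of neither is passed in both
directions, hence a crossing.\<close>

lemma succ_inter:
  assumes e: "succ d p q" "succ d' p' q'" and z: "z \<in> closed_segment p q" "z \<in> closed_segment p' q'" "z \<notin> X"
  shows "d = d' \<and> p = p' \<and> q = q'"
proof -
  have op: "z \<in> open_segment p q" "z \<in> open_segment p' q'"
    using e z unfolding succ_def open_segment_def by auto
  have z1: "co (\<not> d) z = co (\<not> d) p" "co d p < co d z" "co d z < co d q"
    using op(1) open_segment_adj[of d p q z] e(1) unfolding succ_def by auto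
  have z2: "co (\<not> d') z = co (\<not> d') p'" "co d' p' < co d' z" "co d' z < co d' q'"
    using op(2) open_segment_adj[of d' p' q' z] e(2) unfolding succ_def by auto
  have th: "thru H d z" if "succ d p q" "z \<in> open_segment p q" for d p q
  proof -
    have "adj H d p q" "co d p < co d q" using that unfolding succ_def by auto
    moreover have "co (\<not> d) z = co (\<not> d) p" "co d p < co d z" "co d z < co d q"
      using that open_segment_adj[OF calculation] by auto
    ultimately have "covers H d (co (\<not> d) z) (co d p) (co d z)" "covers H d (co (\<not> d) z) (co d z) (co d q)"
      unfolding adj_def by (auto intro: covers_subset)
    then show ?thesis
      using \<open>co d p < co d z\<close> \<open>co d z < co d q\<close> unfolding thru_def bwd_def fwd_def by blast
  qed
  have dd: "d = d'"
  proof (rule ccontr)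
    assume "d \<noteq> d'"
    then have d': "d' = (\<not> d)" by auto
    have "thru H d z" "thru H (\<not> d) z" using th[OF e(1) op(1)] th[OF e(2) op(2)] d' by auto
    then have "thru H e z" for e by (cases "e = d") auto
    have "A d < co d p" "co d q < B d" "A (\<not> d) < co (\<not> d) p" "co (\<not> d) p < B (\<not> d)"
      using e(1) unfolding succ_def crossings_def inside_box_def by auto
    then have "inside_box A B z" using z1 by (intro inside_box_dirI[where d=d]) auto
    then show False using z(3) \<open>\<And>e. thru H e z\<close> unfolding crossings_def by blast
  qed
  have "\<not> co d p < co d p''" if "succ d p q" "succ d p'' q''" "z \<in> open_segment p q" "z \<in> open_segment p'' q''" for p q p'' q''
  proof
    assume lt: "co d p < co d p''"
    have "adj H d p q" "co d p < co d q" "adj H d p'' q''" "co d p'' < co d q''" using that unfolding succ_def by auto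
    then have "p'' \<in> open_segment p q"
      using that(3,4) lt open_segment_adj[of d p q] open_segment_adj[of d p'' q''] by auto
    then show False using that unfolding succ_def by blast
  qed
  from this[of p q p' q'] this[of p' q' p q] have "co d p = co d p'"
    using e op dd by auto
  moreover have "co (\<not> d) p = co (\<not> d) p'" using z1(1) z2(1) dd by simp
  ultimately have "p = p'" using co_eqI by blast
  then show ?thesis using succ_unique[of d p q q'] e dd by simp
qed

lemma joined_cvr: "joined X (cvr_edges T) = linked H X"
proof -
  let ?r = "{(x, y). closed_segment x y \<in> cvr_edges T}"
  let ?s = "{(p, q). p \<in> X \<and> q \<in> X \<and> (\<exists>d. adj H d p q)}"
  have edge: "(p, q) \<in> ?r" "(q, p) \<in> ?r" if "succ d p q" for d p q
    using that unfolding cvr_edges_eq cedges_def by (cases d; auto simp: closed_segment_commute)+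
  have rs: "?r \<subseteq> ?s"
  proof clarify
    fix x1 x2 y1 y2 assume "closed_segment (x1, x2) (y1, y2) \<in> cvr_edges T"
    then obtain d p q where "closed_segment (x1, x2) (y1, y2) = closed_segment p q" and s: "succ d p q"
      unfolding cvr_edges_eq cedges_def by blast
    then have "{(x1, x2), (y1, y2)} = {p, q}" by simp
    then show "(x1, x2) \<in> X \<and> (y1, y2) \<in> X \<and> (\<exists>d. adj H d (x1, x2) (y1, y2))"
      using s adj_sym[of H d p q] unfolding succ_def by (auto simp: doubleton_eq_iff)
  qed
  have chain: "(p, q) \<in> rtrancl ?r \<and> (q, p) \<in> rtrancl ?r"
    if "p \<in> X" "q \<in> X" "adj H d p q" "co d p \<le> co d q" for d p q
    using that
  proof (induction "card {z \<in> X. co d p \<le> co d z \<and> co d z \<le> co d q}" arbitrary: p rule: less_induct)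
    case less
    show ?case
    proof (cases "co d p = co d q")
      case True
      then have "p = q" using less.prems co_eqI unfolding adj_def by blast
      then show ?thesis by simp
    next
      case False
      then have lt: "co d p < co d q" using less.prems by simp
      obtain r where r: "succ d p r" "co d r \<le> co d q"
        using succ_ex[OF less.prems(1-3) lt] by blast
      have pr: "co d p < co d r" "r \<in> X" "adj H d p r" using r(1) unfolding succ_def by auto
      have "adj H d r q" using pr less.prems adj_sym adj_trans by blast
      moreover have "card {z \<in> X. co d r \<le> co d z \<and> co d z \<le> co d q} < card {z \<in> X. co d p \<le> co d z \<and> co d z \<le> co d q}"
      proof (rule psubset_card_mono)
        have "p \<notin> {z \<in> X. co d r \<le> co d z \<and> co d z \<le> co d q}" using pr by simp
        moreover have "p \<in> {z \<in> X. co d p \<le> co d z \<and> co d z \<le> co d q}" using less.prems by simp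
        moreover have "{z \<in> X. co d r \<le> co d z \<and> co d z \<le> co d q} \<subseteq> {z \<in> X. co d p \<le> co d z \<and> co d z \<le> co d q}"
          using pr by auto
        ultimately show "{z \<in> X. co d r \<le> co d z \<and> co d z \<le> co d q} \<subset> {z \<in> X. co d p \<le> co d z \<and> co d z \<le> co d q}"
          by blast
      qed (use finite_X in simp)
      ultimately have "(r, q) \<in> rtrancl ?r \<and> (q, r) \<in> rtrancl ?r"
        using less.hyps[of r] pr less.prems(2) r(2) by blast
      then show ?thesis using edge[OF r(1)] by (meson converse_rtrancl_into_rtrancl rtrancl_into_rtrancl)
    qed
  qed
  have sr: "?s \<subseteq> rtrancl ?r"
  proof
    fix w assume "w \<in> ?s"
    then obtain p q d where w: "w = (p, q)" "p \<in> X" "q \<in> X" "adj H d p q" by auto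
    then show "w \<in> rtrancl ?r" using chain[of p q d] chain[of q p d] adj_sym[of H d p q] by (cases "co d p \<le> co d q") auto
  qed
  have "rtrancl ?r = rtrancl ?s" by (rule rtrancl_subset[symmetric, OF rs sr])
  then show ?thesis unfolding joined_def linked_def by simp
qed

text \<open>Summing the number of edges over both directions gives \<open>2 * V - E\<close>, which is inserted into Euler's
formula.\<close>

theorem tmesh_Euler:
  "int (card (crossing_vertices T)) - int (card (interior_l_edges T)) + int (card (X // linked H X)) = int (card (cvr_cells T))"
proof -
  let ?G = "cvr_edges T"
  have fin: "finite ?G" unfolding cvr_edges_eq using card_cedges(1) by simp
  have E: "int (card X) + int (card {C \<in> components (- (X \<union> \<Union>?G)). bounded C}) =
      int (card (X // joined X ?G)) + int (card ?G)"
  proof (rule plane_graph_Euler[OF finite_X fin])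
    fix e assume "e \<in> ?G"
    then obtain d p q where "e = closed_segment p q" "succ d p q"
      unfolding cvr_edges_eq cedges_def by blast
    then show "\<exists>p q. p \<in> X \<and> q \<in> X \<and> p \<noteq> q \<and> e = closed_segment p q \<and> open_segment p q \<inter> X = {}"
      unfolding succ_def by (intro exI[of _ p] exI[of _ q]) auto
  next
    fix e e' assume ee: "e \<in> ?G" "e' \<in> ?G" "e \<noteq> e'"
    obtain d p q where e: "e = closed_segment p q" "succ d p q"
      using ee(1) unfolding cvr_edges_eq cedges_def by blast
    obtain d' p' q' where e': "e' = closed_segment p' q'" "succ d' p' q'"
      using ee(2) unfolding cvr_edges_eq cedges_def by blast
    show "e \<inter> e' \<subseteq> X" using succ_inter[OF e(2) e'(2)] ee(3) unfolding e(1) e'(1) by blast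
  qed
  have "cedges True \<inter> cedges False = {}"
  proof -
    have False if "succ True p q" "succ False p' q'" "closed_segment p q = closed_segment p' q'" for p q p' q'
    proof -
      have "{p, q} = {p', q'}" using that(3) by simp
      then show False using that(1,2) by (auto simp: doubleton_eq_iff succ_def adj_def)
    qed
    then show ?thesis unfolding cedges_def by blast
  qed
  then have "card ?G = card (cedges True) + card (cedges False)"
    unfolding cvr_edges_eq using card_cedges(1) by (intro card_Un_disjoint) auto
  moreover have "card (interior_l_edges T) = card (l_edge True ` X) + card (l_edge False ` X)"
    unfolding interior_l_edges_eq using finite_X l_edges_disjoint by (intro card_Un_disjoint) auto
  moreover have "cvr_cells T = {C \<in> components (- (X \<union> \<Union>?G)). bounded C}"
    unfolding cvr_cells_def cvr_graph_def crossing_vertices_eq by simp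
  ultimately show ?thesis
    using E card_cedges(2)[of True] card_cedges(2)[of False] unfolding crossing_vertices_eq joined_cvr by simp
qed

end

section \<open>Lines of a subdivision process\<close>

lemma thruI:
  "covers H d (co (\<not> d) p) s s' \<Longrightarrow> s < co d p \<Longrightarrow> co d p < s' \<Longrightarrow> thru H d p"
  unfolding thru_def bwd_def fwd_def using covers_subset by (meson order_refl less_imp_le)

definition lo :: "bool \<Rightarrow> cell \<Rightarrow> real" where "lo d c = co d (fst c)"
definition hi :: "bool \<Rightarrow> cell \<Rightarrow> real" where "hi d c = co d (snd c)"
definition mid :: "bool \<Rightarrow> cell \<Rightarrow> real" where "mid d c = (lo d c + hi d c) / 2"
definition center :: "cell \<Rightarrow> real \<times> real" where "center c = (mid True c, mid False c)"

lemma co_center [simp]: "co d (center c) = mid d c"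
  by (simp add: center_def co_def)

lemma center_eq: "center c = mk d (mid d c) (mid (\<not> d) c)"
  by (simp add: center_def mk_def)

lemma cell_eqI:
  assumes "lo d c = lo d c'" "hi d c = hi d c'" "lo (\<not> d) c = lo (\<not> d) c'" "hi (\<not> d) c = hi (\<not> d) c'"
  shows "c = c'"
  using co_eqI[of d "fst c" "fst c'"] co_eqI[of d "snd c" "snd c'"] assms
  by (auto simp: lo_def hi_def prod_eq_iff)

text \<open>Consecutive elements of a set of reals. Such intervals are equal or do not overlap, which yields all
facts about the alignment of cells of the same level.\<close>

definition gap :: "real set \<Rightarrow> real \<Rightarrow> real \<Rightarrow> bool" where
  "gap Y x y \<longleftrightarrow> x \<in> Y \<and> y \<in> Y \<and> x < y \<and> (\<forall>z\<in>Y. z \<le> x \<or> y \<le> z)"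

lemma gap_overlap:
  assumes "gap Y x y" "gap Y x' y'" "x < y'" "x' < y"
  shows "x = x' \<and> y = y'"
  using assms unfolding gap_def by (meson antisym linorder_not_le)

lemma gap_cases:
  assumes "gap Y x y" "gap Y x' y'"
  shows "x = x' \<and> y = y' \<or> y \<le> x' \<or> y' \<le> x"
  using gap_overlap[OF assms] by linarith

lemma gap_mid:
  assumes "gap Y x y" "gap Y x' y'" "(x + y) / 2 = (x' + y') / 2"
  shows "x = x' \<and> y = y'"
  using gap_cases[OF assms(1,2)] assms unfolding gap_def by force

definition bisect :: "real set \<Rightarrow> real set" where
  "bisect Y = Y \<union> {(x + y) / 2 | x y. gap Y x y}"

lemma finite_bisect: "finite Y \<Longrightarrow> finite (bisect Y)"
proof -
  assume "finite Y"
  moreover have "{(x + y) / 2 | x y. gap Y x y} \<subseteq> (\<lambda>(x, y). (x + y) / 2) ` (Y \<times> Y)"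
  proof
    fix z assume "z \<in> {(x + y) / 2 | x y. gap Y x y}"
    then obtain x y where "z = (x + y) / 2" "(x, y) \<in> Y \<times> Y" unfolding gap_def by blast
    then show "z \<in> (\<lambda>(x, y). (x + y) / 2) ` (Y \<times> Y)" by (metis (no_types, lifting) case_prod_conv imageI)
  qed
  ultimately show ?thesis unfolding bisect_def by (meson finite_SigmaI finite_UnI finite_imageI finite_subset)
qed

lemma gap_bisect:
  assumes "gap Y x y"
  shows "gap (bisect Y) x ((x + y) / 2)" "gap (bisect Y) ((x + y) / 2) y"
proof -
  have lt: "x < y" using assms unfolding gap_def by blast
  have in_bi: "x \<in> bisect Y" "y \<in> bisect Y" "(x + y) / 2 \<in> bisect Y"
    using assms unfolding bisect_def by (auto simp: gap_def)
  have gap: "z \<le> x \<or> z = (x + y) / 2 \<or> y \<le> z" if z: "z \<in> bisect Y" for z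
  proof -
    have "z \<le> x \<or> z = (x + y) / 2 \<or> y \<le> z" if uv: "gap Y u v" "z = (u + v) / 2" for u v
      using gap_cases[OF assms uv(1)] uv assms unfolding gap_def by (auto simp: field_simps)
    then show ?thesis using z assms unfolding bisect_def gap_def by blast
  qed
  show "gap (bisect Y) x ((x + y) / 2)" "gap (bisect Y) ((x + y) / 2) y"
    unfolding gap_def[of "bisect Y"] using in_bi gap lt by (auto simp: field_simps; force)+
qed

lemma in_subcells_iff:
  "c \<in> subcells P \<longleftrightarrow> (\<forall>d. lo d c = lo d P \<and> hi d c = mid d P \<or> lo d c = mid d P \<and> hi d c = hi d P)"
proof -
  obtain a b a' b' where P: "P = ((a, b), (a', b'))" by (metis surj_pair)
  obtain u v u' v' where c: "c = ((u, v), (u', v'))" by (metis surj_pair)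
  show ?thesis
    unfolding P c subcells_def lo_def hi_def mid_def co_def all_bool_eq Let_def
    by (auto simp: midpoint_def field_simps)
qed

text \<open>\<open>Q k\<close> are the cells of level \<open>k\<close> and \<open>S k\<close> those that are subdivided. For each direction
\<open>d\<close>, \<open>G0 d\<close> are the coordinates of the initial grid, \<open>F d\<close> those of the large grid, and
\<open>a d\<close>, \<open>b d\<close> and \<open>A d\<close>, \<open>B d\<close> the respective extreme ones.\<close>

locale hier =
  fixes F G0 :: "bool \<Rightarrow> real set" and A B a b :: "bool \<Rightarrow> real" and Q S :: "nat \<Rightarrow> cell set"
  assumes finite_F: "finite (F d)"
    and F_G0: "F d \<inter> {a d..b d} = G0 d"
    and ab: "a d \<in> F d" "b d \<in> F d" "a d < b d"
    and AB: "A d \<in> F d" "B d \<in> F d"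
    and F_AB: "F d \<subseteq> {A d..B d}"
    and inner_line: "\<exists>x\<in>F d. A d < x \<and> x < B d"
    and Q_0: "c \<in> Q 0 \<Longrightarrow> gap (G0 d) (lo d c) (hi d c)"
    and Q_Suc: "Q (Suc k) = (\<Union>c\<in>S k. subcells c)"
    and S_Q: "S k \<subseteq> Q k"
    and finite_S: "finite (S k)"
begin

primrec coords :: "nat \<Rightarrow> bool \<Rightarrow> real set" where
  "coords 0 d = G0 d"
| "coords (Suc k) d = bisect (coords k d)"

text \<open>Contains the coordinates of all lines present at level \<open>k\<close>. The midlines added in passing to level \<open>k + 1\<close>
have coordinates outside this set (\<open>mid_new\<close>), so old and new lines never lie on a common straight
line, and old lines are never prolonged.\<close>

definition old where "old k d = F d \<union> coords k d"

text \<open>\<open>Lo\<close> and \<open>Hi\<close> are the ends of the midline of a cell after prolongation to the boundary of the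
large grid.\<close>

definition Lo where "Lo d c = (if lo d c = a d then A d else lo d c)"
definition Hi where "Hi d c = (if hi d c = b d then B d else hi d c)"

definition midline where "midline d c = {p. co (\<not> d) p = mid (\<not> d) c \<and> Lo d c \<le> co d p \<and> co d p \<le> Hi d c}"

text \<open>All points on mesh segments of direction \<open>d\<close> at level \<open>k\<close>: full lines of the large grid, and
midlines of the cells subdivided so far.\<close>

definition lines where
  "lines k d = {p. co (\<not> d) p \<in> F (\<not> d) \<and> A d \<le> co d p \<and> co d p \<le> B d} \<union> (\<Union>j<k. \<Union>c\<in>S j. midline d c)"

abbreviation X where "X k \<equiv> crossings (lines k) A B"

lemma bounds: "A d \<le> a d" "b d \<le> B d" "A d < B d"
proof -
  have "a d \<in> {A d..B d}" "b d \<in> {A d..B d}" using F_AB[of d] ab[of d] by blast+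
  then show "A d \<le> a d" "b d \<le> B d" "A d < B d" using ab(3)[of d] by auto
qed

lemma G0_F: "G0 d \<subseteq> F d" using F_G0 by blast

lemma G0_ab: "G0 d \<subseteq> {a d..b d}" using F_G0 by blast

lemma finite_coords: "finite (coords k d)"
  using finite_F[of d] G0_F[of d] by (induction k) (auto intro: finite_bisect finite_subset)

lemma coords_mono: "j \<le> k \<Longrightarrow> coords j d \<subseteq> coords k d"
  by (induction k) (auto simp: bisect_def le_Suc_eq)

lemma coords_ab: "coords k d \<subseteq> {a d..b d}"
proof (induction k)
  case (Suc k)
  then show ?case unfolding coords.simps bisect_def gap_def by (force simp: field_simps)
qed (use G0_ab in simp)

lemma coords_endpoints: "a d \<in> coords k d" "b d \<in> coords k d"
  using coords_mono[of 0 k d] F_G0[of d] ab[of d] by auto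

lemma old_coords: "x \<in> old k d \<Longrightarrow> a d \<le> x \<Longrightarrow> x \<le> b d \<Longrightarrow> x \<in> coords k d"
  using coords_mono[of 0 k d] F_G0[of d] unfolding old_def by auto

lemma finite_old: "finite (old k d)"
  unfolding old_def using finite_F finite_coords by simp

lemma old_AB: "x \<in> old k d \<Longrightarrow> A d \<le> x \<and> x \<le> B d"
  using coords_ab[of k d] F_AB[of d] bounds[of d] unfolding old_def by force

lemma gap_Q: "c \<in> Q k \<Longrightarrow> gap (coords k d) (lo d c) (hi d c)"
proof (induction k arbitrary: c)
  case (Suc k)
  then obtain P where P: "P \<in> S k" "c \<in> subcells P" using Q_Suc by blast
  then have "gap (coords k d) (lo d P) (hi d P)" using Suc.IH S_Q by blast
  from gap_bisect[OF this, folded mid_def] show ?case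
    using P(2)[unfolded in_subcells_iff, rule_format, of d] by auto
qed (use Q_0 in simp)

lemma gap_S: "c \<in> S k \<Longrightarrow> gap (coords k d) (lo d c) (hi d c)"
  using gap_Q S_Q by blast

lemma lo_hi:
  assumes "c \<in> Q k"
  shows "a d \<le> lo d c" "lo d c < hi d c" "hi d c \<le> b d" "lo d c < mid d c" "mid d c < hi d c"
proof -
  note c = gap_Q[OF assms, of d]
  then show "lo d c < hi d c" by (simp add: gap_def)
  then show "lo d c < mid d c" "mid d c < hi d c" by (auto simp: mid_def)
  show "a d \<le> lo d c" "hi d c \<le> b d" using c coords_ab[of k d] by (auto simp: gap_def)
qed

lemma Lo_Hi:
  assumes "c \<in> Q k"
  shows "A d \<le> Lo d c" "Lo d c \<le> lo d c" "hi d c \<le> Hi d c" "Hi d c \<le> B d"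
  using lo_hi[OF assms, of d] bounds[of d] unfolding Lo_def Hi_def by auto

lemma in_Lo_Hi:
  assumes "c \<in> Q k" "Lo d c \<le> x" "x \<le> Hi d c" "a d \<le> x" "x \<le> b d"
  shows "lo d c \<le> x" "x \<le> hi d c"
  using assms unfolding Lo_def Hi_def by (auto split: if_splits)

lemma mid_new: "c \<in> Q k \<Longrightarrow> mid d c \<notin> old k d"
proof
  assume c: "c \<in> Q k" and m: "mid d c \<in> old k d"
  have "mid d c \<in> coords k d" using old_coords[OF m] lo_hi[OF c, of d] by simp
  then show False using gap_Q[OF c, of d] lo_hi[OF c, of d] unfolding gap_def by force
qed

lemma mid_coords: "c \<in> S k \<Longrightarrow> mid d c \<in> coords (Suc k) d"
  using gap_S[of c k d] unfolding coords.simps bisect_def mid_def by blast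

lemma mid_eq: "c \<in> Q k \<Longrightarrow> c' \<in> Q k \<Longrightarrow> mid d c = mid d c' \<Longrightarrow> lo d c = lo d c' \<and> hi d c = hi d c'"
  using gap_mid[OF gap_Q gap_Q] unfolding mid_def by blast

lemma lines_0: "p \<in> lines 0 d \<longleftrightarrow> co (\<not> d) p \<in> F (\<not> d) \<and> A d \<le> co d p \<and> co d p \<le> B d"
  unfolding lines_def by simp

lemma lines_Suc: "lines (Suc k) d = lines k d \<union> (\<Union>c\<in>S k. midline d c)"
  unfolding lines_def by (auto simp: lessThan_Suc)

lemma lines_mono: "j \<le> k \<Longrightarrow> lines j d \<subseteq> lines k d"
  unfolding lines_def by fastforce

lemma lines_F: "t \<in> F (\<not> d) \<Longrightarrow> A d \<le> s \<Longrightarrow> s \<le> B d \<Longrightarrow> mk d s t \<in> lines k d"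
  unfolding lines_def by simp

lemma lines_cases:
  assumes "p \<in> lines k d"
  obtains "co (\<not> d) p \<in> F (\<not> d)" "A d \<le> co d p" "co d p \<le> B d"
  | j c where "j < k" "c \<in> S j" "p \<in> midline d c"
  using assms unfolding lines_def by blast

lemma lines_old: "p \<in> lines k d \<Longrightarrow> co (\<not> d) p \<in> old k (\<not> d)"
proof (erule lines_cases)
  fix j c assume c: "j < k" "c \<in> S j" "p \<in> midline d c"
  then have "co (\<not> d) p \<in> coords (Suc j) (\<not> d)" using mid_coords[OF c(2)] unfolding midline_def by simp
  then show ?thesis using coords_mono[of "Suc j" k "\<not> d"] c(1) unfolding old_def by auto
qed (simp add: old_def)

lemma lines_Suc_old: "co (\<not> d) p \<in> old k (\<not> d) \<Longrightarrow> p \<in> lines (Suc k) d \<longleftrightarrow> p \<in> lines k d"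
  unfolding lines_Suc midline_def using mid_new S_Q by fastforce

lemma lines_Suc_new: "co (\<not> d) p \<notin> old k (\<not> d) \<Longrightarrow> p \<in> lines (Suc k) d \<longleftrightarrow> (\<exists>c\<in>S k. p \<in> midline d c)"
  unfolding lines_Suc using lines_old by blast

lemma covers_Suc_old: "t \<in> old k (\<not> d) \<Longrightarrow> covers (lines (Suc k)) d t s s' \<longleftrightarrow> covers (lines k) d t s s'"
  unfolding covers_def using lines_Suc_old by simp

lemma covers_midline: "c \<in> S k \<Longrightarrow> covers (lines (Suc k)) d (mid (\<not> d) c) (Lo d c) (Hi d c)"
  unfolding covers_def lines_Suc midline_def by auto

lemma covers_F: "t \<in> F (\<not> d) \<Longrightarrow> covers (lines k) d t (A d) (B d)"
  unfolding covers_def using lines_F by blast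

lemma covers_side:
  "c \<in> Q k \<Longrightarrow> t = lo (\<not> d) c \<or> t = hi (\<not> d) c \<Longrightarrow> covers (lines k) d t (lo d c) (hi d c)"
proof (induction k arbitrary: c t)
  case 0
  then have "t \<in> F (\<not> d)" using Q_0[OF 0(1), of "\<not> d"] G0_F[of "\<not> d"] unfolding gap_def by auto
  show ?case
    using lo_hi[OF 0(1), of d] bounds[of d] by (intro covers_subset[OF covers_F[OF \<open>t \<in> F (\<not> d)\<close>]]) auto
next
  case (Suc k)
  then obtain P where P: "P \<in> S k" "c \<in> subcells P" using Q_Suc by blast
  then have PQ: "P \<in> Q k" using S_Q by blast
  have c: "lo d P \<le> lo d c" "hi d c \<le> hi d P" "t = lo (\<not> d) P \<or> t = hi (\<not> d) P \<or> t = mid (\<not> d) P"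
    using P(2) Suc.prems(2) lo_hi[OF PQ, of d] unfolding in_subcells_iff by (metis less_imp_le order_refl)+
  show ?case
  proof (cases "t = mid (\<not> d) P")
    case True
    then show ?thesis using covers_midline[OF P(1), of d] c Lo_Hi[OF PQ, of d] by (auto intro: covers_subset)
  next
    case False
    then have "covers (lines k) d t (lo d P) (hi d P)" using Suc.IH[OF PQ] c(3) by blast
    then have "covers (lines (Suc k)) d t (lo d P) (hi d P)" by (rule covers_mono) (rule lines_mono, simp)
    then show ?thesis using c by (auto intro: covers_subset)
  qed
qed

lemma center_X: "c \<in> S k \<Longrightarrow> center c \<in> X (Suc k)"
proof -
  assume c: "c \<in> S k"
  then have cQ: "c \<in> Q k" using S_Q by blast
  have "thru (lines (Suc k)) d (center c)" for d
    using covers_midline[OF c, of d] Lo_Hi[OF cQ, of d] lo_hi[OF cQ, of d]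
    by (intro thruI[of _ d _ "Lo d c" "Hi d c"]) auto
  moreover have "A d < mid d c \<and> mid d c < B d" for d
    using lo_hi[OF cQ, of d] bounds[of d] by linarith
  then have "inside_box A B (center c)" unfolding inside_box_def by simp
  ultimately show ?thesis unfolding crossings_def by simp
qed

lemma X_mono: "j \<le> k \<Longrightarrow> X j \<subseteq> X k"
  by (intro crossings_mono lines_mono)

lemma frame_crossing: "x \<in> F d \<Longrightarrow> y \<in> F (\<not> d) \<Longrightarrow> A d < x \<Longrightarrow> x < B d \<Longrightarrow> A (\<not> d) < y \<Longrightarrow> y < B (\<not> d) \<Longrightarrow>
  mk d x y \<in> X k"
proof -
  assume x: "x \<in> F d" "y \<in> F (\<not> d)" "A d < x" "x < B d" "A (\<not> d) < y" "y < B (\<not> d)"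
  have "thru (lines k) d (mk d x y)"
    using covers_F[OF x(2), of k] x by (intro thruI[of _ d _ "A d" "B d"]) auto
  moreover have "thru (lines k) (\<not> d) (mk d x y)"
    using covers_F[of x "\<not> d" k] x by (intro thruI[of _ "\<not> d" _ "A (\<not> d)" "B (\<not> d)"]) (auto simp: mk_flip)
  ultimately have "thru (lines k) e (mk d x y)" for e by (cases "e = d") auto
  moreover have "inside_box A B (mk d x y)" using x by (intro inside_box_dirI[where d=d]) auto
  ultimately show ?thesis unfolding crossings_def by simp
qed

text \<open>A midline stops at the sides of its cell, which are covered by lines of level \<open>k\<close> and extend to both
sides of its end. It carries the centre of its cell; a full line is crossed by an inner full line.\<close>

lemma arrangement_lines: "arrangement (lines k) A B"
proof
  fix d :: bool
  have "closed {p. co (\<not> d) p \<in> F (\<not> d) \<and> A d \<le> co d p \<and> co d p \<le> B d}"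
  proof -
    have "{p. co (\<not> d) p \<in> F (\<not> d) \<and> A d \<le> co d p \<and> co d p \<le> B d} =
      co (\<not> d) -` F (\<not> d) \<inter> co d -` {A d..B d}" by auto
    then show ?thesis
      using finite_imp_closed[OF finite_F[of "\<not> d"]]
      by (auto intro!: closed_Int closed_vimage continuous_on_co)
  qed
  moreover have "closed (midline d c)" for c
  proof -
    have "midline d c = co (\<not> d) -` {mid (\<not> d) c} \<inter> co d -` {Lo d c..Hi d c}" unfolding midline_def by auto
    then show ?thesis by (auto intro!: closed_Int closed_vimage continuous_on_co)
  qed
  ultimately show "closed (lines k d)"
    unfolding lines_def using finite_S by (intro closed_Un closed_UN) auto
  show "finite (co (\<not> d) ` lines k d)"
    by (rule finite_subset[OF _ finite_old[of k "\<not> d"]]) (use lines_old in blast)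
  show "A d < B d" by (rule bounds)
  show "mk d s t \<in> lines k d" if "t = A (\<not> d) \<or> t = B (\<not> d)" "A d \<le> s" "s \<le> B d" for s t
    using lines_F[of t d s k] AB[of "\<not> d"] that by auto
  show "A e \<le> co e p \<and> co e p \<le> B e" if p: "p \<in> lines k d" for e p
  proof (cases "e = d")
    case True
    show ?thesis using p
    proof (cases rule: lines_cases)
      case (2 j c)
      then show ?thesis using Lo_Hi[of c j d] S_Q True unfolding midline_def by force
    qed (use True in auto)
  next
    case False
    then have "e = (\<not> d)" by auto
    then show ?thesis using old_AB[OF lines_old[OF p]] by simp
  qed
  show "thru (lines k) d p \<or> co d p = A d \<or> co d p = B d \<or> thru (lines k) (\<not> d) p" if p: "p \<in> lines k d" for p
    using p
  proof (cases rule: lines_cases)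
    case 1
    then show ?thesis
      using thruI[OF covers_F[OF 1(1), of k]] by linarith
  next
    case (2 j c)
    then have cQ: "c \<in> Q j" using S_Q by blast
    have pm: "co (\<not> d) p = mid (\<not> d) c" "Lo d c \<le> co d p" "co d p \<le> Hi d c" using 2(3) unfolding midline_def by auto
    have sub: "lines (Suc j) e \<subseteq> lines k e" "lines j e \<subseteq> lines k e" for e
      using 2(1) lines_mono[of "Suc j" k e] lines_mono[of j k e] by simp_all
    have cov: "covers (lines k) d (co (\<not> d) p) (Lo d c) (Hi d c)"
      unfolding pm(1) using covers_mono[OF covers_midline[OF 2(2)]] sub by blast
    have end': "thru (lines k) (\<not> d) p" if x: "co d p = lo d c \<or> co d p = hi d c"
    proof -
      have "covers (lines j) (\<not> d) (co d p) (lo (\<not> d) c) (hi (\<not> d) c)"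
        using covers_side[OF cQ, of "co d p" "\<not> d"] x by simp
      then have "covers (lines k) (\<not> d) (co d p) (lo (\<not> d) c) (hi (\<not> d) c)"
        by (rule covers_mono) (rule sub)
      then show ?thesis
        using lo_hi[OF cQ, of "\<not> d"] pm(1) by (intro thruI[of _ "\<not> d" _ "lo (\<not> d) c" "hi (\<not> d) c"]) auto
    qed
    consider "Lo d c < co d p" "co d p < Hi d c" | "co d p = Lo d c" | "co d p = Hi d c" using pm by linarith
    then show ?thesis
    proof cases
      case 1
      then show ?thesis using thruI[OF cov] by blast
    qed (use end' in \<open>auto simp: Lo_def Hi_def split: if_splits\<close>)
  qed
  show "\<exists>z\<in>X k. adj (lines k) d p z" if p: "p \<in> lines k d" "A (\<not> d) < co (\<not> d) p" "co (\<not> d) p < B (\<not> d)" for p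
    using p(1)
  proof (cases rule: lines_cases)
    case 1
    obtain x where x: "x \<in> F d" "A d < x" "x < B d" using inner_line by blast
    have "mk d x (co (\<not> d) p) \<in> X k" using frame_crossing x 1 p by blast
    moreover have "adj (lines k) d p (mk d x (co (\<not> d) p))"
      using covers_F[OF 1(1), of k] 1 x unfolding adj_def by (auto intro: covers_subset)
    ultimately show ?thesis by blast
  next
    case (2 j c)
    then have cQ: "c \<in> Q j" using S_Q by blast
    have "center c \<in> X k" using center_X[OF 2(2)] X_mono[of "Suc j" k] 2(1) by auto
    moreover have "adj (lines (Suc j)) d p (center c)"
      using covers_midline[OF 2(2), of d] 2(3) lo_hi[OF cQ, of d] Lo_Hi[OF cQ, of d]
      unfolding adj_def midline_def by (auto intro: covers_subset)
    then have "adj (lines k) d p (center c)" using 2(1) by (intro adj_mono[of "lines (Suc j)" d _ _ "lines k"] lines_mono) auto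
    ultimately show ?thesis by blast
  qed
qed

end

section \<open>Components and shared sides\<close>

lemma equiv_linked: "equiv X (linked H X)"
proof -
  have "sym (rtrancl {(p, q). p \<in> X \<and> q \<in> X \<and> (\<exists>d. adj H d p q)})"
  proof (intro sym_rtrancl symI)
    fix p q assume "(p, q) \<in> {(p, q). p \<in> X \<and> q \<in> X \<and> (\<exists>d. adj H d p q)}"
    then obtain d where "p \<in> X" "q \<in> X" "adj H d p q" by blast
    then show "(q, p) \<in> {(p, q). p \<in> X \<and> q \<in> X \<and> (\<exists>d. adj H d p q)}" using adj_sym[of H d p q] by blast
  qed
  then show ?thesis
    unfolding linked_def by (intro equivI) (auto simp: refl_on_def sym_def intro!: transI dest: rtrancl_trans)
qed

lemma linked_adj: "p \<in> X \<Longrightarrow> q \<in> X \<Longrightarrow> adj H d p q \<Longrightarrow> (p, q) \<in> linked H X"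
  unfolding linked_def by (auto intro!: r_into_rtrancl)

lemma linked_sym: "(p, q) \<in> linked H X \<Longrightarrow> (q, p) \<in> linked H X"
  using equiv_linked by (metis equivE symE)

lemma linked_trans: "(p, q) \<in> linked H X \<Longrightarrow> (q, r) \<in> linked H X \<Longrightarrow> (p, r) \<in> linked H X"
  using equiv_linked by (metis equivE transE)

lemma linked_mono:
  assumes "\<And>d. H d \<subseteq> H' d" "X \<subseteq> X'"
  shows "linked H X \<subseteq> linked H' X'"
proof -
  have "{(p, q). p \<in> X \<and> q \<in> X \<and> (\<exists>d. adj H d p q)} \<subseteq> {(p, q). p \<in> X' \<and> q \<in> X' \<and> (\<exists>d. adj H' d p q)}"
  proof clarify
    fix p1 p2 q1 q2 d assume "(p1, p2) \<in> X" "(q1, q2) \<in> X" "adj H d (p1, p2) (q1, q2)"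
    then show "(p1, p2) \<in> X' \<and> (q1, q2) \<in> X' \<and> (\<exists>d. adj H' d (p1, p2) (q1, q2))"
      using assms(2) adj_mono[of H d "(p1, p2)" "(q1, q2)" H'] assms(1)[of d] by blast
  qed
  from rtrancl_mono[OF this] show ?thesis using assms(2) unfolding linked_def by auto
qed

lemma linked_class_eq:
  assumes "x \<in> X" "y \<in> X"
  shows "linked H X `` {x} = linked H X `` {y} \<longleftrightarrow> (x, y) \<in> linked H X"
  using equiv_linked eq_equiv_class_iff assms by metis

lemma linked_invariant:
  assumes xy: "(x, y) \<in> linked H X"
    and f: "\<And>p q d. p \<in> X \<Longrightarrow> q \<in> X \<Longrightarrow> adj H d p q \<Longrightarrow> f p = f q"
  shows "f x = f y"
proof -
  have "(x, y) \<in> rtrancl {(p, q). p \<in> X \<and> q \<in> X \<and> (\<exists>d. adj H d p q)}" using xy by (simp add: linked_def)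
  then show ?thesis by (induction rule: rtrancl_induct) (use f in force)+
qed

lemma card_quotient_labels:
  assumes "finite V" "equiv V R" and "\<And>x y. x \<in> V \<Longrightarrow> y \<in> V \<Longrightarrow> (x, y) \<in> R \<longleftrightarrow> f x = f y"
  shows "card (V // R) = card (f ` V)"
proof -
  have cls: "R `` {x} = {y \<in> V. f y = f x}" if "x \<in> V" for x
    using assms(2,3) that equiv_type[OF assms(2)] by (auto; metis)
  have "bij_betw (\<lambda>l. {y \<in> V. f y = l}) (f ` V) (V // R)"
    unfolding bij_betw_def
  proof
    show "inj_on (\<lambda>l. {y \<in> V. f y = l}) (f ` V)" by (intro inj_onI) blast
    show "(\<lambda>l. {y \<in> V. f y = l}) ` f ` V = V // R"
      unfolding quotient_def using cls by (auto simp: image_iff)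
  qed
  then show ?thesis by (simp add: bij_betw_same_card)
qed

context hier
begin

text \<open>The side of \<open>c\<close> at coordinate \<open>x\<close> (orthogonal to \<open>d\<close>) is also a side of another cell in
\<open>M\<close>, or borders on the frame. For \<open>M = S k\<close> these are the sides whose midpoints become crossings.\<close>

definition shared where
  "shared M c d x \<longleftrightarrow> (x = lo d c \<or> x = hi d c) \<and>
    ((\<exists>e\<in>M. e \<noteq> c \<and> (x = lo d e \<or> x = hi d e) \<and> lo (\<not> d) e = lo (\<not> d) c \<and> hi (\<not> d) e = hi (\<not> d) c) \<or>
     (A d < x \<and> x < B d \<and> (x = a d \<or> x = b d)))"

definition isolated where "isolated k = {c \<in> S k. \<forall>d x. \<not> shared (S k) c d x}"

abbreviation R where "R k \<equiv> linked (lines k) (X k)"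

lemma S_in_Q: "c \<in> S k \<Longrightarrow> c \<in> Q k"
  using S_Q by blast

lemma X_inside: "p \<in> X k \<Longrightarrow> A d < co d p \<and> co d p < B d"
  unfolding crossings_def inside_box_def by blast

lemma X_lines: "p \<in> X k \<Longrightarrow> p \<in> lines k d"
  unfolding crossings_def using thru_in by blast

lemma hit_X: "p \<in> lines k d \<Longrightarrow> A (\<not> d) < co (\<not> d) p \<Longrightarrow> co (\<not> d) p < B (\<not> d) \<Longrightarrow> \<exists>z\<in>X k. adj (lines k) d p z"
  by (rule arrangement.hit[OF arrangement_lines])

lemma R_mono: "R k \<subseteq> R (Suc k)"
  by (intro linked_mono lines_mono X_mono) simp_all

text \<open>A crossing on a full line is linked to a crossing of two full lines, and full lines of different
directions meet.\<close>

lemma frame_crossings_linked: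
  assumes z: "z \<in> X k" "z' \<in> X k" and F: "co d z \<in> F d" "co d' z' \<in> F d'"
  shows "(z, z') \<in> R k"
proof -
  have to_grid: "\<exists>w. w \<in> X k \<and> (z, w) \<in> R k \<and> (\<forall>d. co d w \<in> F d)"
    if z: "z \<in> X k" "co d z \<in> F d" for z d
  proof -
    obtain y where y: "y \<in> F (\<not> d)" "A (\<not> d) < y" "y < B (\<not> d)" using inner_line by blast
    define w where "w = mk d (co d z) y"
    have w: "w \<in> X k" unfolding w_def using frame_crossing y z X_inside[OF z(1), of d] by blast
    have "covers (lines k) (\<not> d) (co d z) (A (\<not> d)) (B (\<not> d))" using covers_F[of "co d z" "\<not> d" k] z(2) by simp
    then have "adj (lines k) (\<not> d) z w"
      using y X_inside[OF z(1), of "\<not> d"] unfolding adj_def w_def by (auto intro: covers_subset)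
    then have "(z, w) \<in> R k" using linked_adj z(1) w by blast
    moreover have "co e w \<in> F e" for e using z(2) y(1) by (cases "e = d") (auto simp: w_def)
    ultimately show ?thesis using w by blast
  qed
  obtain w where w: "w \<in> X k" "(z, w) \<in> R k" "\<And>d. co d w \<in> F d" using to_grid[OF z(1) F(1)] by blast
  obtain w' where w': "w' \<in> X k" "(z', w') \<in> R k" "\<And>d. co d w' \<in> F d" using to_grid[OF z(2) F(2)] by blast
  define v where "v = mk True (co True w') (co False w)"
  have v: "v \<in> X k" unfolding v_def
    using frame_crossing[of "co True w'" True "co False w"] w w' X_inside[OF w(1), of False] X_inside[OF w'(1), of True] by simp
  have "adj (lines k) True w v"
    using covers_F[of "co False w" True k] w(3)[of False] X_inside[OF w(1), of True] X_inside[OF w'(1), of True]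
      co_mk(2)[of True "co True w'" "co False w"]
    unfolding adj_def v_def by (auto intro: covers_subset)
  moreover have "adj (lines k) False v w'"
    using covers_F[of "co True w'" False k] w'(3)[of True] X_inside[OF w(1), of False] X_inside[OF w'(1), of False]
      co_mk(2)[of True "co True w'" "co False w"]
    unfolding adj_def v_def by (auto intro: covers_subset)
  ultimately have "(w, v) \<in> R k" "(v, w') \<in> R k" using linked_adj v w(1) w'(1) by blast+
  then show ?thesis using w(2) w'(2) linked_sym linked_trans by metis
qed

text \<open>Along the side the point is passed because the midpoint is interior to it; across the side, because
the midlines of the two cells (or the prolonged midline of the one cell) meet there.\<close>

lemma crossing_side:
  assumes P: "P \<in> S k" and sh: "shared (S k) P d x"
  shows "mk d x (mid (\<not> d) P) \<in> X (Suc k)"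
proof -
  have PQ: "P \<in> Q k" using P S_Q by blast
  define v where "v = mk d x (mid (\<not> d) P)"
  note P_ = lo_hi[OF PQ, of d] Lo_Hi[OF PQ, of d] gap_S[OF P, of d] bounds[of d]
  have x: "x = lo d P \<or> x = hi d P" using sh unfolding shared_def by blast
  have "covers (lines k) (\<not> d) x (lo (\<not> d) P) (hi (\<not> d) P)"
    using covers_side[OF PQ, of x "\<not> d"] x by simp
  then have "covers (lines (Suc k)) (\<not> d) x (lo (\<not> d) P) (hi (\<not> d) P)"
    by (rule covers_mono) (simp add: lines_mono)
  then have "thru (lines (Suc k)) (\<not> d) v"
    using lo_hi[OF PQ, of "\<not> d"] by (intro thruI[of _ "\<not> d" _ "lo (\<not> d) P" "hi (\<not> d) P"]) (auto simp: v_def)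
  moreover have "thru (lines (Suc k)) d v \<and> A d < x \<and> x < B d"
  proof (cases "A d < x \<and> x < B d \<and> (x = a d \<or> x = b d)")
    case True
    then have "Lo d P < x \<and> x < Hi d P" using x P_ unfolding Lo_def Hi_def by auto
    then show ?thesis using True covers_midline[OF P, of d] by (intro conjI thruI[of _ d _ "Lo d P" "Hi d P"]) (auto simp: v_def)
  next
    case False
    then obtain e where e: "e \<in> S k" "e \<noteq> P" "x = lo d e \<or> x = hi d e"
      "lo (\<not> d) e = lo (\<not> d) P" "hi (\<not> d) e = hi (\<not> d) P"
      using sh unfolding shared_def by blast
    then have eQ: "e \<in> Q k" using S_Q by blast
    note e_ = lo_hi[OF eQ, of d] Lo_Hi[OF eQ, of d] gap_S[OF e(1), of d]
    have m: "mid (\<not> d) e = mid (\<not> d) P" using e(4,5) by (simp add: mid_def)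
    have ne: "lo d e \<noteq> lo d P \<or> hi d e \<noteq> hi d P" using cell_eqI[of d e P] e by blast
    have cov: "covers (lines (Suc k)) d (mid (\<not> d) P) (Lo d P) (Hi d P)"
      "covers (lines (Suc k)) d (mid (\<not> d) P) (Lo d e) (Hi d e)"
      using covers_midline[OF P, of d] covers_midline[OF e(1), of d] m by auto
    consider "hi d P = x" "lo d e = x" | "hi d e = x" "lo d P = x"
    proof -
      have "hi d P \<le> lo d e \<or> hi d e \<le> lo d P" using gap_cases[OF P_(10) e_(10)] ne by auto
      then have "hi d P = x \<and> lo d e = x \<or> hi d e = x \<and> lo d P = x"
        using x e(3) P_(2) e_(2) by linarith
      then show thesis using that by blast
    qed
    then show ?thesis
    proof cases
      case 1
      then have "covers (lines (Suc k)) d (mid (\<not> d) P) (lo d P) x" "covers (lines (Suc k)) d (mid (\<not> d) P) x (hi d e)"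
        using P_ e_ by (auto intro: covers_subset[OF cov(1)] covers_subset[OF cov(2)])
      then have "covers (lines (Suc k)) d (mid (\<not> d) P) (lo d P) (hi d e)" by (rule covers_join)
      then show ?thesis using 1 P_ e_ by (intro conjI thruI[of _ d _ "lo d P" "hi d e"]) (auto simp: v_def)
    next
      case 2
      then have "covers (lines (Suc k)) d (mid (\<not> d) P) (lo d e) x" "covers (lines (Suc k)) d (mid (\<not> d) P) x (hi d P)"
        using P_ e_ by (auto intro: covers_subset[OF cov(1)] covers_subset[OF cov(2)])
      then have "covers (lines (Suc k)) d (mid (\<not> d) P) (lo d e) (hi d P)" by (rule covers_join)
      then show ?thesis using 2 P_ e_ by (intro conjI thruI[of _ d _ "lo d e" "hi d P"]) (auto simp: v_def)
    qed
  qed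
  ultimately have "thru (lines (Suc k)) f v" for f by (cases "f = d") auto
  moreover have "inside_box A B v"
    using \<open>thru (lines (Suc k)) d v \<and> A d < x \<and> x < B d\<close> lo_hi[OF PQ, of "\<not> d"] bounds[of "\<not> d"]
    by (intro inside_box_dirI[where d=d]) (auto simp: v_def)
  ultimately show ?thesis unfolding crossings_def v_def by blast
qed

text \<open>All crossings on the lines that contain a shared side of \<open>c\<close> are linked to \<open>\<rho>\<close>.\<close>

definition rooted where
  "rooted k c \<rho> \<longleftrightarrow> \<rho> \<in> X k \<and> (\<forall>d x z. shared (Q k) c d x \<longrightarrow> z \<in> X k \<longrightarrow>
     adj (lines k) (\<not> d) (mk d x (mid (\<not> d) c)) z \<longrightarrow> (\<rho>, z) \<in> R k)"

lemma rootedD: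
  assumes "rooted k c \<rho>" "shared (Q k) c d x" "z \<in> X k" "adj (lines k) (\<not> d) (mk d x (mid (\<not> d) c)) z"
  shows "\<rho> \<in> X k" "(\<rho>, z) \<in> R k"
  using assms unfolding rooted_def by auto

text \<open>The reason why subdividing a cell does not merge components. For level 0, everything is linked. For a
cell of level \<open>j + 1\<close> the root is the centre of its parent \<open>P\<close>: two sides of \<open>c\<close> lie on the
midlines of \<open>P\<close>. The other two lie on sides of \<open>P\<close>, and if such a side of \<open>c\<close> is shared with a cell
of level \<open>j + 1\<close>, then \<open>P\<close> shares its side with the parent of that cell, so the midpoint of
the side of \<open>P\<close> is a crossing, linked to the centre by a midline.\<close>

lemma root_exists: "c \<in> Q k \<Longrightarrow> \<exists>\<rho>. rooted k c \<rho>"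
proof (cases k)
  case 0
  obtain x where x: "x \<in> F True" "A True < x" "x < B True" using inner_line[of True] by blast
  obtain y where y: "y \<in> F (\<not> True)" "A (\<not> True) < y" "y < B (\<not> True)" using inner_line[of "\<not> True"] by blast
  have "mk True x y \<in> X 0" by (rule frame_crossing[OF x(1) y(1) x(2,3) y(2,3)])
  moreover have "co d z \<in> F d" if "z \<in> X 0" for z d
    using X_lines[OF that, of "\<not> d"] lines_0[of z "\<not> d"] by simp
  ultimately show ?thesis unfolding rooted_def 0 using frame_crossings_linked by blast
next
  case (Suc j)
  assume "c \<in> Q k"
  then have cQ: "c \<in> Q (Suc j)" using Suc by simp
  then obtain P where P: "P \<in> S j" "c \<in> subcells P" using Q_Suc by blast
  then have PQ: "P \<in> Q j" using S_Q by blast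
  have sub: "lo d c = lo d P \<and> hi d c = mid d P \<or> lo d c = mid d P \<and> hi d c = hi d P" for d
    using P(2) in_subcells_iff by blast
  have mc: "lo d P \<le> mid d c" "mid d c \<le> hi d P" for d
    using sub[of d] lo_hi[OF PQ, of d] lo_hi[OF cQ, of d] by auto
  have linked: "(center P, z) \<in> R (Suc j)"
    if sh: "shared (Q (Suc j)) c d x" and z: "z \<in> X (Suc j)" and adj_z: "adj (lines (Suc j)) (\<not> d) (mk d x (mid (\<not> d) c)) z" for d x z
  proof (cases "x = mid d P")
    case True
    have "adj (lines (Suc j)) (\<not> d) (center P) (mk d x (mid (\<not> d) c))"
      using covers_midline[OF P(1), of "\<not> d"] mc[of "\<not> d"] lo_hi[OF PQ, of "\<not> d"] Lo_Hi[OF PQ, of "\<not> d"] True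
      unfolding adj_def by (auto intro: covers_subset)
    then show ?thesis using adj_trans adj_z linked_adj center_X[OF P(1)] z by blast
  next
    case False
    then have x: "x = lo d P \<or> x = hi d P" using sh sub[of d] unfolding shared_def by auto
    have shP: "shared (S j) P d x"
    proof (cases "A d < x \<and> x < B d \<and> (x = a d \<or> x = b d)")
      case True
      then show ?thesis using x unfolding shared_def by blast
    next
      case F: False
      then obtain e where e: "e \<in> Q (Suc j)" "e \<noteq> c" "x = lo d e \<or> x = hi d e"
        "lo (\<not> d) e = lo (\<not> d) c" "hi (\<not> d) e = hi (\<not> d) c"
        using sh unfolding shared_def by blast
      then obtain P' where P': "P' \<in> S j" "e \<in> subcells P'" using Q_Suc by blast
      then have P'Q: "P' \<in> Q j" using S_Q by blast
      have sub': "lo d e = lo d P' \<and> hi d e = mid d P' \<or> lo d e = mid d P' \<and> hi d e = hi d P'" for d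
        using P'(2) in_subcells_iff by blast
      have "x \<in> old j d" using x gap_Q[OF PQ, of d] unfolding old_def gap_def by auto
      then have x': "x = lo d P' \<or> x = hi d P'" using sub'[of d] e(3) mid_new[OF P'Q, of d] by auto
      have same: "lo (\<not> d) P' = lo (\<not> d) P" "hi (\<not> d) P' = hi (\<not> d) P"
      proof -
        have "lo (\<not> d) P' < hi (\<not> d) P" "lo (\<not> d) P < hi (\<not> d) P'"
          using sub[of "\<not> d"] sub'[of "\<not> d"] e(4,5) lo_hi[OF PQ, of "\<not> d"] lo_hi[OF P'Q, of "\<not> d"] lo_hi[OF cQ, of "\<not> d"]
          by auto
        then show "lo (\<not> d) P' = lo (\<not> d) P" "hi (\<not> d) P' = hi (\<not> d) P"
          using gap_overlap[OF gap_Q[OF P'Q, of "\<not> d"] gap_Q[OF PQ, of "\<not> d"]] by auto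
      qed
      have "P' \<noteq> P"
      proof
        assume eq: "P' = P"
        have "lo d e = lo d c \<and> hi d e = hi d c"
          using sub[of d] sub'[of d] e(3) sh x lo_hi[OF PQ, of d] eq unfolding shared_def by auto
        then show False using cell_eqI[of d e c] e by blast
      qed
      then show ?thesis using P' x x' same unfolding shared_def by blast
    qed
    define v where "v = mk d x (mid (\<not> d) P)"
    have v: "v \<in> X (Suc j)" unfolding v_def by (rule crossing_side[OF P(1) shP])
    have "adj (lines (Suc j)) d (center P) v"
      using covers_midline[OF P(1), of d] lo_hi[OF PQ, of d] Lo_Hi[OF PQ, of d] x
      unfolding adj_def v_def by (auto intro: covers_subset)
    then have 1: "(center P, v) \<in> R (Suc j)" using linked_adj center_X[OF P(1)] v by blast
    have "covers (lines j) (\<not> d) x (lo (\<not> d) P) (hi (\<not> d) P)"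
      using covers_side[OF PQ, of x "\<not> d"] x by simp
    then have "covers (lines (Suc j)) (\<not> d) x (lo (\<not> d) P) (hi (\<not> d) P)"
      by (rule covers_mono) (simp add: lines_mono)
    then have "adj (lines (Suc j)) (\<not> d) v (mk d x (mid (\<not> d) c))"
      using mc[of "\<not> d"] lo_hi[OF PQ, of "\<not> d"] unfolding adj_def v_def by (auto intro: covers_subset)
    then have "adj (lines (Suc j)) (\<not> d) v z" using adj_trans adj_z by blast
    then have "(v, z) \<in> R (Suc j)" using linked_adj v z by blast
    then show ?thesis using 1 linked_trans by metis
  qed
  show ?thesis unfolding Suc rooted_def using center_X[OF P(1)] linked by blast
qed

definition root where "root k c = (SOME \<rho>. rooted k c \<rho>)"

lemma rooted_root: "c \<in> Q k \<Longrightarrow> rooted k c (root k c)"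
  unfolding root_def using root_exists someI_ex by metis

lemma shared_mono: "shared M c d x \<Longrightarrow> M \<subseteq> M' \<Longrightarrow> shared M' c d x"
  unfolding shared_def by blast

definition cls where "cls k z = R k `` {z}"

text \<open>The component to which the centre of a subdivided cell is going to belong: the old component at its
shared sides, or a new one named by the cell.\<close>

definition lab :: "nat \<Rightarrow> cell \<Rightarrow> (real \<times> real) set + cell" where
  "lab k c = (if c \<in> isolated k then Inr c else Inl (cls k (root k c)))"

lemma cls_eq: "z \<in> X k \<Longrightarrow> z' \<in> X k \<Longrightarrow> cls k z = cls k z' \<longleftrightarrow> (z, z') \<in> R k"
  unfolding cls_def by (rule linked_class_eq)

lemma lab_side:
  assumes c: "c \<in> S k" and sh: "shared (S k) c d x" and z: "z \<in> X k" "adj (lines k) (\<not> d) (mk d x (mid (\<not> d) c)) z"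
  shows "lab k c = Inl (cls k z)"
proof -
  have cQ: "c \<in> Q k" using c S_Q by blast
  have "root k c \<in> X k" "(root k c, z) \<in> R k"
    using rootedD[OF rooted_root[OF cQ] shared_mono[OF sh S_Q] z] by simp_all
  moreover have "c \<notin> isolated k" using sh unfolding isolated_def by blast
  ultimately show ?thesis using cls_eq z(1) unfolding lab_def by simp
qed

lemma side_hit:
  assumes c: "c \<in> Q k" and x: "x = lo d c \<or> x = hi d c" "A d < x" "x < B d"
  shows "\<exists>z\<in>X k. adj (lines k) (\<not> d) (mk d x (mid (\<not> d) c)) z"
proof (rule hit_X)
  have "covers (lines k) (\<not> d) x (lo (\<not> d) c) (hi (\<not> d) c)" using covers_side[OF c, of x "\<not> d"] x by simp
  then show "mk d x (mid (\<not> d) c) \<in> lines k (\<not> d)"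
    using lo_hi[OF c, of "\<not> d"] unfolding covers_def by (simp add: mk_flip)
qed (use x in auto)

lemma shared_inside:
  assumes c: "c \<in> S k" and sh: "shared (S k) c d x"
  shows "A d < x" "x < B d"
  using X_inside[OF crossing_side[OF assms], of d] by auto

lemma lab_frame:
  assumes c: "c \<in> S k" and sh: "shared (S k) c d x" and x: "x \<in> F d" and z: "z \<in> X k" "co d z \<in> F d"
  shows "lab k c = Inl (cls k z)"
proof -
  have cQ: "c \<in> Q k" using c S_Q by blast
  obtain z' where z': "z' \<in> X k" "adj (lines k) (\<not> d) (mk d x (mid (\<not> d) c)) z'"
    using side_hit[OF cQ, of x d] sh shared_inside[OF c sh] unfolding shared_def by blast
  then have "co d z' = x" by (simp add: adj_def)
  then have "(z', z) \<in> R k" using frame_crossings_linked z' z x by blast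
  then show ?thesis using lab_side[OF c sh z'] cls_eq z z' by simp
qed

text \<open>Two midlines on one straight line meet only at a side shared by their cells, and both labels are the
component at this side.\<close>

lemma lab_meet:
  assumes c: "c \<in> S k" "e \<in> S k" and p: "p \<in> midline d c" "p \<in> midline d e"
  shows "lab k c = lab k e"
proof (cases "c = e")
  case False
  have Qs: "c \<in> Q k" "e \<in> Q k" using c S_in_Q by simp_all
  have meet: "lab k c = lab k e"
    if c: "c \<in> S k" "e \<in> S k" "c \<in> Q k" "e \<in> Q k" "c \<noteq> e" and p: "p \<in> midline d c" "p \<in> midline d e" and le: "hi d c \<le> lo d e" for c e
  proof -
    have m: "mid (\<not> d) c = mid (\<not> d) e" using p unfolding midline_def by simp
    then have same: "lo (\<not> d) c = lo (\<not> d) e" "hi (\<not> d) c = hi (\<not> d) e" using mid_eq[OF c(3,4) m] by simp_all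
    have "lo d e \<noteq> a d" "hi d c \<noteq> b d" using le lo_hi[OF c(3), of d] lo_hi[OF c(4), of d] by auto
    then have "hi d c = lo d e" using p le unfolding midline_def Lo_def Hi_def by auto
    then have sh: "shared (S k) c d (hi d c)" "shared (S k) e d (hi d c)"
      using c(1,2,5) c(5)[symmetric] same unfolding shared_def by auto
    obtain z where "z \<in> X k" "adj (lines k) (\<not> d) (mk d (hi d c) (mid (\<not> d) c)) z"
      using side_hit[OF c(3), of "hi d c" d] shared_inside[OF c(1) sh(1)] by blast
    then show ?thesis using lab_side[OF c(1) sh(1)] lab_side[OF c(2) sh(2)] m by simp
  qed
  have m: "mid (\<not> d) c = mid (\<not> d) e" using p unfolding midline_def by simp
  then have "lo (\<not> d) c = lo (\<not> d) e" "hi (\<not> d) c = hi (\<not> d) e" using mid_eq[OF Qs m] by simp_all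
  then have "\<not> (lo d c = lo d e \<and> hi d c = hi d e)" using cell_eqI[of d c e] False by blast
  then have "hi d c \<le> lo d e \<or> hi d e \<le> lo d c"
    using gap_cases[OF gap_Q[OF Qs(1), of d] gap_Q[OF Qs(2), of d]] by auto
  then show ?thesis
    using meet[OF c Qs False p] meet[OF c(2,1) Qs(2,1) False[symmetric] p(2,1)] by auto
qed simp

end

section \<open>Counting the components level by level\<close>

context hier
begin

text \<open>A point slightly to the left of the midline, with no old coordinate in between, lies on the midline of
the neighbour.\<close>

lemma left_neighbour:
  assumes c: "c \<in> S k" and bw: "bwd (lines (Suc k)) d (mk d (lo d c) (mid (\<not> d) c))" and ne: "lo d c \<noteq> a d"
  obtains e where "e \<in> S k" "hi d e = lo d c" "mid (\<not> d) e = mid (\<not> d) c"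
proof -
  define x where "x = lo d c"
  have cQ: "c \<in> Q k" by (rule S_in_Q[OF c])
  have x: "a d < x" "x \<le> b d" "x \<in> coords k d"
    using lo_hi[OF cQ, of d] ne gap_Q[OF cQ, of d] unfolding x_def gap_def by auto
  obtain a' where a': "a' < x" "covers (lines (Suc k)) d (mid (\<not> d) c) a' x"
    using bw unfolding bwd_def x_def by auto
  define Y where "Y = {z \<in> coords k d. z < x}"
  have Y: "finite Y" "a d \<in> Y" unfolding Y_def using finite_coords x coords_endpoints by auto
  define m where "m = Max Y"
  have m: "m < x" "a d \<le> m" "\<And>z. z \<in> coords k d \<Longrightarrow> z < x \<Longrightarrow> z \<le> m"
  proof -
    have "m \<in> Y" unfolding m_def using Y by (intro Max_in) auto
    then show "m < x" unfolding Y_def by simp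
    show "a d \<le> m" "\<And>z. z \<in> coords k d \<Longrightarrow> z < x \<Longrightarrow> z \<le> m"
      unfolding m_def using Y by (auto intro!: Max_ge simp: Y_def)
  qed
  define M where "M = max a' m"
  have M: "a' \<le> M" "m \<le> M" "M < x" using a' m unfolding M_def by simp_all
  \<comment> \<open>No coordinate of level \<open>k\<close> lies between \<open>s\<close> and \<open>x\<close>.\<close>
  define s where "s = (M + x) / 2"
  have "M < s" "s < x" using M(3) unfolding s_def by simp_all
  then have s: "a' < s" "m < s" "s < x" using M by simp_all
  have "mk d s (mid (\<not> d) c) \<in> lines (Suc k) d" using a'(2) s unfolding covers_def by auto
  then obtain e where e: "e \<in> S k" "mk d s (mid (\<not> d) c) \<in> midline d e"
    using lines_Suc_new[of d "mk d s (mid (\<not> d) c)" k] mid_new[OF cQ, of "\<not> d"] by auto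
  have eQ: "e \<in> Q k" by (rule S_in_Q[OF e(1)])
  have "lo d e \<le> s" "s \<le> hi d e"
    using in_Lo_Hi[OF eQ, of d s] e(2) s m x unfolding midline_def by auto
  moreover have "hi d e \<in> coords k d" "x \<le> lo d e \<or> hi d e \<le> x"
    using gap_Q[OF eQ, of d] x(3) unfolding gap_def by auto
  ultimately have "hi d e = x" using m(3)[of "hi d e"] s by force
  then show thesis using that e unfolding midline_def x_def by simp
qed

lemma right_neighbour:
  assumes c: "c \<in> S k" and fw: "fwd (lines (Suc k)) d (mk d (hi d c) (mid (\<not> d) c))" and ne: "hi d c \<noteq> b d"
  obtains e where "e \<in> S k" "lo d e = hi d c" "mid (\<not> d) e = mid (\<not> d) c"
proof -
  define x where "x = hi d c"
  have cQ: "c \<in> Q k" by (rule S_in_Q[OF c])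
  have x: "x < b d" "a d \<le> x" "x \<in> coords k d"
    using lo_hi[OF cQ, of d] ne gap_Q[OF cQ, of d] unfolding x_def gap_def by auto
  obtain a' where a': "x < a'" "covers (lines (Suc k)) d (mid (\<not> d) c) x a'"
    using fw unfolding fwd_def x_def by auto
  define Y where "Y = {z \<in> coords k d. x < z}"
  have Y: "finite Y" "b d \<in> Y" unfolding Y_def using finite_coords x coords_endpoints by auto
  define m where "m = Min Y"
  have m: "x < m" "m \<le> b d" "\<And>z. z \<in> coords k d \<Longrightarrow> x < z \<Longrightarrow> m \<le> z"
  proof -
    have "m \<in> Y" unfolding m_def using Y by (intro Min_in) auto
    then show "x < m" unfolding Y_def by simp
    show "m \<le> b d" "\<And>z. z \<in> coords k d \<Longrightarrow> x < z \<Longrightarrow> m \<le> z"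
      unfolding m_def using Y by (auto intro!: Min_le simp: Y_def)
  qed
  define M where "M = min a' m"
  have M: "M \<le> a'" "M \<le> m" "x < M" using a' m unfolding M_def by simp_all
  define s where "s = (M + x) / 2"
  have "s < M" "x < s" using M(3) unfolding s_def by simp_all
  then have s: "s < a'" "s < m" "x < s" using M by simp_all
  have "mk d s (mid (\<not> d) c) \<in> lines (Suc k) d" using a'(2) s unfolding covers_def by auto
  then obtain e where e: "e \<in> S k" "mk d s (mid (\<not> d) c) \<in> midline d e"
    using lines_Suc_new[of d "mk d s (mid (\<not> d) c)" k] mid_new[OF cQ, of "\<not> d"] by auto
  have eQ: "e \<in> Q k" by (rule S_in_Q[OF e(1)])
  have "lo d e \<le> s" "s \<le> hi d e"
    using in_Lo_Hi[OF eQ, of d s] e(2) s m x unfolding midline_def by auto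
  moreover have "lo d e \<in> coords k d" "x \<le> lo d e \<or> hi d e \<le> x"
    using gap_Q[OF eQ, of d] x(3) unfolding gap_def by auto
  ultimately have "lo d e = x" using m(3)[of "lo d e"] s by force
  then show thesis using that e unfolding midline_def x_def by simp
qed

text \<open>The two kinds of new crossings. If the coordinate along the midline is new, the point also lies on an
orthogonal midline, and alignment forces both to belong to the same cell. Otherwise the point is on a
shared side, or on a line of the frame beyond the side at which the midline has been prolonged.\<close>

lemma crossing_on_midline:
  assumes c: "c \<in> S k" and p: "p \<in> X (Suc k)" and midline: "p \<in> midline d c"
  shows "p = center c \<or> (\<exists>x. shared (S k) c d x \<and> co d p \<in> old k d \<and> (co d p = x \<or> x \<in> F d \<and> co d p \<in> F d))"
proof -
  define x where "x = co d p"
  have cQ: "c \<in> Q k" by (rule S_in_Q[OF c])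
  have y: "co (\<not> d) p = mid (\<not> d) c" and xc: "Lo d c \<le> x" "x \<le> Hi d c" using midline unfolding midline_def x_def by auto
  have ins: "A d < x" "x < B d" using X_inside[OF p, of d] unfolding x_def by auto
  have th: "thru (lines (Suc k)) d p" using p unfolding crossings_def by blast
  have p_eq: "p = mk d x (mid (\<not> d) c)" unfolding x_def using y by (metis mk_co)
  show ?thesis
  proof (cases "x \<in> old k d")
    case False
    have "p \<in> lines (Suc k) (\<not> d)" by (rule X_lines[OF p])
    then obtain c' where c': "c' \<in> S k" "p \<in> midline (\<not> d) c'"
      using lines_Suc_new[of "\<not> d" p k] False unfolding x_def by auto
    then have c'Q: "c' \<in> Q k" by (intro S_in_Q)
    have m': "x = mid d c'" "Lo (\<not> d) c' \<le> mid (\<not> d) c" "mid (\<not> d) c \<le> Hi (\<not> d) c'"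
      using c'(2) y unfolding midline_def x_def by auto
    have "lo d c \<le> x" "x \<le> hi d c"
      using in_Lo_Hi[OF cQ xc] m'(1) lo_hi[OF c'Q, of d] by auto
    then have 1: "lo d c = lo d c'" "hi d c = hi d c'"
      using gap_overlap[OF gap_Q[OF cQ, of d] gap_Q[OF c'Q, of d]] m'(1) lo_hi[OF c'Q, of d] by auto
    have "lo (\<not> d) c' \<le> mid (\<not> d) c" "mid (\<not> d) c \<le> hi (\<not> d) c'"
      using in_Lo_Hi[OF c'Q m'(2,3)] lo_hi[OF cQ, of "\<not> d"] by auto
    then have "lo (\<not> d) c = lo (\<not> d) c'" "hi (\<not> d) c = hi (\<not> d) c'"
      using gap_overlap[OF gap_Q[OF cQ, of "\<not> d"] gap_Q[OF c'Q, of "\<not> d"]] lo_hi[OF cQ, of "\<not> d"] by auto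
    then have "c = c'" using cell_eqI[of d c c'] 1 by blast
    then have "p = center c" unfolding p_eq m'(1) center_eq[of c d] by simp
    then show ?thesis by blast
  next
    case old: True
    have "\<exists>x'. shared (S k) c d x' \<and> (x = x' \<or> x' \<in> F d \<and> x \<in> F d)"
    proof -
      consider "x < lo d c" | "x > hi d c" | "x = lo d c" | "x = hi d c" | "lo d c < x" "x < hi d c" by linarith
      then show ?thesis
      proof cases
        case 1
        then have "lo d c = a d" using xc unfolding Lo_def by (auto split: if_splits)
        moreover have "x \<in> F d" using old coords_ab[of k d] 1 calculation unfolding old_def by auto
        ultimately show ?thesis using 1 ins bounds[of d] ab[of d] unfolding shared_def by (intro exI[of _ "a d"]) auto
      next
        case 2
        then have "hi d c = b d" using xc unfolding Hi_def by (auto split: if_splits)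
        moreover have "x \<in> F d" using old coords_ab[of k d] 2 calculation unfolding old_def by auto
        ultimately show ?thesis using 2 ins bounds[of d] ab[of d] unfolding shared_def by (intro exI[of _ "b d"]) auto
      next
        case 3
        show ?thesis
        proof (cases "lo d c = a d")
          case True
          then show ?thesis using 3 ins unfolding shared_def by auto
        next
          case False
          have "bwd (lines (Suc k)) d (mk d (lo d c) (mid (\<not> d) c))"
            using th unfolding thru_def p_eq 3 by blast
          then obtain e where e: "e \<in> S k" "hi d e = lo d c" "mid (\<not> d) e = mid (\<not> d) c"
            using left_neighbour[OF c _ False] by blast
          have "e \<noteq> c" using e(2) lo_hi[OF cQ, of d] by auto
          then have "shared (S k) c d x"
            using e mid_eq[OF S_in_Q[OF e(1)] cQ e(3)] 3 unfolding shared_def by metis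
          then show ?thesis by blast
        qed
      next
        case 4
        show ?thesis
        proof (cases "hi d c = b d")
          case True
          then show ?thesis using 4 ins unfolding shared_def by auto
        next
          case False
          have "fwd (lines (Suc k)) d (mk d (hi d c) (mid (\<not> d) c))"
            using th unfolding thru_def p_eq 4 by blast
          then obtain e where e: "e \<in> S k" "lo d e = hi d c" "mid (\<not> d) e = mid (\<not> d) c"
            using right_neighbour[OF c _ False] by blast
          have "e \<noteq> c" using e(2) lo_hi[OF cQ, of d] by auto
          then have "shared (S k) c d x"
            using e mid_eq[OF S_in_Q[OF e(1)] cQ e(3)] 4 unfolding shared_def by metis
          then show ?thesis by blast
        qed
      next
        case 5
        then have "x \<in> coords k d" using old_coords[OF old] lo_hi[OF cQ, of d] by auto
        then show ?thesis using 5 gap_Q[OF cQ, of d] unfolding gap_def by force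
      qed
    qed
    then show ?thesis using old unfolding x_def by blast
  qed
qed

lemma old_X:
  assumes p: "p \<in> X (Suc k)" and old: "\<And>d. co d p \<in> old k d"
  shows "p \<in> X k"
proof -
  have "thru (lines k) d p" for d
  proof -
    have "thru (lines (Suc k)) d p" using p unfolding crossings_def by blast
    then show ?thesis
      unfolding thru_def bwd_def fwd_def using covers_Suc_old[OF old[of "\<not> d"]] by simp
  qed
  then show ?thesis using p unfolding crossings_def by blast
qed

text \<open>The component of a crossing of level \<open>k + 1\<close>: an old component if an old crossing can be reached
along an old line, and otherwise that of the cell whose centre it is.\<close>

definition label where
  "label k p = (if \<exists>z\<in>X k. \<exists>d. adj (lines k) d p z
     then Inl (cls k (SOME z. z \<in> X k \<and> (\<exists>d. adj (lines k) d p z)))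
     else lab k (SOME c. c \<in> S k \<and> center c = p))"

text \<open>Independence of the choice: if old lines of both directions pass through the point, it is already a
crossing of level \<open>k\<close>.\<close>

lemma label_old:
  assumes p: "p \<in> X (Suc k)" and z: "z \<in> X k" "adj (lines k) d p z"
  shows "label k p = Inl (cls k z)"
proof -
  define z' where "z' = (SOME z. z \<in> X k \<and> (\<exists>d. adj (lines k) d p z))"
  have "z' \<in> X k \<and> (\<exists>d. adj (lines k) d p z')" unfolding z'_def by (rule someI[of _ z]) (use z in blast)
  then obtain d' where z': "z' \<in> X k" "adj (lines k) d' p z'" by blast
  have "(z', z) \<in> R k"
  proof (cases "d = d'")
    case True
    then have "adj (lines k) d z' z" using z z' adj_sym adj_trans by blast
    then show ?thesis using linked_adj z z' by blast
  next
    case False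
    then have d': "d' = (\<not> d)" by auto
    have "p \<in> lines k d" "p \<in> lines k (\<not> d)" using adj_in z(2) z'(2) d' by blast+
    then have "co (\<not> d) p \<in> old k (\<not> d)" "co d p \<in> old k d" using lines_old[of p k d] lines_old[of p k "\<not> d"] by auto
    then have "co e p \<in> old k e" for e by (cases "e = d") auto
    then have "p \<in> X k" by (rule old_X[OF p])
    then have "(p, z) \<in> R k" "(p, z') \<in> R k" using linked_adj z z' by blast+
    then show ?thesis using linked_sym linked_trans by metis
  qed
  then have "cls k z' = cls k z" using cls_eq z z' by simp
  moreover have "label k p = Inl (cls k z')" unfolding label_def z'_def using z by auto
  ultimately show ?thesis by simp
qed

lemma center_inj: "c \<in> Q k \<Longrightarrow> c' \<in> Q k \<Longrightarrow> center c = center c' \<Longrightarrow> c = c'"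
proof -
  assume c: "c \<in> Q k" "c' \<in> Q k" "center c = center c'"
  have "mid d c = mid d c'" for d using c(3) co_center by metis
  then show "c = c'" using mid_eq[OF c(1,2)] cell_eqI[of True c c'] by blast
qed

lemma center_label: "c \<in> S k \<Longrightarrow> label k (center c) = lab k c"
proof -
  assume c: "c \<in> S k"
  have "\<not> adj (lines k) d (center c) z" for d z
  proof
    assume "adj (lines k) d (center c) z"
    then have "center c \<in> lines k d" using adj_in by blast
    then show False using lines_old[of "center c" k d] mid_new[OF S_in_Q[OF c], of "\<not> d"] by simp
  qed
  moreover have "(SOME c'. c' \<in> S k \<and> center c' = center c) = c"
    using c center_inj S_in_Q by (intro some_equality) blast+
  ultimately show ?thesis unfolding label_def by simp
qed

lemma label_midline:
  assumes c: "c \<in> S k" and p: "p \<in> X (Suc k)" and midline: "p \<in> midline d c"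
  shows "label k p = lab k c"
proof (cases "p = center c")
  case False
  then obtain x where x: "shared (S k) c d x" "co d p \<in> old k d" "co d p = x \<or> x \<in> F d \<and> co d p \<in> F d"
    using crossing_on_midline[OF c p midline] by blast
  have y: "co (\<not> d) p = mid (\<not> d) c" using midline unfolding midline_def by simp
  have "p \<in> lines k (\<not> d)" using lines_Suc_old[of "\<not> d" p k] x(2) X_lines[OF p, of "\<not> d"] by simp
  then obtain z where z: "z \<in> X k" "adj (lines k) (\<not> d) p z"
    using hit_X[of p k "\<not> d"] X_inside[OF p, of d] by auto
  have co_z: "co d z = co d p" using z(2) unfolding adj_def by simp
  have "lab k c = Inl (cls k z)"
    using x(3)
  proof
    assume "co d p = x"
    then have "mk d x (mid (\<not> d) c) = p" using y by (metis mk_co)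
    then show ?thesis using lab_side[OF c x(1) z(1)] z(2) by simp
  next
    assume "x \<in> F d \<and> co d p \<in> F d"
    then show ?thesis using lab_frame[OF c x(1) _ z(1)] co_z by simp
  qed
  then show ?thesis using label_old[OF p z] by simp
qed (use c center_label in simp)

lemma closed_midline: "closed (midline d c)"
proof -
  have "midline d c = co (\<not> d) -` {mid (\<not> d) c} \<inter> co d -` {Lo d c..Hi d c}" unfolding midline_def by auto
  then show ?thesis by (auto intro!: closed_Int closed_vimage continuous_on_co)
qed

text \<open>The midlines with a given label are closed, those with different labels are disjoint, and a segment is
connected.\<close>

lemma lab_chain:
  assumes cov: "closed_segment p q \<subseteq> (\<Union>c\<in>S k. midline d c)"
    and c: "c \<in> S k" "p \<in> midline d c" and e: "e \<in> S k" "q \<in> midline d e"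
  shows "lab k c = lab k e"
proof (rule ccontr)
  assume ne: "lab k c \<noteq> lab k e"
  define U where "U = (\<Union>f\<in>{f \<in> S k. lab k f = lab k c}. midline d f)"
  define V where "V = (\<Union>f\<in>{f \<in> S k. lab k f \<noteq> lab k c}. midline d f)"
  have "closed U" "closed V" unfolding U_def V_def using finite_S closed_midline by (auto intro!: closed_UN)
  moreover have "closed_segment p q \<subseteq> U \<union> V" using cov unfolding U_def V_def by blast
  moreover have "U \<inter> V = {}"
  proof (rule ccontr)
    assume "U \<inter> V \<noteq> {}"
    then obtain w f g where "f \<in> S k" "lab k f = lab k c" "w \<in> midline d f"
      "g \<in> S k" "lab k g \<noteq> lab k c" "w \<in> midline d g"
      unfolding U_def V_def by auto
    then show False using lab_meet[of f k g w d] by simp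
  qed
  moreover have "p \<in> U \<inter> closed_segment p q" unfolding U_def using c by auto
  moreover have "q \<in> V \<inter> closed_segment p q" unfolding V_def using e ne by auto
  moreover have "connected (closed_segment p q)" by simp
  ultimately show False unfolding connected_closed by blast
qed

text \<open>Old straight lines contain no new segments and new straight lines consist of midlines, so both ends
get their labels from the same source.\<close>

lemma label_adj:
  assumes p: "p \<in> X (Suc k)" and q: "q \<in> X (Suc k)" and adj: "adj (lines (Suc k)) d p q"
  shows "label k p = label k q"
proof (cases "co (\<not> d) p \<in> old k (\<not> d)")
  case True
  have adj': "adj (lines k) d p q" using adj unfolding adj_def covers_Suc_old[OF True] .
  then have "p \<in> lines k d" using adj_in by blast
  then obtain z where z: "z \<in> X k" "adj (lines k) d p z" using hit_X X_inside[OF p] by blast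
  then have "adj (lines k) d q z" using adj' adj_sym adj_trans by blast
  then show ?thesis using label_old[OF p z] label_old[OF q z(1)] by simp
next
  case False
  have co_q: "co (\<not> d) q = co (\<not> d) p" using adj unfolding adj_def by simp
  have cov: "closed_segment p q \<subseteq> (\<Union>c\<in>S k. midline d c)"
  proof
    fix w assume w: "w \<in> closed_segment p q"
    have eq: "closed_segment p q = closed_segment (mk d (co d p) (co (\<not> d) p)) (mk d (co d q) (co (\<not> d) p))"
      using co_q by (metis mk_co)
    then have w': "co (\<not> d) w = co (\<not> d) p" "co d w \<in> closed_segment (co d p) (co d q)"
      using subsetD[OF equalityD1[OF eq] w] unfolding in_closed_segment_mk by auto
    then have "mk d (co d w) (co (\<not> d) w) \<in> lines (Suc k) d"
      using adj unfolding adj_def covers_def closed_segment_eq_real_ivl by (auto split: if_splits)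
    then have "w \<in> lines (Suc k) d" by simp
    then show "w \<in> (\<Union>c\<in>S k. midline d c)" using lines_Suc_new[of d w k] False w'(1) by simp
  qed
  obtain c where c: "c \<in> S k" "p \<in> midline d c" using cov by auto
  obtain e where e: "e \<in> S k" "q \<in> midline d e" using cov by auto
  show ?thesis
    using lab_chain[OF cov c e] label_midline[OF c(1) p c(2)] label_midline[OF e(1) q e(2)] by simp
qed

text \<open>Every crossing is linked to an old crossing with its label, or is the centre of an isolated cell. The
centre of a cell with a shared side is linked to the midpoint of that side.\<close>

lemma label_cases:
  assumes p: "p \<in> X (Suc k)"
  obtains z where "z \<in> X k" "label k p = Inl (cls k z)" "(p, z) \<in> R (Suc k)"
  | c where "c \<in> isolated k" "p = center c" "label k p = Inr c"
proof (cases "\<exists>z\<in>X k. \<exists>d. adj (lines k) d p z")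
  case True
  then obtain z d where z: "z \<in> X k" "adj (lines k) d p z" by blast
  have "adj (lines (Suc k)) d p z" using adj_mono[OF z(2)] lines_mono[of k "Suc k" d] by auto
  moreover have "z \<in> X (Suc k)" using z X_mono[of k "Suc k"] by auto
  ultimately have "(p, z) \<in> R (Suc k)" using linked_adj[OF p] by blast
  then show thesis using that(1) z label_old[OF p z] by blast
next
  case False
  have "p \<notin> lines k d" for d using False hit_X[of p k d] X_inside[OF p] by blast
  then obtain c where c: "c \<in> S k" "p \<in> midline True c" using X_lines[OF p, of True] unfolding lines_Suc by blast
  have "co True p \<notin> old k True"
  proof
    assume "co True p \<in> old k True"
    then have "p \<in> lines k False" using lines_Suc_old[of False p k] X_lines[OF p, of False] by simp
    then show False using \<open>\<And>d. p \<notin> lines k d\<close> by blast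
  qed
  then have pc: "p = center c" using crossing_on_midline[OF c(1) p c(2)] by blast
  have lp: "label k p = lab k c" using label_midline[OF c(1) p c(2)] .
  show thesis
  proof (cases "c \<in> isolated k")
    case True
    then show ?thesis using that(2) pc lp unfolding lab_def by simp
  next
    case False
    then obtain d x where sh: "shared (S k) c d x" using c unfolding isolated_def by blast
    have cQ: "c \<in> Q k" by (rule S_in_Q[OF c(1)])
    define m where "m = mk d x (mid (\<not> d) c)"
    have x: "x = lo d c \<or> x = hi d c" using sh unfolding shared_def by blast
    have m: "m \<in> X (Suc k)" unfolding m_def by (rule crossing_side[OF c(1) sh])
    obtain z where z: "z \<in> X k" "adj (lines k) (\<not> d) m z"
      using side_hit[OF cQ x shared_inside[OF c(1) sh]] unfolding m_def by blast
    have "adj (lines (Suc k)) (\<not> d) m z" using adj_mono[OF z(2)] lines_mono[of k "Suc k" "\<not> d"] by auto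
    moreover have "z \<in> X (Suc k)" using z X_mono[of k "Suc k"] by auto
    ultimately have "(m, z) \<in> R (Suc k)" using linked_adj[OF m] by blast
    moreover have "adj (lines (Suc k)) d p m"
      using covers_midline[OF c(1), of d] x lo_hi[OF cQ, of d] Lo_Hi[OF cQ, of d]
      unfolding pc m_def adj_def by (auto intro: covers_subset)
    then have "(p, m) \<in> R (Suc k)" using linked_adj[OF p m] by blast
    ultimately have "(p, z) \<in> R (Suc k)" using linked_trans by metis
    moreover have "lab k c = Inl (cls k z)" using lab_side[OF c(1) sh z(1)] z(2) unfolding m_def by blast
    ultimately show ?thesis using that(1) z(1) lp by simp
  qed
qed

lemma finite_X: "finite (X k)"
  by (rule arrangement.finite_X[OF arrangement_lines])

text \<open>By the preceding lemmas the labels distinguish exactly the components of level \<open>k + 1\<close>, and they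
are the old components and the isolated cells.\<close>

lemma card_classes_Suc: "card (X (Suc k) // R (Suc k)) = card (X k // R k) + card (isolated k)"
proof -
  have lab_R: "(p, q) \<in> R (Suc k) \<longleftrightarrow> label k p = label k q" if pq: "p \<in> X (Suc k)" "q \<in> X (Suc k)" for p q
  proof
    assume "(p, q) \<in> R (Suc k)"
    then show "label k p = label k q" by (rule linked_invariant) (rule label_adj)
  next
    assume eq: "label k p = label k q"
    show "(p, q) \<in> R (Suc k)"
    proof (cases rule: label_cases[OF pq(1)])
      case (1 z)
      show ?thesis
      proof (cases rule: label_cases[OF pq(2)])
        case q: (1 z')
        then have "(z, z') \<in> R k" using cls_eq[OF 1(1) q(1)] 1(2) eq by simp
        then have "(z, z') \<in> R (Suc k)" using R_mono by blast
        then show ?thesis using 1(3) q(3) linked_sym linked_trans by metis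
      next
        case (2 c)
        then show ?thesis using 1 eq by simp
      qed
    next
      case (2 c)
      show ?thesis
      proof (cases rule: label_cases[OF pq(2)])
        case q: (2 c')
        then have "p = q" using 2 eq by simp
        then show ?thesis using pq equiv_linked[of "X (Suc k)" "lines (Suc k)"] by (metis equivE refl_onD)
      next
        case (1 z)
        then show ?thesis using 2 eq by simp
      qed
    qed
  qed
  have img: "label k ` X (Suc k) = Inl ` (X k // R k) \<union> Inr ` isolated k"
  proof (intro equalityI subsetI)
    fix l assume "l \<in> label k ` X (Suc k)"
    then obtain p where p: "p \<in> X (Suc k)" "l = label k p" by blast
    show "l \<in> Inl ` (X k // R k) \<union> Inr ` isolated k"
    proof (cases rule: label_cases[OF p(1)])
      case (1 z)
      then show ?thesis using p(2) unfolding cls_def by (auto intro: quotientI)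
    next
      case (2 c)
      then show ?thesis using p(2) by auto
    qed
  next
    fix l assume "l \<in> Inl ` (X k // R k) \<union> Inr ` isolated k"
    then show "l \<in> label k ` X (Suc k)"
    proof
      assume "l \<in> Inl ` (X k // R k)"
      then obtain z where z: "z \<in> X k" "l = Inl (cls k z)" unfolding quotient_def cls_def by blast
      have zS: "z \<in> X (Suc k)" using z X_mono[of k "Suc k"] by auto
      have "label k z = l" using label_old[OF zS z(1) adj_refl[of z "lines k" True, OF X_lines[OF z(1)]]] z(2) by simp
      then show ?thesis using zS by blast
    next
      assume "l \<in> Inr ` isolated k"
      then obtain c where c: "c \<in> isolated k" "l = Inr c" by blast
      then have "c \<in> S k" unfolding isolated_def by blast
      then show ?thesis using center_X center_label[of c k] c unfolding lab_def by (metis image_eqI)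
    qed
  qed
  have fin: "finite (X k // R k)" "finite (isolated k)"
    using finite_quotient[OF finite_X equiv_type[OF equiv_linked]] finite_S unfolding isolated_def by simp_all
  have "card (X (Suc k) // R (Suc k)) = card (label k ` X (Suc k))"
    by (rule card_quotient_labels[OF finite_X equiv_linked lab_R])
  also have "\<dots> = card (X k // R k) + card (isolated k)"
    unfolding img using fin by (subst card_Un_disjoint) (auto simp: card_image)
  finally show ?thesis .
qed

lemma card_classes_0: "card (X 0 // R 0) = 1"
proof -
  obtain x where x: "x \<in> F True" "A True < x" "x < B True" using inner_line[of True] by blast
  obtain y where y: "y \<in> F (\<not> True)" "A (\<not> True) < y" "y < B (\<not> True)" using inner_line[of "\<not> True"] by blast
  have ne: "mk True x y \<in> X 0" by (rule frame_crossing[OF x(1) y(1) x(2,3) y(2,3)])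
  have F: "co d z \<in> F d" if "z \<in> X 0" for z d
    using X_lines[OF that, of "\<not> d"] lines_0[of z "\<not> d"] by simp
  have "(p, q) \<in> R 0" if "p \<in> X 0" "q \<in> X 0" for p q
    using frame_crossings_linked[OF that, of True True] F that by blast
  then have 1: "card (X 0 // R 0) = card ((\<lambda>_ :: real \<times> real. ()) ` X 0)"
    by (intro card_quotient_labels finite_X equiv_linked) simp
  have 2: "(\<lambda>_ :: real \<times> real. ()) ` X 0 = {()}" using ne by auto
  show ?thesis unfolding 1 2 by simp
qed

theorem card_classes: "card (X n // R n) = 1 + (\<Sum>k<n. card (isolated k))"
proof (induction n)
  case 0
  then show ?case using card_classes_0 by simp
next
  case (Suc n)
  then show ?case using card_classes_Suc[of n] by simp
qed

end

section \<open>Grids, subcells and neighbours\<close>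

text \<open>The union of the sides of direction \<open>d\<close> of all cells.\<close>

definition Hs :: "cell set \<Rightarrow> bool \<Rightarrow> (real \<times> real) set" where
  "Hs T d = {p. \<exists>c\<in>T. lo d c \<le> co d p \<and> co d p \<le> hi d c \<and> (co (\<not> d) p = lo (\<not> d) c \<or> co (\<not> d) p = hi (\<not> d) c)}"

definition nondeg :: "cell \<Rightarrow> bool" where "nondeg c \<longleftrightarrow> (\<forall>d. lo d c < hi d c)"

definition sep :: "cell \<Rightarrow> cell \<Rightarrow> bool" where
  "sep c e \<longleftrightarrow> (\<exists>d. hi d c \<le> lo d e \<or> hi d e \<le> lo d c)"

lemma in_rect: "p \<in> rect c \<longleftrightarrow> (\<forall>d. lo d c \<le> co d p \<and> co d p \<le> hi d c)"
  unfolding rect_def lo_def hi_def co_def all_bool_eq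
  by (cases p; cases "fst c"; cases "snd c") (auto simp: cbox_Pair_eq)

lemma in_frontier_rect:
  "p \<in> frontier (rect c) \<longleftrightarrow> p \<in> rect c \<and> (\<exists>d. co d p = lo d c \<or> co d p = hi d c)"
proof -
  have "p \<in> interior (rect c) \<longleftrightarrow> (\<forall>d. lo d c < co d p \<and> co d p < hi d c)"
    unfolding rect_def lo_def hi_def co_def all_bool_eq
    by (cases p; cases "fst c"; cases "snd c") (auto simp: cbox_Pair_eq interior_Times)
  moreover have "closed (rect c)" unfolding rect_def by (rule closed_cbox)
  then have "frontier (rect c) = rect c - interior (rect c)" by (simp add: frontier_def)
  moreover have "lo d c < co d p \<and> co d p < hi d c \<longleftrightarrow> \<not> (co d p = lo d c \<or> co d p = hi d c)"
    if "p \<in> rect c" for d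
    using that[unfolded in_rect, rule_format, of d] by linarith
  ultimately show ?thesis by blast
qed

lemma in_corners: "p \<in> corners c \<longleftrightarrow> (\<forall>d. co d p = lo d c \<or> co d p = hi d c)"
  unfolding corners_def lo_def hi_def co_def all_bool_eq mem_Times_iff by auto

lemma skeleton_Hs:
  assumes "\<And>c. c \<in> T \<Longrightarrow> nondeg c"
  shows "skeleton T = Hs T True \<union> Hs T False"
proof -
  have "p \<in> skeleton T \<longleftrightarrow> (\<exists>d. p \<in> Hs T d)" for p
  proof
    assume "p \<in> skeleton T"
    then obtain c where c: "c \<in> T" "p \<in> frontier (rect c)" unfolding skeleton_def by blast
    then obtain d where "p \<in> rect c" "co d p = lo d c \<or> co d p = hi d c" using in_frontier_rect by blast
    then have "p \<in> Hs T (\<not> d)" using c(1) unfolding Hs_def in_rect by auto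
    then show "\<exists>d. p \<in> Hs T d" by blast
  next
    assume "\<exists>d. p \<in> Hs T d"
    then obtain d c where c: "c \<in> T" "lo d c \<le> co d p" "co d p \<le> hi d c"
      "co (\<not> d) p = lo (\<not> d) c \<or> co (\<not> d) p = hi (\<not> d) c"
      unfolding Hs_def by blast
    have "lo e c \<le> co e p \<and> co e p \<le> hi e c" for e
      using c assms[OF c(1)] unfolding nondeg_def by (cases "e = d") (auto simp: less_imp_le)
    then have "p \<in> frontier (rect c)" using c(4) unfolding in_frontier_rect in_rect by blast
    then show "p \<in> skeleton T" using c(1) unfolding skeleton_def by blast
  qed
  then show ?thesis by (auto simp: ex_bool_eq)
qed

text \<open>If a point were in the relative interior of a horizontal side of one cell and of a vertical side of
another, the interiors of the two cells would overlap.\<close>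

lemma vertices_Hs:
  assumes nd: "\<And>c. c \<in> T \<Longrightarrow> nondeg c" and sp: "\<And>c e. c \<in> T \<Longrightarrow> e \<in> T \<Longrightarrow> c \<noteq> e \<Longrightarrow> sep c e"
  shows "vertices T = Hs T True \<inter> Hs T False"
proof (intro equalityI subsetI)
  fix p assume "p \<in> vertices T"
  then obtain c where c: "c \<in> T" "\<forall>d. co d p = lo d c \<or> co d p = hi d c"
    unfolding vertices_def in_corners[symmetric] by blast
  then have "lo d c \<le> co d p \<and> co d p \<le> hi d c" for d
    using nd[OF c(1)] unfolding nondeg_def by (metis less_imp_le order_refl)
  then have "p \<in> Hs T d" for d using c unfolding Hs_def by blast
  then show "p \<in> Hs T True \<inter> Hs T False" by blast
next
  fix p assume "p \<in> Hs T True \<inter> Hs T False"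
  then obtain c e where c: "c \<in> T" "lo True c \<le> co True p" "co True p \<le> hi True c"
      "co False p = lo False c \<or> co False p = hi False c"
    and e: "e \<in> T" "lo False e \<le> co False p" "co False p \<le> hi False e"
      "co True p = lo True e \<or> co True p = hi True e"
    unfolding Hs_def by auto
  have nds: "lo True c < hi True c" "lo False c < hi False c" "lo True e < hi True e" "lo False e < hi False e"
    using nd[OF c(1)] nd[OF e(1)] unfolding nondeg_def by auto
  have "p \<in> corners c \<or> p \<in> corners e"
  proof (rule ccontr)
    assume no: "\<not> (p \<in> corners c \<or> p \<in> corners e)"
    then have s: "lo True c < co True p" "co True p < hi True c" "lo False e < co False p" "co False p < hi False e"
      using c e unfolding in_corners all_bool_eq by auto
    then have "c \<noteq> e" using c(4) by auto
    then have "sep c e" using sp c(1) e(1) by blast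
    then show False using s c(4) e(4) nds unfolding sep_def ex_bool_eq by auto
  qed
  then show "p \<in> vertices T" using c(1) e(1) unfolding vertices_def by blast
qed

definition grid :: "(bool \<Rightarrow> real set) \<Rightarrow> cell set" where
  "grid Y = {c. \<forall>d. gap (Y d) (lo d c) (hi d c)}"

lemma gap_nth:
  assumes "sorted_wrt (<) xs"
  shows "gap (set xs) x y \<longleftrightarrow> (\<exists>i. Suc i < length xs \<and> x = xs ! i \<and> y = xs ! Suc i)"
proof
  assume "\<exists>i. Suc i < length xs \<and> x = xs ! i \<and> y = xs ! Suc i"
  then obtain i where i: "Suc i < length xs" "x = xs ! i" "y = xs ! Suc i" by blast
  have "z \<le> x \<or> y \<le> z" if z: "z \<in> set xs" for z
  proof -
    obtain j where j: "j < length xs" "z = xs ! j" using z by (metis in_set_conv_nth)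
    show ?thesis
    proof (cases "j \<le> i")
      case True
      then show ?thesis using sorted_wrt_nth_less[OF assms, of j i] i j by (cases "j = i") auto
    next
      case False
      then show ?thesis using sorted_wrt_nth_less[OF assms, of "Suc i" j] i j by (cases "j = Suc i") auto
    qed
  qed
  moreover have "x < y" using sorted_wrt_nth_less[OF assms, of i "Suc i"] i by simp
  ultimately show "gap (set xs) x y" using i unfolding gap_def by auto
next
  assume c: "gap (set xs) x y"
  then obtain i j where ij: "i < length xs" "x = xs ! i" "j < length xs" "y = xs ! j"
    unfolding gap_def by (metis in_set_conv_nth)
  have lt: "i < j"
  proof (rule ccontr)
    assume "\<not> i < j"
    then have "y \<le> x" using sorted_wrt_nth_less[OF assms, of j i] ij by (cases "j = i") auto
    then show False using c unfolding gap_def by simp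
  qed
  have "j = Suc i"
  proof (rule ccontr)
    assume "j \<noteq> Suc i"
    then have "Suc i < j" using lt by simp
    then have "x < xs ! Suc i" "xs ! Suc i < y" "xs ! Suc i \<in> set xs"
      using sorted_wrt_nth_less[OF assms, of i "Suc i"] sorted_wrt_nth_less[OF assms, of "Suc i" j] ij by auto
    then show False using c unfolding gap_def by force
  qed
  then show "\<exists>i. Suc i < length xs \<and> x = xs ! i \<and> y = xs ! Suc i" using ij by blast
qed

lemma tensor_mesh_grid:
  assumes "sorted_wrt (<) xs" "sorted_wrt (<) ys"
  shows "tensor_mesh xs ys = grid (\<lambda>d. if d then set xs else set ys)"
proof -
  have "c \<in> tensor_mesh xs ys \<longleftrightarrow> gap (set xs) (lo True c) (hi True c) \<and> gap (set ys) (lo False c) (hi False c)" for c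
    unfolding tensor_mesh_def gap_nth[OF assms(1)] gap_nth[OF assms(2)] lo_def hi_def co_def
    by (cases "fst c"; cases "snd c"; cases c) auto
  then show ?thesis unfolding grid_def by (auto simp: all_bool_eq)
qed

lemma gap_cover:
  assumes Y: "finite Y" "x \<in> Y" "y \<in> Y" "x \<le> s" "s \<le> y" "x < y"
  shows "\<exists>l h. gap Y l h \<and> l \<le> s \<and> s \<le> h"
proof -
  define P where "P = {z \<in> Y. z \<le> s \<and> z < y}"
  have P: "finite P" "x \<in> P" using Y by (auto simp: P_def)
  define l where "l = Max P"
  have l: "l \<in> P" "\<And>z. z \<in> P \<Longrightarrow> z \<le> l" unfolding l_def using P by (auto intro: Max_in)
  then have lY: "l \<in> Y" "l \<le> s" "l < y" by (auto simp: P_def)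
  define N where "N = {z \<in> Y. l < z}"
  have N: "finite N" "y \<in> N" using Y lY by (auto simp: N_def)
  define h where "h = Min N"
  have h: "h \<in> N" "\<And>z. z \<in> N \<Longrightarrow> h \<le> z" unfolding h_def using N by (auto intro: Min_in)
  then have hY: "h \<in> Y" "l < h" "h \<le> y" using N by (auto simp: N_def)
  have "s \<le> h"
  proof (rule ccontr)
    assume "\<not> s \<le> h"
    then have "h \<in> P" using hY Y(5) by (auto simp: P_def)
    then show False using l(2) hY(2) by force
  qed
  moreover have "z \<le> l \<or> h \<le> z" if "z \<in> Y" for z
    using h(2)[of z] that by (cases "z \<le> l") (auto simp: N_def)
  then have "gap Y l h" unfolding gap_def using lY hY by blast
  ultimately show ?thesis using lY by blast
qed

lemma gap_within: "gap Y l h \<Longrightarrow> Y \<subseteq> {x..y} \<Longrightarrow> x \<le> l \<and> l < h \<and> h \<le> y"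
  unfolding gap_def by auto

lemma cell_exI:
  fixes l h :: "bool \<Rightarrow> real"
  shows "\<exists>c :: cell. \<forall>d. lo d c = l d \<and> hi d c = h d"
proof (intro exI allI)
  show "lo d ((l True, l False), (h True, h False)) = l d \<and> hi d ((l True, l False), (h True, h False)) = h d" for d
    by (cases d) (simp_all add: lo_def hi_def co_def)
qed

lemma grid_rects:
  assumes Y: "\<And>d. finite (Y d)" "\<And>d. x d \<in> Y d" "\<And>d. y d \<in> Y d" "\<And>d. x d < y d" "\<And>d. Y d \<subseteq> {x d..y d}"
  shows "(\<exists>c\<in>grid Y. p \<in> rect c) \<longleftrightarrow> (\<forall>d. x d \<le> co d p \<and> co d p \<le> y d)"
proof
  assume "\<exists>c\<in>grid Y. p \<in> rect c"
  then obtain c where c: "\<And>d. gap (Y d) (lo d c) (hi d c)" "\<And>d. lo d c \<le> co d p \<and> co d p \<le> hi d c"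
    unfolding grid_def in_rect by blast
  show "\<forall>d. x d \<le> co d p \<and> co d p \<le> y d"
  proof
    fix d show "x d \<le> co d p \<and> co d p \<le> y d" using gap_within[OF c(1) Y(5), of d] c(2)[of d] by linarith
  qed
next
  assume p: "\<forall>d. x d \<le> co d p \<and> co d p \<le> y d"
  have "\<exists>l h. gap (Y d) l h \<and> l \<le> co d p \<and> co d p \<le> h" for d
    using gap_cover[OF Y(1)[of d] Y(2)[of d] Y(3)[of d] _ _ Y(4)[of d], of "co d p"] p by blast
  then obtain l h where lh: "\<And>d. gap (Y d) (l d) (h d) \<and> l d \<le> co d p \<and> co d p \<le> h d" by metis
  obtain c where c: "\<And>d. lo d c = l d" "\<And>d. hi d c = h d" using cell_exI[of l h] by blast
  have "c \<in> grid Y" "p \<in> rect c" unfolding grid_def in_rect using lh c by auto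
  then show "\<exists>c\<in>grid Y. p \<in> rect c" by blast
qed

lemma grid_Hs:
  assumes Y: "\<And>d. finite (Y d)" "\<And>d. x d \<in> Y d" "\<And>d. y d \<in> Y d" "\<And>d. x d < y d" "\<And>d. Y d \<subseteq> {x d..y d}"
  shows "p \<in> Hs (grid Y) d \<longleftrightarrow> x d \<le> co d p \<and> co d p \<le> y d \<and> co (\<not> d) p \<in> Y (\<not> d)"
proof
  assume "p \<in> Hs (grid Y) d"
  then obtain c where c: "\<And>d. gap (Y d) (lo d c) (hi d c)" "lo d c \<le> co d p" "co d p \<le> hi d c"
    "co (\<not> d) p = lo (\<not> d) c \<or> co (\<not> d) p = hi (\<not> d) c"
    unfolding grid_def Hs_def by blast
  then show "x d \<le> co d p \<and> co d p \<le> y d \<and> co (\<not> d) p \<in> Y (\<not> d)"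
    using gap_within[OF c(1) Y(5), of d] c(1)[of "\<not> d"] unfolding gap_def by auto
next
  assume p: "x d \<le> co d p \<and> co d p \<le> y d \<and> co (\<not> d) p \<in> Y (\<not> d)"
  obtain l1 h1 where 1: "gap (Y d) l1 h1" "l1 \<le> co d p" "co d p \<le> h1"
    using gap_cover[OF Y(1)[of d] Y(2)[of d] Y(3)[of d] _ _ Y(4)[of d], of "co d p"] p by blast
  let ?t = "co (\<not> d) p"
  have t: "x (\<not> d) \<le> ?t" "?t \<le> y (\<not> d)" using p Y(5)[of "\<not> d"] by auto
  obtain l2 h2 where 2: "gap (Y (\<not> d)) l2 h2" "l2 \<le> ?t" "?t \<le> h2"
    using gap_cover[OF Y(1)[of "\<not> d"] Y(2)[of "\<not> d"] Y(3)[of "\<not> d"] t Y(4)[of "\<not> d"]] by blast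
  have "?t = l2 \<or> ?t = h2" using 2 p unfolding gap_def by force
  define l h where "l e = (if e = d then l1 else l2)" and "h e = (if e = d then h1 else h2)" for e
  obtain c where c: "\<And>e. lo e c = l e" "\<And>e. hi e c = h e" using cell_exI[of l h] by blast
  have "gap (Y e) (lo e c) (hi e c)" for e
    unfolding c l_def h_def using 1 2 by (cases "e = d") auto
  then have "c \<in> grid Y" unfolding grid_def by blast
  moreover have "lo d c = l1" "hi d c = h1" "lo (\<not> d) c = l2" "hi (\<not> d) c = h2"
    unfolding c l_def h_def by auto
  ultimately show "p \<in> Hs (grid Y) d"
    using 1 \<open>?t = l2 \<or> ?t = h2\<close> unfolding Hs_def by (intro CollectI bexI[of _ c]) simp_all
qed

lemma grid_sep:
  assumes "c \<in> grid Y" "e \<in> grid Y" "c \<noteq> e"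
  shows "sep c e"
proof (rule ccontr)
  assume "\<not> sep c e"
  then have "lo d c = lo d e \<and> hi d c = hi d e" for d
    using gap_cases[of "Y d" "lo d c" "hi d c" "lo d e" "hi d e"] assms unfolding sep_def grid_def by blast
  then show False using cell_eqI[of True c e] assms(3) by blast
qed

lemma grid_nondeg: "c \<in> grid Y \<Longrightarrow> nondeg c"
  unfolding grid_def nondeg_def gap_def by blast

lemma finite_grid:
  assumes "\<And>d. finite (Y d)"
  shows "finite (grid Y)"
proof (rule finite_subset)
  show "grid Y \<subseteq> (Y True \<times> Y False) \<times> (Y True \<times> Y False)"
  proof
    fix c assume "c \<in> grid Y"
    then have "lo d c \<in> Y d" "hi d c \<in> Y d" for d unfolding grid_def gap_def by blast+
    from this(1)[of True] this(1)[of False] this(2)[of True] this(2)[of False]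
    show "c \<in> (Y True \<times> Y False) \<times> (Y True \<times> Y False)"
      unfolding lo_def hi_def co_def by (cases c) (auto simp: mem_Times_iff)
  qed
  show "finite ((Y True \<times> Y False) \<times> (Y True \<times> Y False))" using assms by (intro finite_cartesian_product)
qed

lemma Hs_Un: "Hs (T \<union> T') d = Hs T d \<union> Hs T' d"
  unfolding Hs_def by blast

lemma Hs_UN: "Hs (\<Union>i\<in>I. T i) d = (\<Union>i\<in>I. Hs (T i) d)"
  unfolding Hs_def by blast

lemma subcells_Hs:
  assumes c: "nondeg c"
  shows "Hs (subcells c) d = Hs {c} d \<union> {p. co (\<not> d) p = mid (\<not> d) c \<and> lo d c \<le> co d p \<and> co d p \<le> hi d c}"
proof (intro equalityI subsetI)
  fix p assume "p \<in> Hs (subcells c) d"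
  then obtain e where e: "\<forall>d. lo d e = lo d c \<and> hi d e = mid d c \<or> lo d e = mid d c \<and> hi d e = hi d c"
    "lo d e \<le> co d p" "co d p \<le> hi d e" "co (\<not> d) p = lo (\<not> d) e \<or> co (\<not> d) p = hi (\<not> d) e"
    unfolding Hs_def in_subcells_iff[symmetric] by blast
  have m: "lo d c \<le> mid d c" "mid d c \<le> hi d c" using c[unfolded nondeg_def, rule_format, of d] by (auto simp: mid_def)
  have "lo d c \<le> co d p \<and> co d p \<le> hi d c" using e(1)[rule_format, of d] e(2,3) m by auto
  then show "p \<in> Hs {c} d \<union> {p. co (\<not> d) p = mid (\<not> d) c \<and> lo d c \<le> co d p \<and> co d p \<le> hi d c}"
    using e(1)[rule_format, of "\<not> d"] e(4) unfolding Hs_def by auto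
next
  fix p assume "p \<in> Hs {c} d \<union> {p. co (\<not> d) p = mid (\<not> d) c \<and> lo d c \<le> co d p \<and> co d p \<le> hi d c}"
  then have p: "lo d c \<le> co d p" "co d p \<le> hi d c"
    "co (\<not> d) p = lo (\<not> d) c \<or> co (\<not> d) p = hi (\<not> d) c \<or> co (\<not> d) p = mid (\<not> d) c"
    unfolding Hs_def by auto
  define l h where "l e = (if e = d then (if co d p \<le> mid d c then lo d c else mid d c)
      else (if co (\<not> d) p = hi (\<not> d) c then mid (\<not> d) c else lo (\<not> d) c))"
    and "h e = (if e = d then (if co d p \<le> mid d c then mid d c else hi d c)
      else (if co (\<not> d) p = hi (\<not> d) c then hi (\<not> d) c else mid (\<not> d) c))" for e
  obtain x where x: "\<And>e. lo e x = l e" "\<And>e. hi e x = h e" using cell_exI[of l h] by blast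
  have "lo e x = lo e c \<and> hi e x = mid e c \<or> lo e x = mid e c \<and> hi e x = hi e c" for e
    unfolding x l_def h_def by (cases "e = d") auto
  then have "x \<in> subcells c" unfolding in_subcells_iff by blast
  moreover have "lo d x \<le> co d p" "co d p \<le> hi d x" "co (\<not> d) p = lo (\<not> d) x \<or> co (\<not> d) p = hi (\<not> d) x"
    unfolding x l_def h_def using p by auto
  ultimately show "p \<in> Hs (subcells c) d" unfolding Hs_def by blast
qed

lemma subcells_nondeg: "nondeg c \<Longrightarrow> e \<in> subcells c \<Longrightarrow> nondeg e"
proof -
  assume c: "nondeg c" "e \<in> subcells c"
  have "lo d e < hi d e" for d
    using c(1)[unfolded nondeg_def, rule_format, of d] c(2)[unfolded in_subcells_iff, rule_format, of d]
    by (auto simp: mid_def)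
  then show "nondeg e" unfolding nondeg_def by blast
qed

lemma subcells_within: "nondeg c \<Longrightarrow> e \<in> subcells c \<Longrightarrow> lo d c \<le> lo d e \<and> hi d e \<le> hi d c"
proof -
  assume c: "nondeg c" and e: "e \<in> subcells c"
  have "lo d c < mid d c" "mid d c < hi d c" using c[unfolded nondeg_def, rule_format, of d] by (auto simp: mid_def)
  then show ?thesis using e[unfolded in_subcells_iff, rule_format, of d] by auto
qed

lemma subcells_sep:
  assumes "x \<in> subcells c" "y \<in> subcells c" "x \<noteq> y"
  shows "sep x y"
proof (rule ccontr)
  assume no: "\<not> sep x y"
  have "lo d x = lo d y \<and> hi d x = hi d y" for d
  proof -
    have "\<not> hi d x \<le> lo d y" "\<not> hi d y \<le> lo d x" using no unfolding sep_def by blast+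
    then show ?thesis
      using assms(1)[unfolded in_subcells_iff, rule_format, of d] assms(2)[unfolded in_subcells_iff, rule_format, of d]
      by auto
  qed
  then show False using cell_eqI[of True x y] assms(3) by blast
qed

lemma subcells_rects: "nondeg c \<Longrightarrow> (\<exists>e\<in>subcells c. p \<in> rect e) \<longleftrightarrow> p \<in> rect c"
proof
  assume c: "nondeg c" and "\<exists>e\<in>subcells c. p \<in> rect e"
  then obtain e where e: "e \<in> subcells c" "\<And>d. lo d e \<le> co d p \<and> co d p \<le> hi d e" unfolding in_rect by blast
  have "lo d c \<le> co d p \<and> co d p \<le> hi d c" for d
    using subcells_within[OF c e(1), of d] e(2)[of d] by linarith
  then show "p \<in> rect c" unfolding in_rect by blast
next
  assume p: "p \<in> rect c"
  obtain x where x: "\<And>d. lo d x = (if co d p \<le> mid d c then lo d c else mid d c)"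
    "\<And>d. hi d x = (if co d p \<le> mid d c then mid d c else hi d c)"
    using cell_exI[of "\<lambda>d. if co d p \<le> mid d c then lo d c else mid d c" "\<lambda>d. if co d p \<le> mid d c then mid d c else hi d c"]
    by blast
  have "x \<in> subcells c" unfolding in_subcells_iff x by auto
  moreover have "p \<in> rect x" using p unfolding in_rect x by auto
  ultimately show "\<exists>e\<in>subcells c. p \<in> rect e" by blast
qed

lemma finite_subcells: "finite (subcells c)"
  unfolding subcells_def by (cases c) (auto simp: Let_def)

lemma neighbouring_sym: "neighbouring c e \<Longrightarrow> neighbouring e c"
  unfolding neighbouring_def by (metis Int_commute)

text \<open>Separated cells can only intersect in a segment orthogonal to the direction of separation.\<close>

lemma neighbouringD:
  assumes n: "neighbouring c e" and sp: "sep c e"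
  obtains d where "hi d c = lo d e \<or> hi d e = lo d c" "lo (\<not> d) c < hi (\<not> d) e" "lo (\<not> d) e < hi (\<not> d) c"
proof -
  obtain p q where pq: "p \<noteq> q" "rect c \<inter> rect e = closed_segment p q" using n unfolding neighbouring_def by blast
  have "p \<in> rect c \<inter> rect e" "q \<in> rect c \<inter> rect e" using pq(2) by auto
  then have in1: "lo d c \<le> co d p" "co d p \<le> hi d c" "lo d e \<le> co d p" "co d p \<le> hi d e"
    "lo d c \<le> co d q" "co d q \<le> hi d c" "lo d e \<le> co d q" "co d q \<le> hi d e" for d
    unfolding in_rect Int_iff by blast+
  obtain d where d: "hi d c \<le> lo d e \<or> hi d e \<le> lo d c" using sp unfolding sep_def by blast
  then have eq: "co d p = co d q" "hi d c = lo d e \<or> hi d e = lo d c"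
    using in1[of d] by auto
  then have "co (\<not> d) p \<noteq> co (\<not> d) q" using pq(1) co_eqI by blast
  then have "lo (\<not> d) c < hi (\<not> d) e" "lo (\<not> d) e < hi (\<not> d) c" using in1[of "\<not> d"] by linarith+
  then show thesis using that eq(2) by blast
qed

lemma neighbouringI:
  assumes nd: "nondeg c" "nondeg e" and t: "hi d c = lo d e" and eq: "lo (\<not> d) c = lo (\<not> d) e" "hi (\<not> d) c = hi (\<not> d) e"
  shows "neighbouring c e"
proof -
  define p q where "p = mk (\<not> d) (lo (\<not> d) c) (lo d e)" and "q = mk (\<not> d) (hi (\<not> d) c) (lo d e)"
  have lt: "lo x c < hi x c" "lo x e < hi x e" for x using nd unfolding nondeg_def by auto
  have "w \<in> rect c \<inter> rect e \<longleftrightarrow> w \<in> closed_segment p q" for w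
  proof -
    have "w \<in> rect c \<inter> rect e \<longleftrightarrow> (lo d c \<le> co d w \<and> co d w \<le> hi d c \<and> lo d e \<le> co d w \<and> co d w \<le> hi d e) \<and>
      (lo (\<not> d) c \<le> co (\<not> d) w \<and> co (\<not> d) w \<le> hi (\<not> d) c \<and> lo (\<not> d) e \<le> co (\<not> d) w \<and> co (\<not> d) w \<le> hi (\<not> d) e)"
      unfolding Int_iff in_rect all_bool_eq by (cases d) auto
    also have "\<dots> \<longleftrightarrow> co d w = lo d e \<and> lo (\<not> d) c \<le> co (\<not> d) w \<and> co (\<not> d) w \<le> hi (\<not> d) c"
      using lt[of d] t eq by auto
    also have "\<dots> \<longleftrightarrow> w \<in> closed_segment p q"
      unfolding p_def q_def using in_closed_segment_mk_le[of "lo (\<not> d) c" "hi (\<not> d) c" w "\<not> d" "lo d e"] lt(1)[of "\<not> d"] by auto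
    finally show ?thesis .
  qed
  then have "rect c \<inter> rect e = closed_segment p q" by blast
  moreover have "p \<noteq> q" unfolding p_def q_def using lt(1)[of "\<not> d"] by simp
  moreover have "c \<noteq> e" using t lt[of d] by auto
  ultimately show ?thesis unfolding neighbouring_def by blast
qed

section \<open>Meshes of a subdivision process\<close>

text \<open>\<open>T k\<close> is the mesh of level \<open>k\<close> on the original region, without an extension.\<close>

locale mesh_process = hier +
  fixes T :: "nat \<Rightarrow> cell set"
  assumes T_0: "T 0 = grid G0" and Q_0_grid: "Q 0 = grid G0"
    and T_Suc: "T (Suc k) = (T k - S k) \<union> (\<Union>c\<in>S k. subcells c)"
begin

lemma G0_facts: "finite (G0 d)" "a d \<in> G0 d" "b d \<in> G0 d" "a d < b d" "G0 d \<subseteq> {a d..b d}"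
  using finite_coords[of 0 d] coords_endpoints[of d 0] ab(3)[of d] G0_ab[of d] by simp_all

lemma Q_T: "Q k \<subseteq> T k"
proof (cases k)
  case 0
  then show ?thesis using T_0 Q_0_grid by simp
next
  case (Suc j)
  then show ?thesis using T_Suc Q_Suc by blast
qed

lemma S_T: "c \<in> S k \<Longrightarrow> c \<in> T k"
  using Q_T S_in_Q by blast

text \<open>Cells of the next mesh lie in cells of the present one; those with different parents are separated
because the parents are.\<close>

lemma T_props:
  "(\<forall>c\<in>T k. nondeg c) \<and> (\<forall>c\<in>T k. \<forall>e\<in>T k. c \<noteq> e \<longrightarrow> sep c e)"
proof (induction k)
  case 0
  show ?case unfolding T_0 using grid_nondeg grid_sep by blast
next
  case (Suc k)
  then have nd: "\<And>c. c \<in> T k \<Longrightarrow> nondeg c"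
    and sp: "\<And>c e. c \<in> T k \<Longrightarrow> e \<in> T k \<Longrightarrow> c \<noteq> e \<Longrightarrow> sep c e" by blast+
  have "nondeg c" if "c \<in> T (Suc k)" for c
  proof -
    consider "c \<in> T k" | x where "x \<in> S k" "c \<in> subcells x" using \<open>c \<in> T (Suc k)\<close> unfolding T_Suc by blast
    then show ?thesis
    proof cases
      case (2 x)
      then show ?thesis using subcells_nondeg[OF nd[OF S_T[OF 2(1)]]] by blast
    qed (rule nd)
  qed
  moreover have "sep c e" if ce: "c \<in> T (Suc k)" "e \<in> T (Suc k)" "c \<noteq> e" for c e
  proof -
    have parent: "\<exists>y\<in>T k. (c = y \<and> y \<notin> S k \<or> c \<in> subcells y \<and> y \<in> S k) \<and> (\<forall>d. lo d y \<le> lo d c \<and> hi d c \<le> hi d y)"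
      if "c \<in> T (Suc k)" for c
    proof -
      consider "c \<in> T k" "c \<notin> S k" | x where "x \<in> S k" "c \<in> subcells x" using \<open>c \<in> T (Suc k)\<close> unfolding T_Suc by blast
      then show ?thesis
      proof cases
        case 1
        then show ?thesis by auto
      next
        case (2 x)
        then show ?thesis using subcells_within[OF nd[OF S_T[OF 2(1)]] 2(2)] S_T[OF 2(1)] by blast
      qed
    qed
    obtain y where y: "y \<in> T k" "c = y \<and> y \<notin> S k \<or> c \<in> subcells y \<and> y \<in> S k" "\<And>d. lo d y \<le> lo d c \<and> hi d c \<le> hi d y"
      using parent[OF ce(1)] by blast
    obtain z where z: "z \<in> T k" "e = z \<and> z \<notin> S k \<or> e \<in> subcells z \<and> z \<in> S k" "\<And>d. lo d z \<le> lo d e \<and> hi d e \<le> hi d z"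
      using parent[OF ce(2)] by blast
    show ?thesis
    proof (cases "y = z")
      case True
      then have "c \<in> subcells y" "e \<in> subcells y" using y z ce(3) by auto
      then show ?thesis using subcells_sep ce(3) by blast
    next
      case False
      then obtain d where "hi d y \<le> lo d z \<or> hi d z \<le> lo d y" using sp[OF y(1) z(1)] unfolding sep_def by blast
      then have "hi d c \<le> lo d e \<or> hi d e \<le> lo d c" using y(3)[of d] z(3)[of d] by linarith
      then show ?thesis unfolding sep_def by blast
    qed
  qed
  ultimately show ?case by blast
qed

lemma nondeg_T: "c \<in> T k \<Longrightarrow> nondeg c"
  and sep_T: "c \<in> T k \<Longrightarrow> e \<in> T k \<Longrightarrow> c \<noteq> e \<Longrightarrow> sep c e"
  using T_props by blast+

lemma rects_T: "(\<exists>c\<in>T k. p \<in> rect c) \<longleftrightarrow> (\<forall>d. a d \<le> co d p \<and> co d p \<le> b d)"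
proof (induction k)
  case 0
  show ?case unfolding T_0 by (rule grid_rects[OF G0_facts])
next
  case (Suc k)
  have "(\<exists>c\<in>T (Suc k). p \<in> rect c) \<longleftrightarrow> (\<exists>c\<in>T k - S k. p \<in> rect c) \<or> (\<exists>c\<in>S k. \<exists>e\<in>subcells c. p \<in> rect e)"
    unfolding T_Suc by blast
  also have "\<dots> \<longleftrightarrow> (\<exists>c\<in>T k - S k. p \<in> rect c) \<or> (\<exists>c\<in>S k. p \<in> rect c)"
    using subcells_rects[OF nondeg_T[OF S_T]] by blast
  also have "\<dots> \<longleftrightarrow> (\<exists>c\<in>T k. p \<in> rect c)" using S_T by blast
  finally show ?case using Suc by simp
qed

lemma within_T:
  assumes "c \<in> T k"
  shows "a d \<le> lo d c" "lo d c < hi d c" "hi d c \<le> b d"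
proof -
  have lt: "lo e c < hi e c" for e using nondeg_T[OF assms] unfolding nondeg_def by blast
  then show "lo d c < hi d c" .
  have "fst c \<in> rect c" "snd c \<in> rect c" unfolding in_rect lo_def[symmetric] hi_def[symmetric] using lt by (auto simp: less_imp_le)
  then have "a d \<le> co d (fst c) \<and> co d (snd c) \<le> b d" using rects_T[of k "fst c"] rects_T[of k "snd c"] assms by blast
  then show "a d \<le> lo d c" "hi d c \<le> b d" unfolding lo_def hi_def by simp_all
qed

lemma Hs_T: "p \<in> Hs (T k) d \<longleftrightarrow> co (\<not> d) p \<in> G0 (\<not> d) \<and> a d \<le> co d p \<and> co d p \<le> b d \<or>
    (\<exists>j<k. \<exists>c\<in>S j. co (\<not> d) p = mid (\<not> d) c \<and> lo d c \<le> co d p \<and> co d p \<le> hi d c)"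
proof (induction k)
  case 0
  show ?case unfolding T_0 using grid_Hs[of G0 a b p d, OF G0_facts] by auto
next
  case (Suc k)
  have "p \<in> Hs (T (Suc k)) d \<longleftrightarrow> p \<in> Hs (T k - S k) d \<or> (\<exists>c\<in>S k. p \<in> Hs (subcells c) d)"
    unfolding T_Suc Hs_Un Hs_UN by blast
  also have "\<dots> \<longleftrightarrow> p \<in> Hs (T k - S k) d \<or> (\<exists>c\<in>S k. p \<in> Hs {c} d) \<or>
    (\<exists>c\<in>S k. co (\<not> d) p = mid (\<not> d) c \<and> lo d c \<le> co d p \<and> co d p \<le> hi d c)"
    using subcells_Hs[OF nondeg_T[OF S_T]] by blast
  also have "\<dots> \<longleftrightarrow> p \<in> Hs (T k) d \<or>
    (\<exists>c\<in>S k. co (\<not> d) p = mid (\<not> d) c \<and> lo d c \<le> co d p \<and> co d p \<le> hi d c)"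
  proof -
    have "p \<in> Hs (T k - S k) d \<or> (\<exists>c\<in>S k. p \<in> Hs {c} d) \<longleftrightarrow> p \<in> Hs (T k) d"
      using S_T unfolding Hs_def by blast
    then show ?thesis by blast
  qed
  finally show ?case unfolding Suc by (auto simp: less_Suc_eq)
qed

lemma vertices_T: "v \<in> vertices (T k) \<longleftrightarrow> (\<forall>d. v \<in> Hs (T k) d)"
  using vertices_Hs[of "T k", OF nondeg_T sep_T] by (auto simp: all_bool_eq)

text \<open>A subcell has the midpoint of its parent among its coordinates, so it is not a cell of the old level.\<close>

lemma Q_T_Suc: "e \<in> Q k \<Longrightarrow> e \<in> T (Suc k) \<longleftrightarrow> e \<notin> S k"
proof -
  assume e: "e \<in> Q k"
  have "e \<notin> subcells c" if c: "c \<in> S k" for c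
  proof
    assume "e \<in> subcells c"
    then have "lo True e = mid True c \<or> hi True e = mid True c" unfolding in_subcells_iff by blast
    moreover have "mid True c \<notin> coords k True" using mid_new[OF S_in_Q[OF c], of True] unfolding old_def by blast
    ultimately show False using gap_Q[OF e, of True] unfolding gap_def by auto
  qed
  then show "e \<in> T (Suc k) \<longleftrightarrow> e \<notin> S k" unfolding T_Suc using e Q_T by blast
qed

text \<open>The cell touches the boundary of the original region at a place where the large grid continues.\<close>

definition meets_frame where
  "meets_frame c \<longleftrightarrow> (\<exists>d. A d < a d \<and> lo d c = a d \<or> b d < B d \<and> hi d c = b d)"

lemma shared_iff_neighbour:
  assumes c: "c \<in> S k"
  shows "(\<exists>d x. shared (S k) c d x) \<longleftrightarrow> (\<exists>e\<in>S k. neighbouring c e) \<or> meets_frame c"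
proof
  assume "\<exists>d x. shared (S k) c d x"
  then obtain d x where sh: "shared (S k) c d x" by blast
  note c_ = lo_hi[OF S_in_Q[OF c], of d] bounds[of d] ab(3)[of d]
  show "(\<exists>e\<in>S k. neighbouring c e) \<or> meets_frame c"
  proof (cases "A d < x \<and> x < B d \<and> (x = a d \<or> x = b d)")
    case True
    then have "x = a d \<and> lo d c = a d \<or> x = b d \<and> hi d c = b d"
      using sh c_ unfolding shared_def by auto
    with True have "A d < a d \<and> lo d c = a d \<or> b d < B d \<and> hi d c = b d" by metis
    then show ?thesis unfolding meets_frame_def by blast
  next
    case False
    then obtain e where e: "e \<in> S k" "e \<noteq> c" "x = lo d e \<or> x = hi d e"
      "lo (\<not> d) e = lo (\<not> d) c" "hi (\<not> d) e = hi (\<not> d) c" and x: "x = lo d c \<or> x = hi d c"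
      using sh unfolding shared_def by blast
    have nd: "nondeg c" "nondeg e" using nondeg_T S_T c e(1) by blast+
    have "hi d c = lo d e \<or> hi d e = lo d c"
    proof -
      have "sep c e" using sep_T S_T c e(1,2) by blast
      then obtain f where f: "hi f c \<le> lo f e \<or> hi f e \<le> lo f c" unfolding sep_def by blast
      have "lo g c < hi g c" "lo g e < hi g e" for g using nd unfolding nondeg_def by auto
      from this(1)[of d] this(2)[of d] this(1)[of "\<not> d"] this(2)[of "\<not> d"] show ?thesis
        using f e(3-5) x by (cases "f = d") auto
    qed
    then have "neighbouring c e"
      using neighbouringI[OF nd, of d] neighbouring_sym[OF neighbouringI[OF nd(2,1), of d]] e(4,5) by auto
    then show ?thesis using e(1) by blast
  qed
next
  assume "(\<exists>e\<in>S k. neighbouring c e) \<or> meets_frame c"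
  then show "\<exists>d x. shared (S k) c d x"
  proof
    assume "\<exists>e\<in>S k. neighbouring c e"
    then obtain e where e: "e \<in> S k" "neighbouring c e" by blast
    have ne: "e \<noteq> c" using e(2) unfolding neighbouring_def by blast
    then have "sep c e" using sep_T S_T c e(1) by blast
    then obtain d where d: "hi d c = lo d e \<or> hi d e = lo d c" "lo (\<not> d) c < hi (\<not> d) e" "lo (\<not> d) e < hi (\<not> d) c"
      using neighbouringD[OF e(2)] by blast
    have "lo (\<not> d) c = lo (\<not> d) e \<and> hi (\<not> d) c = hi (\<not> d) e"
      using gap_overlap[OF gap_S[OF c] gap_S[OF e(1)] d(2,3)] .
    then show ?thesis using d(1) e(1) ne unfolding shared_def by metis
  next
    assume "meets_frame c"
    then obtain d where d: "A d < a d \<and> lo d c = a d \<or> b d < B d \<and> hi d c = b d" unfolding meets_frame_def by blast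
    then show ?thesis
    proof
      assume "A d < a d \<and> lo d c = a d"
      then have "shared (S k) c d (a d)" using bounds[of d] ab(3)[of d] unfolding shared_def by auto
      then show ?thesis by blast
    next
      assume "b d < B d \<and> hi d c = b d"
      then have "shared (S k) c d (b d)" using bounds[of d] ab(3)[of d] unfolding shared_def by auto
      then show ?thesis by blast
    qed
  qed
qed

lemma isolated_eq: "isolated k = {c \<in> S k. (\<forall>e\<in>S k. \<not> neighbouring c e) \<and> \<not> meets_frame c}"
  unfolding isolated_def using shared_iff_neighbour by blast

text \<open>Common to classical meshes and extensions: only the sides and the region of the mesh \<open>M\<close> have to be
compared with the model.\<close>

lemma Euler_from_mesh:
  assumes nd: "\<And>c. c \<in> M \<Longrightarrow> nondeg c" and sp: "\<And>c e. c \<in> M \<Longrightarrow> e \<in> M \<Longrightarrow> c \<noteq> e \<Longrightarrow> sep c e"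
    and H: "\<And>d p. p \<in> Hs M d \<longleftrightarrow> p \<in> lines k d"
    and rects: "\<And>p. (\<exists>c\<in>M. p \<in> rect c) \<longleftrightarrow> (\<forall>d. A d \<le> co d p \<and> co d p \<le> B d)"
  shows "int (card (crossing_vertices M)) - int (card (interior_l_edges M)) + int (1 + (\<Sum>j<k. card (isolated j)))
    = int (card (cvr_cells M))"
proof -
  have HM: "Hs M d = lines k d" for d using H by blast
  have "tmesh (lines k) A B M"
  proof (intro tmesh.intro arrangement_lines tmesh_axioms.intro)
    show "vertices M = lines k True \<inter> lines k False" using vertices_Hs[of M, OF nd sp] HM by simp
    show "skeleton M = lines k True \<union> lines k False" using skeleton_Hs[of M, OF nd] HM by simp
    have "p \<in> region M \<longleftrightarrow> p \<in> cbox (A True, A False) (B True, B False)" for p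
      using rects[of p] unfolding region_def all_bool_eq by (cases p) (auto simp: cbox_Pair_eq co_def)
    then show "region M = cbox (A True, A False) (B True, B False)" by blast
  qed
  then show ?thesis using tmesh.tmesh_Euler[of "lines k" A B M] card_classes[of k] by simp
qed

end

locale classical_process = mesh_process +
  assumes no_frame: "F d = G0 d" "A d = a d" "B d = b d"
begin

lemma classical_Hs: "p \<in> Hs (T k) d \<longleftrightarrow> p \<in> lines k d"
proof -
  have "Lo d c = lo d c" "Hi d c = hi d c" for c
    using no_frame(2)[of d] no_frame(3)[of d] unfolding Lo_def Hi_def by auto
  then show ?thesis
    using no_frame(1)[of "\<not> d"] no_frame(2)[of d] no_frame(3)[of d] unfolding Hs_T lines_def midline_def by auto
qed

lemma classical_isolated: "isolated k = {c \<in> S k. \<forall>e\<in>Q k. neighbouring c e \<longrightarrow> e \<in> T (Suc k)}"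
proof -
  have "\<not> meets_frame c" for c using no_frame(2,3) unfolding meets_frame_def by simp
  then show ?thesis unfolding isolated_eq using Q_T_Suc S_in_Q by blast
qed

lemma classical_Euler:
  "int (card (crossing_vertices (T k))) - int (card (interior_l_edges (T k))) + int (1 + (\<Sum>j<k. card (isolated j)))
    = int (card (cvr_cells (T k)))"
  by (rule Euler_from_mesh[OF nondeg_T sep_T classical_Hs]) (simp_all add: rects_T no_frame)

end

section \<open>Extensions\<close>

text \<open>\<open>P d s\<close> are the coordinates in direction \<open>d\<close> of the frame below (\<open>s = False\<close>) or
above (\<open>s = True\<close>) the original region.\<close>

locale extended_process = mesh_process +
  fixes P :: "bool \<Rightarrow> bool \<Rightarrow> real set"
  assumes finite_P: "finite (P d s)"
    and P_low: "A d \<in> P d False" "a d \<in> P d False" "A d < a d" "P d False \<subseteq> {A d..a d}"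
    and P_high: "b d \<in> P d True" "B d \<in> P d True" "b d < B d" "P d True \<subseteq> {b d..B d}"
    and F_P: "F d = P d False \<union> G0 d \<union> P d True"
begin

definition border where "border s d = (if s then b d else a d)"
definition flo where "flo s d = (if s then b d else A d)"
definition fhi where "fhi s d = (if s then B d else a d)"

text \<open>The coordinates of the lines that cut the part of the frame beyond the border \<open>s\<close>.\<close>

definition W where "W k d s = {x. mk d x (border s (\<not> d)) \<in> vertices (T k)}"

definition corner_block where "corner_block \<sigma> = grid (\<lambda>d. P d (\<sigma> d))"

definition side_block where "side_block k d s = grid (\<lambda>e. if e = d then W k d s else P e s)"

definition ext where "ext k = T k \<union> (\<Union>\<sigma>. corner_block \<sigma>) \<union> (\<Union>d. \<Union>s. side_block k d s)"

lemma P_facts: "finite (P d s)" "flo s d \<in> P d s" "fhi s d \<in> P d s" "flo s d < fhi s d" "P d s \<subseteq> {flo s d..fhi s d}"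
  using finite_P[of d s] P_low[of d] P_high[of d] unfolding flo_def fhi_def by (cases s; simp)+

lemma border_G0: "border s d \<in> G0 d"
  unfolding border_def using G0_facts(2,3) by simp

lemma touches_border:
  assumes "c \<in> S j"
  shows "lo d c \<le> border s d \<and> border s d \<le> hi d c \<longleftrightarrow> (if s then hi d c = b d else lo d c = a d)"
  using lo_hi[OF S_in_Q[OF assms], of d] unfolding border_def by auto

lemma W_iff:
  "x \<in> W k d s \<longleftrightarrow> x \<in> G0 d \<or>
    (\<exists>j<k. \<exists>c\<in>S j. x = mid d c \<and> (if s then hi (\<not> d) c = b (\<not> d) else lo (\<not> d) c = a (\<not> d)))"
proof -
  define p where "p = mk d x (border s (\<not> d))"
  have co_p: "co d p = x" "co (\<not> d) p = border s (\<not> d)" unfolding p_def by simp_all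
  have bo: "a (\<not> d) \<le> border s (\<not> d)" "border s (\<not> d) \<le> b (\<not> d)"
    using border_G0[of s "\<not> d"] G0_facts(5)[of "\<not> d"] by auto
  have "x \<in> W k d s \<longleftrightarrow> p \<in> Hs (T k) d \<and> p \<in> Hs (T k) (\<not> d)"
    unfolding W_def p_def[symmetric] vertices_T mem_Collect_eq by (cases d) (auto simp: all_bool_eq)
  also have "p \<in> Hs (T k) (\<not> d) \<longleftrightarrow> x \<in> G0 d \<or>
      (\<exists>j<k. \<exists>c\<in>S j. x = mid d c \<and> lo (\<not> d) c \<le> border s (\<not> d) \<and> border s (\<not> d) \<le> hi (\<not> d) c)"
    unfolding Hs_T co_p not_not using bo by blast
  also have "\<dots> \<longleftrightarrow> x \<in> G0 d \<or>
    (\<exists>j<k. \<exists>c\<in>S j. x = mid d c \<and> (if s then hi (\<not> d) c = b (\<not> d) else lo (\<not> d) c = a (\<not> d)))"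
    using touches_border[of _ _ "\<not> d" s] by blast
  also have "p \<in> Hs (T k) d \<and> \<dots> \<longleftrightarrow> \<dots>"
  proof -
    have "p \<in> Hs (T k) d" if "a d \<le> x" "x \<le> b d"
      unfolding Hs_T co_p using border_G0 that by blast
    moreover have "a d \<le> mid d c \<and> mid d c \<le> b d" if "c \<in> S j" for c j
      using lo_hi[OF S_in_Q[OF that], of d] by linarith
    ultimately show ?thesis using G0_facts(5)[of d] by fastforce
  qed
  finally show ?thesis .
qed

lemma W_coords: "W k d s \<subseteq> coords k d"
proof
  fix x assume "x \<in> W k d s"
  then consider "x \<in> G0 d" | j c where "j < k" "c \<in> S j" "x = mid d c" unfolding W_iff by blast
  then show "x \<in> coords k d"
  proof cases
    case 1
    then show ?thesis using coords_mono[of 0 k d] by auto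
  next
    case (2 j c)
    then show ?thesis using mid_coords[OF 2(2), of d] coords_mono[of "Suc j" k d] by auto
  qed
qed

lemma W_facts: "finite (W k d s)" "a d \<in> W k d s" "b d \<in> W k d s" "a d < b d" "W k d s \<subseteq> {a d..b d}"
  using finite_subset[OF W_coords finite_coords] W_coords[of k d s] coords_ab[of k d] G0_facts(2-4)[of d] W_iff by auto

lemma ext_cases:
  assumes "c \<in> ext k"
  obtains "c \<in> T k"
  | \<sigma> where "\<And>d. gap (P d (\<sigma> d)) (lo d c) (hi d c)"
  | d s where "gap (W k d s) (lo d c) (hi d c)" "gap (P (\<not> d) s) (lo (\<not> d) c) (hi (\<not> d) c)"
proof -
  consider "c \<in> T k" | \<sigma> where "c \<in> corner_block \<sigma>" | d s where "c \<in> side_block k d s"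
    using assms unfolding ext_def by blast
  then show thesis
  proof cases
    case (2 \<sigma>)
    then show ?thesis using that(2)[of \<sigma>] unfolding corner_block_def grid_def by blast
  next
    case (3 d s)
    then have c: "gap (if e = d then W k d s else P e s) (lo e c) (hi e c)" for e
      unfolding side_block_def grid_def by blast
    show ?thesis using that(3)[of d s] c[of d] c[of "\<not> d"] by simp
  qed (rule that(1))
qed

lemma in_side_block:
  "gap (W k d s) (lo d c) (hi d c) \<Longrightarrow> gap (P (\<not> d) s) (lo (\<not> d) c) (hi (\<not> d) c) \<Longrightarrow> c \<in> side_block k d s"
proof -
  assume c: "gap (W k d s) (lo d c) (hi d c)" "gap (P (\<not> d) s) (lo (\<not> d) c) (hi (\<not> d) c)"
  have "gap (if e = d then W k d s else P e s) (lo e c) (hi e c)" for e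
    using c by (cases "e = d") auto
  then show "c \<in> side_block k d s" unfolding side_block_def grid_def by blast
qed

lemma gap_P: "gap (P d s) l h \<Longrightarrow> flo s d \<le> l \<and> l < h \<and> h \<le> fhi s d"
  by (rule gap_within[OF _ P_facts(5)])

lemma gap_W: "gap (W k d s) l h \<Longrightarrow> a d \<le> l \<and> l < h \<and> h \<le> b d"
  by (rule gap_within[OF _ W_facts(5)])

lemma nondeg_ext: "c \<in> ext k \<Longrightarrow> nondeg c"
  unfolding ext_def corner_block_def side_block_def using nondeg_T grid_nondeg by blast

lemma sep_sym: "sep c e \<Longrightarrow> sep e c"
  unfolding sep_def by blast

lemma sep_frame:
  assumes "a d \<le> lo d c" "hi d c \<le> b d" "gap (P d s) (lo d e) (hi d e)"
  shows "sep c e"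
proof -
  have "hi d c \<le> lo d e \<or> hi d e \<le> lo d c"
    using assms(1,2) gap_P[OF assms(3)] unfolding flo_def fhi_def by (cases s) auto
  then show ?thesis unfolding sep_def by blast
qed

lemma sep_frames:
  assumes "gap (P d s) (lo d c) (hi d c)" "gap (P d s') (lo d e) (hi d e)" "s \<noteq> s'"
  shows "sep c e"
proof -
  have "hi d c \<le> lo d e \<or> hi d e \<le> lo d c"
    using gap_P[OF assms(1)] gap_P[OF assms(2)] ab(3)[of d] assms(3)
    unfolding flo_def fhi_def by (cases s; cases s') auto
  then show ?thesis unfolding sep_def by blast
qed

text \<open>In each direction a cell lies below, within or above the original region. Cells in different zones are
separated; cells in the same zones belong to the same block.\<close>

lemma sep_ext:
  assumes c: "c \<in> ext k" and e: "e \<in> ext k" and ne: "c \<noteq> e"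
  shows "sep c e"
  using c
proof (cases rule: ext_cases)
  case cT: 1
  note wc = within_T(1,3)[OF cT]
  show ?thesis using e
  proof (cases rule: ext_cases)
    case 1
    then show ?thesis using sep_T cT ne by blast
  next
    case (2 \<sigma>)
    then show ?thesis using sep_frame[OF wc(1)[of True] wc(2)[of True] 2[of True]] by blast
  next
    case (3 d s)
    then show ?thesis using sep_frame[OF wc(1)[of "\<not> d"] wc(2)[of "\<not> d"] 3(2)] by blast
  qed
next
  case cC: (2 \<sigma>)
  show ?thesis using e
  proof (cases rule: ext_cases)
    case 1
    then show ?thesis using sep_sym[OF sep_frame[OF within_T(1)[OF 1] within_T(3)[OF 1] cC[of True]]] by blast
  next
    case (2 \<tau>)
    show ?thesis
    proof (cases "\<sigma> = \<tau>")
      case True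
      then show ?thesis using grid_sep[of c "\<lambda>d. P d (\<sigma> d)" e] cC 2 ne unfolding grid_def by blast
    next
      case False
      then obtain d where "\<sigma> d \<noteq> \<tau> d" by blast
      then show ?thesis using sep_frames[OF cC[of d] 2[of d]] by blast
    qed
  next
    case (3 d s)
    then show ?thesis using sep_sym[OF sep_frame[OF _ _ cC[of d]]] gap_W[OF 3(1)] by blast
  qed
next
  case cW: (3 d s)
  show ?thesis using e
  proof (cases rule: ext_cases)
    case 1
    then show ?thesis using sep_sym[OF sep_frame[OF within_T(1)[OF 1] within_T(3)[OF 1] cW(2)]] by blast
  next
    case (2 \<sigma>)
    then show ?thesis using sep_frame[OF _ _ 2[of d]] gap_W[OF cW(1)] by blast
  next
    case (3 d' s')
    show ?thesis
    proof (cases "d' = d")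
      case True
      show ?thesis
      proof (cases "s = s'")
        case ss: True
        have "c \<in> side_block k d s" "e \<in> side_block k d s"
          using in_side_block[OF cW] in_side_block[OF 3] True ss by auto
        then show ?thesis using grid_sep ne unfolding side_block_def by blast
      next
        case False
        then show ?thesis using sep_frames[OF cW(2) 3(2)[unfolded True]] by blast
      qed
    next
      case False
      then have d': "d' = (\<not> d)" by auto
      have "gap (P d s') (lo d e) (hi d e)" using 3(2) unfolding d' by simp
      then show ?thesis using sep_frame[of d c s' e] gap_W[OF cW(1)] by blast
    qed
  qed
qed

lemma rects_ext: "(\<exists>c\<in>ext k. p \<in> rect c) \<longleftrightarrow> (\<forall>d. A d \<le> co d p \<and> co d p \<le> B d)"
proof -
  have corner: "(\<exists>c\<in>corner_block \<sigma>. p \<in> rect c) \<longleftrightarrow> (\<forall>d. flo (\<sigma> d) d \<le> co d p \<and> co d p \<le> fhi (\<sigma> d) d)" for \<sigma>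
    unfolding corner_block_def
    by (rule grid_rects[where x="\<lambda>d. flo (\<sigma> d) d" and y="\<lambda>d. fhi (\<sigma> d) d"]) (use P_facts in auto)
  have side: "(\<exists>c\<in>side_block k d s. p \<in> rect c) \<longleftrightarrow>
      (a d \<le> co d p \<and> co d p \<le> b d) \<and> (flo s (\<not> d) \<le> co (\<not> d) p \<and> co (\<not> d) p \<le> fhi s (\<not> d))" for d s
  proof -
    have "(\<exists>c\<in>side_block k d s. p \<in> rect c) \<longleftrightarrow>
      (\<forall>e. (if e = d then a d else flo s e) \<le> co e p \<and> co e p \<le> (if e = d then b d else fhi s e))"
      unfolding side_block_def
      by (rule grid_rects) (use P_facts W_facts in auto)
    then show ?thesis unfolding all_bool_eq by (cases d) auto
  qed
  have "(\<exists>c\<in>ext k. p \<in> rect c) \<longleftrightarrow> (\<forall>d. a d \<le> co d p \<and> co d p \<le> b d) \<or>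
      (\<exists>\<sigma>. \<forall>d. flo (\<sigma> d) d \<le> co d p \<and> co d p \<le> fhi (\<sigma> d) d) \<or>
      (\<exists>d s. (a d \<le> co d p \<and> co d p \<le> b d) \<and> (flo s (\<not> d) \<le> co (\<not> d) p \<and> co (\<not> d) p \<le> fhi s (\<not> d)))"
    unfolding rects_T[of k, symmetric] corner[symmetric] side[symmetric] ext_def by blast
  also have "\<dots> \<longleftrightarrow> (\<forall>d. A d \<le> co d p \<and> co d p \<le> B d)"
  proof
    assume "(\<forall>d. a d \<le> co d p \<and> co d p \<le> b d) \<or>
      (\<exists>\<sigma>. \<forall>d. flo (\<sigma> d) d \<le> co d p \<and> co d p \<le> fhi (\<sigma> d) d) \<or>
      (\<exists>d s. (a d \<le> co d p \<and> co d p \<le> b d) \<and> (flo s (\<not> d) \<le> co (\<not> d) p \<and> co (\<not> d) p \<le> fhi s (\<not> d)))"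
    moreover have rng: "A d \<le> flo s d \<and> fhi s d \<le> B d" "A d \<le> a d" "b d \<le> B d" for d s
      using P_low(3)[of d] P_high(3)[of d] ab(3)[of d] unfolding flo_def fhi_def by auto
    ultimately show "\<forall>d. A d \<le> co d p \<and> co d p \<le> B d"
    proof (elim disjE exE)
      assume I: "\<forall>d. a d \<le> co d p \<and> co d p \<le> b d"
      show ?thesis
      proof
        fix d show "A d \<le> co d p \<and> co d p \<le> B d" using I[rule_format, of d] rng(2)[of d] rng(3)[of d] by linarith
      qed
    next
      fix \<sigma> assume I: "\<forall>d. flo (\<sigma> d) d \<le> co d p \<and> co d p \<le> fhi (\<sigma> d) d"
      show ?thesis
      proof
        fix d show "A d \<le> co d p \<and> co d p \<le> B d" using I[rule_format, of d] rng(1)[of d "\<sigma> d"] by linarith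
      qed
    next
      fix d s assume I: "(a d \<le> co d p \<and> co d p \<le> b d) \<and> (flo s (\<not> d) \<le> co (\<not> d) p \<and> co (\<not> d) p \<le> fhi s (\<not> d))"
      have "A d \<le> co d p \<and> co d p \<le> B d" using I rng(2)[of d] rng(3)[of d] by linarith
      moreover have "A (\<not> d) \<le> co (\<not> d) p \<and> co (\<not> d) p \<le> B (\<not> d)" using I rng(1)[of "\<not> d" s] by linarith
      ultimately show ?thesis by (cases d) (auto simp: all_bool_eq)
    qed
  next
    assume box: "\<forall>d. A d \<le> co d p \<and> co d p \<le> B d"
    define \<sigma> where "\<sigma> d \<longleftrightarrow> b d \<le> co d p" for d
    have out: "flo (\<sigma> d) d \<le> co d p \<and> co d p \<le> fhi (\<sigma> d) d" if "\<not> (a d \<le> co d p \<and> co d p \<le> b d)" for d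
      using that box[rule_format, of d] ab(3)[of d] unfolding \<sigma>_def flo_def fhi_def by auto
    show "(\<forall>d. a d \<le> co d p \<and> co d p \<le> b d) \<or>
      (\<exists>\<sigma>. \<forall>d. flo (\<sigma> d) d \<le> co d p \<and> co d p \<le> fhi (\<sigma> d) d) \<or>
      (\<exists>d s. (a d \<le> co d p \<and> co d p \<le> b d) \<and> (flo s (\<not> d) \<le> co (\<not> d) p \<and> co (\<not> d) p \<le> fhi s (\<not> d)))"
    proof (cases "\<exists>d. a d \<le> co d p \<and> co d p \<le> b d")
      case True
      then obtain d where d: "a d \<le> co d p \<and> co d p \<le> b d" by blast
      show ?thesis
      proof (cases "a (\<not> d) \<le> co (\<not> d) p \<and> co (\<not> d) p \<le> b (\<not> d)")
        case True
        then have "\<forall>d. a d \<le> co d p \<and> co d p \<le> b d" using d by (cases d) (auto simp: all_bool_eq)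
        then show ?thesis by blast
      next
        case False
        then show ?thesis using d out[of "\<not> d"] by blast
      qed
    next
      case False
      then show ?thesis using out by blast
    qed
  qed
  finally show ?thesis .
qed

text \<open>A full line of the large grid is composed of its parts in the three zones; a prolonged midline, of a
midline in the original region and of lines in the side blocks.\<close>

lemma Hs_ext: "p \<in> Hs (ext k) e \<longleftrightarrow> p \<in> lines k e"
proof -
  have corner: "p \<in> Hs (corner_block \<sigma>) e \<longleftrightarrow> flo (\<sigma> e) e \<le> co e p \<and> co e p \<le> fhi (\<sigma> e) e \<and> co (\<not> e) p \<in> P (\<not> e) (\<sigma> (\<not> e))" for \<sigma>
    unfolding corner_block_def
    by (rule grid_Hs[where x="\<lambda>d. flo (\<sigma> d) d" and y="\<lambda>d. fhi (\<sigma> d) d"]) (use P_facts in auto)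
  have side: "p \<in> Hs (side_block k d s) e \<longleftrightarrow>
      (if e = d then a e \<le> co e p \<and> co e p \<le> b e \<and> co (\<not> e) p \<in> P (\<not> e) s
       else flo s e \<le> co e p \<and> co e p \<le> fhi s e \<and> co (\<not> e) p \<in> W k (\<not> e) s)" for d s
  proof -
    have "p \<in> Hs (side_block k d s) e \<longleftrightarrow>
      (if e = d then a d else flo s e) \<le> co e p \<and> co e p \<le> (if e = d then b d else fhi s e) \<and>
      co (\<not> e) p \<in> (if (\<not> e) = d then W k d s else P (\<not> e) s)"
      unfolding side_block_def
      by (rule grid_Hs[where x="\<lambda>e. if e = d then a d else flo s e" and y="\<lambda>e. if e = d then b d else fhi s e"])
        (use P_facts W_facts in auto)
    then show ?thesis by (cases "e = d") auto
  qed
  let ?s = "co e p" and ?t = "co (\<not> e) p"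
  have "p \<in> Hs (ext k) e \<longleftrightarrow> p \<in> Hs (T k) e \<or>
      (\<exists>\<sigma>. flo (\<sigma> e) e \<le> ?s \<and> ?s \<le> fhi (\<sigma> e) e \<and> ?t \<in> P (\<not> e) (\<sigma> (\<not> e))) \<or>
      (\<exists>d s. if e = d then a e \<le> ?s \<and> ?s \<le> b e \<and> ?t \<in> P (\<not> e) s
       else flo s e \<le> ?s \<and> ?s \<le> fhi s e \<and> ?t \<in> W k (\<not> e) s)"
    unfolding ext_def Hs_Un Hs_UN Un_iff UN_iff corner side by blast
  also have "\<dots> \<longleftrightarrow> p \<in> Hs (T k) e \<or>
      (\<exists>u s. flo u e \<le> ?s \<and> ?s \<le> fhi u e \<and> ?t \<in> P (\<not> e) s) \<or>
      (\<exists>s. a e \<le> ?s \<and> ?s \<le> b e \<and> ?t \<in> P (\<not> e) s) \<or>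
      (\<exists>s. flo s e \<le> ?s \<and> ?s \<le> fhi s e \<and> ?t \<in> W k (\<not> e) s)"
  proof -
    have "(\<exists>\<sigma>. flo (\<sigma> e) e \<le> ?s \<and> ?s \<le> fhi (\<sigma> e) e \<and> ?t \<in> P (\<not> e) (\<sigma> (\<not> e))) \<longleftrightarrow>
      (\<exists>u s. flo u e \<le> ?s \<and> ?s \<le> fhi u e \<and> ?t \<in> P (\<not> e) s)"
    proof
      assume "\<exists>u s. flo u e \<le> ?s \<and> ?s \<le> fhi u e \<and> ?t \<in> P (\<not> e) s"
      then obtain u s where "flo u e \<le> ?s \<and> ?s \<le> fhi u e \<and> ?t \<in> P (\<not> e) s" by blast
      then show "\<exists>\<sigma>. flo (\<sigma> e) e \<le> ?s \<and> ?s \<le> fhi (\<sigma> e) e \<and> ?t \<in> P (\<not> e) (\<sigma> (\<not> e))"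
        by (intro exI[of _ "\<lambda>d. if d = e then u else s"]) simp
    qed blast
    moreover have "(\<exists>d s. if e = d then Q1 s else Q2 s) \<longleftrightarrow> (\<exists>s. Q1 s) \<or> (\<exists>s. Q2 s)" for Q1 Q2 :: "bool \<Rightarrow> bool"
      by (cases e) (auto simp: ex_bool_eq)
    ultimately show ?thesis by simp
  qed
  also have "\<dots> \<longleftrightarrow> p \<in> lines k e"
  proof
    have full: "p \<in> lines k e" if "?t \<in> F (\<not> e)" "A e \<le> ?s" "?s \<le> B e"
      unfolding lines_def using that by blast
    have part: "p \<in> lines k e" if "j < k" "c \<in> S j" "?t = mid (\<not> e) c" "Lo e c \<le> ?s" "?s \<le> Hi e c" for j c
      unfolding lines_def midline_def using that by blast
    have rng: "A e \<le> flo s e" "fhi s e \<le> B e" "A e \<le> a e" "b e \<le> B e" for s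
      using P_low(3)[of e] P_high(3)[of e] ab(3)[of e] unfolding flo_def fhi_def by auto
    assume "p \<in> Hs (T k) e \<or>
      (\<exists>u s. flo u e \<le> ?s \<and> ?s \<le> fhi u e \<and> ?t \<in> P (\<not> e) s) \<or>
      (\<exists>s. a e \<le> ?s \<and> ?s \<le> b e \<and> ?t \<in> P (\<not> e) s) \<or>
      (\<exists>s. flo s e \<le> ?s \<and> ?s \<le> fhi s e \<and> ?t \<in> W k (\<not> e) s)"
    then show "p \<in> lines k e"
    proof (elim disjE exE conjE)
      assume "p \<in> Hs (T k) e"
      then consider "?t \<in> G0 (\<not> e)" "a e \<le> ?s" "?s \<le> b e"
        | j c where "j < k" "c \<in> S j" "?t = mid (\<not> e) c" "lo e c \<le> ?s" "?s \<le> hi e c"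
        unfolding Hs_T by blast
      then show ?thesis
      proof cases
        case 1
        then show ?thesis using full rng(3,4) G0_F[of "\<not> e"] by auto
      next
        case (2 j c)
        then show ?thesis using part[OF 2(1-3)] Lo_Hi[OF S_in_Q[OF 2(2)], of e] by linarith
      qed
    next
      fix u s assume as: "flo u e \<le> ?s" "?s \<le> fhi u e" "?t \<in> P (\<not> e) s"
      then have "?t \<in> F (\<not> e)" unfolding F_P by (cases s) auto
      then show ?thesis using full as rng(1,2)[of u] by linarith
    next
      fix s assume as: "a e \<le> ?s" "?s \<le> b e" "?t \<in> P (\<not> e) s"
      then have "?t \<in> F (\<not> e)" unfolding F_P by (cases s) auto
      then show ?thesis using full as rng(3,4) by linarith
    next
      fix s assume as: "flo s e \<le> ?s" "?s \<le> fhi s e" "?t \<in> W k (\<not> e) s"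
      consider "?t \<in> G0 (\<not> e)"
        | j c where "j < k" "c \<in> S j" "?t = mid (\<not> e) c" "if s then hi e c = b e else lo e c = a e"
        using as(3) unfolding W_iff not_not by blast
      then show ?thesis
      proof cases
        case 1
        then show ?thesis using full as rng(1,2)[of s] G0_F[of "\<not> e"] by auto
      next
        case (2 j c)
        have "Lo e c \<le> ?s \<and> ?s \<le> Hi e c"
          using 2(4) as(1,2) Lo_Hi[OF S_in_Q[OF 2(2)], of e] lo_hi[OF S_in_Q[OF 2(2)], of e]
          unfolding flo_def fhi_def by (cases s) (auto simp: Lo_def Hi_def)
        then show ?thesis using part[OF 2(1-3)] by blast
      qed
    qed
  next
    assume "p \<in> lines k e"
    then show "p \<in> Hs (T k) e \<or>
      (\<exists>u s. flo u e \<le> ?s \<and> ?s \<le> fhi u e \<and> ?t \<in> P (\<not> e) s) \<or>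
      (\<exists>s. a e \<le> ?s \<and> ?s \<le> b e \<and> ?t \<in> P (\<not> e) s) \<or>
      (\<exists>s. flo s e \<le> ?s \<and> ?s \<le> fhi s e \<and> ?t \<in> W k (\<not> e) s)"
    proof (cases rule: lines_cases)
      case 1
      have zone: "(a e \<le> ?s \<and> ?s \<le> b e) \<or> (\<exists>u. flo u e \<le> ?s \<and> ?s \<le> fhi u e)"
        using 1(2,3) unfolding flo_def fhi_def by (simp add: ex_bool_eq) linarith
      consider "?t \<in> G0 (\<not> e)" | s where "?t \<in> P (\<not> e) s" using 1(1) unfolding F_P by blast
      then show ?thesis
      proof cases
        case G: 1
        then have "?t \<in> W k (\<not> e) s" for s unfolding W_iff by blast
        then show ?thesis using zone G unfolding Hs_T by blast
      next
        case (2 s)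
        then show ?thesis using zone by blast
      qed
    next
      case (2 j c)
      then have t: "?t = mid (\<not> e) c" "Lo e c \<le> ?s" "?s \<le> Hi e c" unfolding midline_def by auto
      note c_ = lo_hi[OF S_in_Q[OF 2(2)], of e] Lo_Hi[OF S_in_Q[OF 2(2)], of e]
      consider "lo e c \<le> ?s" "?s \<le> hi e c" | "?s < lo e c" | "hi e c < ?s" by linarith
      then show ?thesis
      proof cases
        case 1
        then have "p \<in> Hs (T k) e" unfolding Hs_T using 2(1,2) t(1) by blast
        then show ?thesis by blast
      next
        case low: 2
        then have "lo e c = a e" using t(2) unfolding Lo_def by (auto split: if_splits)
        then have "?t \<in> W k (\<not> e) False" unfolding W_iff not_not using 2(1,2) t(1) by auto
        moreover have "flo False e \<le> ?s" "?s \<le> fhi False e"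
          using low \<open>lo e c = a e\<close> t(2) c_ unfolding flo_def fhi_def by auto
        ultimately show ?thesis by blast
      next
        case high: 3
        then have "hi e c = b e" using t(3) unfolding Hi_def by (auto split: if_splits)
        then have "?t \<in> W k (\<not> e) True" unfolding W_iff not_not using 2(1,2) t(1) by auto
        moreover have "flo True e \<le> ?s" "?s \<le> fhi True e"
          using high \<open>hi e c = b e\<close> t(3) c_ unfolding flo_def fhi_def by auto
        ultimately show ?thesis by blast
      qed
    qed
  qed
  finally show ?thesis .
qed

end

section \<open>Isolated cells of extensions\<close>

lemma neighbouring_meet: "neighbouring c e \<Longrightarrow> lo d c \<le> hi d e \<and> lo d e \<le> hi d c"
proof -
  assume "neighbouring c e"
  then obtain p q where "rect c \<inter> rect e = closed_segment p q" unfolding neighbouring_def by blast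
  then have "p \<in> rect c" "p \<in> rect e" by auto
  then have "lo d c \<le> co d p" "co d p \<le> hi d c" "lo d e \<le> co d p" "co d p \<le> hi d e"
    unfolding in_rect by auto
  then show ?thesis by linarith
qed

context extended_process
begin

lemma P_not_inner: "gap (P d s) l h \<Longrightarrow> \<not> (a d \<le> l \<and> h \<le> b d)"
  using gap_P[of d s l h] unfolding flo_def fhi_def by (cases s) auto

lemma ext_inner: "e \<in> ext k \<Longrightarrow> (\<And>d. a d \<le> lo d e \<and> hi d e \<le> b d) \<Longrightarrow> e \<in> T k"
proof -
  assume e: "e \<in> ext k" and inn: "\<And>d. a d \<le> lo d e \<and> hi d e \<le> b d"
  show "e \<in> T k"
    using e
  proof (cases rule: ext_cases)
    case (2 \<sigma>)
    then show ?thesis using P_not_inner[OF 2[of True]] inn[of True] by blast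
  next
    case (3 d s)
    then show ?thesis using P_not_inner[OF 3(2)] inn[of "\<not> d"] by blast
  qed
qed

lemma border_cell:
  obtains l h where "gap (P d s) l h" "if s then l = b d else h = a d"
proof (cases s)
  case True
  have "\<exists>l h. gap (P d True) l h \<and> l \<le> b d \<and> b d \<le> h"
    by (rule gap_cover[of _ "b d" "B d"]) (use P_high finite_P in \<open>auto simp: less_imp_le\<close>)
  then obtain l h where lh: "gap (P d True) l h" "l \<le> b d" by blast
  then have "l = b d" using gap_P[OF lh(1)] unfolding flo_def by simp
  then show thesis using that lh(1) True by simp
next
  case False
  have "\<exists>l h. gap (P d False) l h \<and> l \<le> a d \<and> a d \<le> h"
    by (rule gap_cover[of _ "A d" "a d"]) (use P_low finite_P in \<open>auto simp: less_imp_le\<close>)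
  then obtain l h where lh: "gap (P d False) l h" "a d \<le> h" by blast
  then have "h = a d" using gap_P[OF lh(1)] unfolding fhi_def by simp
  then show thesis using that lh(1) False by simp
qed

lemma gap_W_cell:
  assumes c: "c \<in> S k" and t: "if s then hi d c = b d else lo d c = a d"
  shows "gap (W k (\<not> d) s) (lo (\<not> d) c) (hi (\<not> d) c)"
proof -
  have corner: "x \<in> W k (\<not> d) s" if x: "x = lo (\<not> d) c \<or> x = hi (\<not> d) c" for x
  proof -
    define p where "p = mk (\<not> d) x (border s d)"
    have "co d p = border s d" "co (\<not> d) p = x" unfolding p_def by (simp_all add: mk_flip)
    then have "co d p = lo d c \<or> co d p = hi d c" "co (\<not> d) p = lo (\<not> d) c \<or> co (\<not> d) p = hi (\<not> d) c"
      using x t unfolding border_def by (cases s; simp)+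
    then have "p \<in> corners c" unfolding in_corners by (cases d) (auto simp: all_bool_eq)
    then have "p \<in> vertices (T k)" unfolding vertices_def using S_T[OF c] by blast
    then show ?thesis unfolding W_def p_def by simp
  qed
  show ?thesis
    unfolding gap_def using corner gap_S[OF c, of "\<not> d"] W_coords[of k "\<not> d" s] unfolding gap_def by blast
qed

text \<open>The cell of the frame across a side on the border of the original region is cut in passing to the next
level, because the midpoint of the side becomes a vertex.\<close>

lemma frame_neighbour:
  assumes c: "c \<in> S k" and t: "if s then hi d c = b d else lo d c = a d"
  shows "\<exists>e. e \<in> ext k \<and> e \<notin> T k \<and> neighbouring c e \<and> e \<notin> ext (Suc k)"
proof -
  obtain l h where lh: "gap (P d s) l h" "if s then l = b d else h = a d" using border_cell by blast
  obtain e where "\<forall>f. lo f e = (if f = d then l else lo f c) \<and> hi f e = (if f = d then h else hi f c)"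
    using cell_exI[of "\<lambda>f. if f = d then l else lo f c" "\<lambda>f. if f = d then h else hi f c"] by blast
  then have ed: "lo d e = l" "hi d e = h" and en: "lo (\<not> d) e = lo (\<not> d) c" "hi (\<not> d) e = hi (\<not> d) c" by auto
  have Pe: "gap (P d s) (lo d e) (hi d e)" using lh(1) ed by simp
  have "e \<in> side_block k (\<not> d) s"
    using in_side_block[of k "\<not> d" s e] gap_W_cell[OF c t] Pe en by simp
  then have eext: "e \<in> ext k" unfolding ext_def by blast
  have notT: "e \<notin> T j" for j
  proof
    assume "e \<in> T j"
    then show False using P_not_inner[OF Pe] within_T[of e j d] by blast
  qed
  have nd: "nondeg c" "nondeg e" using nondeg_T[OF S_T[OF c]] nondeg_ext[OF eext] by auto
  have nb: "neighbouring c e"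
  proof (cases s)
    case True
    then have "hi d c = lo d e" using t lh(2) ed by simp
    then show ?thesis using neighbouringI[OF nd, of d] en by simp
  next
    case False
    then have "hi d e = lo d c" using t lh(2) ed by simp
    then show ?thesis using neighbouring_sym[OF neighbouringI[OF nd(2,1), of d]] en by simp
  qed
  have "e \<notin> ext (Suc k)"
  proof
    assume "e \<in> ext (Suc k)"
    then show False
    proof (cases rule: ext_cases)
      case 1
      then show False using notT by blast
    next
      case (2 \<sigma>)
      show False using P_not_inner[OF 2[of "\<not> d"]] en lo_hi[OF S_in_Q[OF c], of "\<not> d"] by auto
    next
      case (3 d' s')
      show False
      proof (cases "d' = d")
        case True
        then show False using gap_W[of "Suc k" d s' "lo d e" "hi d e"] 3(1) P_not_inner[OF Pe] by blast
      next
        case False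
        then have d': "d' = (\<not> d)" by auto
        have P': "gap (P d s') (lo d e) (hi d e)" using 3(2) unfolding d' by simp
        have "s' = s"
          using gap_P[OF Pe] gap_P[OF P'] ab(3)[of d] unfolding flo_def fhi_def by (cases s; cases s') auto
        then have W': "gap (W (Suc k) (\<not> d) s) (lo (\<not> d) c) (hi (\<not> d) c)" using 3(1) en unfolding d' by simp
        have "mid (\<not> d) c \<in> W (Suc k) (\<not> d) s"
          unfolding W_iff not_not using c t by blast
        then show False using W' lo_hi(4,5)[OF S_in_Q[OF c], of "\<not> d"] unfolding gap_def by force
      qed
    qed
  qed
  then show ?thesis using eext notT nb by blast
qed

lemma meets_frame_iff: "meets_frame c \<longleftrightarrow> (\<exists>d s. if s then hi d c = b d else lo d c = a d)"
  unfolding meets_frame_def using P_low(3) P_high(3) by (auto simp: ex_bool_eq)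

lemma no_frame_neighbour:
  assumes c: "c \<in> S k" and e: "e \<in> ext k" "e \<notin> T k" and nb: "neighbouring c e"
  shows "meets_frame c"
proof -
  obtain d s where P: "gap (P d s) (lo d e) (hi d e)" using e(1) by (cases rule: ext_cases) (use e(2) in blast)+
  have "lo d c \<le> hi d e" "lo d e \<le> hi d c" using neighbouring_meet[OF nb] by blast+
  then have "if s then hi d c = b d else lo d c = a d"
    using gap_P[OF P] lo_hi[OF S_in_Q[OF c], of d] unfolding flo_def fhi_def by (cases s) auto
  then show ?thesis unfolding meets_frame_iff by blast
qed

text \<open>A cell on the border has a neighbour in the frame that does not remain, and a cell off the border has
no neighbours in the frame.\<close>

lemma extended_isolated:
  "isolated k = {c \<in> S k. \<forall>e\<in>Q k \<union> (ext k - T k). neighbouring c e \<longrightarrow> e \<in> ext (Suc k)}"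
proof -
  have "(\<forall>e\<in>S k. \<not> neighbouring c e) \<and> \<not> meets_frame c \<longleftrightarrow>
      (\<forall>e\<in>Q k \<union> (ext k - T k). neighbouring c e \<longrightarrow> e \<in> ext (Suc k))" (is "?L \<longleftrightarrow> ?R") if c: "c \<in> S k" for c
  proof
    assume L: ?L
    show ?R
    proof (intro ballI impI)
      fix e assume e: "e \<in> Q k \<union> (ext k - T k)" "neighbouring c e"
      show "e \<in> ext (Suc k)"
      proof (cases "e \<in> Q k")
        case True
        then have "e \<in> T (Suc k)" using Q_T_Suc L e(2) by blast
        then show ?thesis unfolding ext_def by blast
      next
        case False
        then show ?thesis using no_frame_neighbour[OF c _ _ e(2)] e(1) L by blast
      qed
    qed
  next
    assume R: ?R
    have "\<not> neighbouring c e" if e: "e \<in> S k" for e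
    proof
      assume "neighbouring c e"
      then have "e \<in> ext (Suc k)" using R S_in_Q[OF e] by blast
      then have "e \<in> T (Suc k)" by (rule ext_inner) (use lo_hi[OF S_in_Q[OF e]] in blast)
      then show False using Q_T_Suc[OF S_in_Q[OF e]] e by blast
    qed
    moreover have "\<not> meets_frame c"
    proof
      assume "meets_frame c"
      then obtain d s where "if s then hi d c = b d else lo d c = a d" unfolding meets_frame_iff by blast
      then obtain e where "e \<in> ext k" "e \<notin> T k" "neighbouring c e" "e \<notin> ext (Suc k)"
        using frame_neighbour[OF c] by blast
      then show False using R by blast
    qed
    ultimately show ?L by blast
  qed
  then show ?thesis unfolding isolated_eq by blast
qed

lemma extended_Euler:
  "int (card (crossing_vertices (ext k))) - int (card (interior_l_edges (ext k))) + int (1 + (\<Sum>j<k. card (isolated j)))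
    = int (card (cvr_cells (ext k)))"
  by (rule Euler_from_mesh[OF nondeg_ext sep_ext Hs_ext]) (simp_all add: rects_ext)

end

section \<open>Classical meshes and extensions as instances\<close>

lemma grid_lines_facts:
  assumes "grid_lines xs"
  shows "sorted_wrt (<) xs" "hd xs \<in> set xs" "last xs \<in> set xs" "hd xs < last xs" "set xs \<subseteq> {hd xs..last xs}"
proof -
  show so: "sorted_wrt (<) xs" using assms by (simp add: grid_lines_def)
  have len: "2 \<le> length xs" "xs \<noteq> []" using assms by (auto simp: grid_lines_def)
  show "hd xs \<in> set xs" "last xs \<in> set xs" using len by simp_all
  have hl: "hd xs = xs ! 0" "last xs = xs ! (length xs - 1)" using len by (simp_all add: hd_conv_nth last_conv_nth)
  show "hd xs < last xs" unfolding hl using sorted_wrt_nth_less[OF so, of 0 "length xs - 1"] len by simp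
  show "set xs \<subseteq> {hd xs..last xs}"
  proof
    fix x assume "x \<in> set xs"
    then obtain i where i: "i < length xs" "x = xs ! i" by (metis in_set_conv_nth)
    have "xs ! 0 \<le> x" using sorted_wrt_nth_less[OF so, of 0 i] i by (cases "i = 0") auto
    moreover have "x \<le> xs ! (length xs - 1)"
    proof (cases "i = length xs - 1")
      case False
      then have "i < length xs - 1" "length xs - 1 < length xs" using i by arith+
      then show ?thesis using sorted_wrt_nth_less[OF so, of i "length xs - 1"] i by simp
    qed (use i in simp)
    ultimately show "x \<in> {hd xs..last xs}" unfolding hl by simp
  qed
qed

lemma inner_grid_line:
  assumes "grid_lines xs" "3 \<le> length xs"
  shows "\<exists>x\<in>set xs. hd xs < x \<and> x < last xs"
proof -
  have so: "sorted_wrt (<) xs" using assms by (simp add: grid_lines_def)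
  have hl: "hd xs = xs ! 0" "last xs = xs ! (length xs - 1)"
  proof -
    have "xs \<noteq> []" using assms(2) by auto
    then show "hd xs = xs ! 0" "last xs = xs ! (length xs - 1)" by (simp_all add: hd_conv_nth last_conv_nth)
  qed
  show ?thesis
    unfolding hl using sorted_wrt_nth_less[OF so, of 0 1] sorted_wrt_nth_less[OF so, of 1 "length xs - 1"] assms(2)
    by (intro bexI[of _ "xs ! 1"]) auto
qed

text \<open>Stopping the process at level \<open>N\<close> makes \<open>S k\<close> a set of cells of level \<open>k\<close> for all \<open>k\<close>.\<close>

definition truncated :: "(nat \<Rightarrow> cell set) \<Rightarrow> nat \<Rightarrow> nat \<Rightarrow> cell set" where
  "truncated S N k = (if k < N then S k else {})"

lemma level_cells_truncated: "k \<le> N \<Longrightarrow> level_cells xs ys (truncated S N) k = level_cells xs ys S k"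
  by (induction k) (auto simp: truncated_def)

lemma level_mesh_truncated: "k \<le> N \<Longrightarrow> level_mesh xs ys (truncated S N) k = level_mesh xs ys S k"
  by (induction k) (auto simp: truncated_def)

definition axis :: "'a \<Rightarrow> 'a \<Rightarrow> bool \<Rightarrow> 'a" where
  "axis x y d = (if d then x else y)"

lemma tensor_mesh_axis:
  "sorted_wrt (<) xs \<Longrightarrow> sorted_wrt (<) ys \<Longrightarrow> tensor_mesh xs ys = grid (\<lambda>d. set (axis xs ys d))"
  using tensor_mesh_grid[of xs ys] unfolding axis_def by (simp add: if_distrib)

lemma truncated_process:
  assumes "subdivision_process xs ys S N"
  shows "truncated S N k \<subseteq> level_cells xs ys (truncated S N) k" "finite (truncated S N k)"
    "finite (level_cells xs ys (truncated S N) k)"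
proof -
  have gl: "grid_lines xs" "grid_lines ys" and S: "\<And>k. k < N \<Longrightarrow> S k \<subseteq> level_cells xs ys S k"
    using assms by (auto simp: subdivision_process_def)
  have sub: "truncated S N k \<subseteq> level_cells xs ys (truncated S N) k" for k
  proof (cases "k < N")
    case True
    then show ?thesis using S[OF True] level_cells_truncated[of k N xs ys S] by (simp add: truncated_def)
  qed (simp add: truncated_def)
  then show "truncated S N k \<subseteq> level_cells xs ys (truncated S N) k" .
  have fin: "finite (level_cells xs ys (truncated S N) k)" for k
  proof (induction k)
    case 0
    have "finite (grid (\<lambda>d. set (axis xs ys d)))" by (rule finite_grid) simp
    then show ?case using tensor_mesh_axis grid_lines_facts(1) gl by simp
  next
    case (Suc k)
    then have "finite (truncated S N k)" using sub finite_subset by blast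
    then show ?case using finite_subcells by simp
  qed
  then show "finite (level_cells xs ys (truncated S N) k)" .
  show "finite (truncated S N k)" using sub fin finite_subset by blast
qed

lemma process_axioms:
  assumes p: "subdivision_process xs ys S N"
    and F: "\<And>d. finite (F d)" "\<And>d. F d \<inter> {hd (axis xs ys d)..last (axis xs ys d)} = set (axis xs ys d)"
      "\<And>d. A d \<in> F d" "\<And>d. B d \<in> F d" "\<And>d. F d \<subseteq> {A d..B d}" "\<And>d. \<exists>x\<in>F d. A d < x \<and> x < B d"
  shows "mesh_process F (\<lambda>d. set (axis xs ys d)) A B (\<lambda>d. hd (axis xs ys d)) (\<lambda>d. last (axis xs ys d))
    (level_cells xs ys (truncated S N)) (truncated S N) (level_mesh xs ys (truncated S N))"
proof -
  have gl: "grid_lines xs" "grid_lines ys" using p by (auto simp: subdivision_process_def)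
  then have gl': "grid_lines (axis xs ys d)" for d unfolding axis_def by simp
  note lf = grid_lines_facts[OF gl']
  have grid0: "tensor_mesh xs ys = grid (\<lambda>d. set (axis xs ys d))"
    using tensor_mesh_axis grid_lines_facts(1) gl by blast
  show ?thesis
  proof
    fix d k and c :: cell
    show "finite (F d)" "A d \<in> F d" "B d \<in> F d" "F d \<subseteq> {A d..B d}" "\<exists>x\<in>F d. A d < x \<and> x < B d"
      "F d \<inter> {hd (axis xs ys d)..last (axis xs ys d)} = set (axis xs ys d)" using F by auto
    show "hd (axis xs ys d) < last (axis xs ys d)" by (rule lf)
    show "hd (axis xs ys d) \<in> F d" "last (axis xs ys d) \<in> F d" using F(2)[of d] lf(2,3)[of d] by auto
    show "gap (set (axis xs ys d)) (lo d c) (hi d c)" if "c \<in> level_cells xs ys (truncated S N) 0"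
      using that unfolding level_cells.simps grid0 grid_def by simp
    show "level_cells xs ys (truncated S N) (Suc k) = (\<Union>c\<in>truncated S N k. subcells c)" by simp
    show "truncated S N k \<subseteq> level_cells xs ys (truncated S N) k" "finite (truncated S N k)"
      using truncated_process[OF p] by auto
    show "level_mesh xs ys (truncated S N) 0 = grid (\<lambda>d. set (axis xs ys d))"
      "level_cells xs ys (truncated S N) 0 = grid (\<lambda>d. set (axis xs ys d))" using grid0 by simp_all
    show "level_mesh xs ys (truncated S N) (Suc k) = level_mesh xs ys (truncated S N) k - truncated S N k \<union>
      (\<Union>c\<in>truncated S N k. subcells c)" by simp
  qed
qed

lemma classical_case:
  assumes p: "subdivision_process xs ys S N" and len: "3 \<le> length xs" "3 \<le> length ys"
  shows "int (card (crossing_vertices (level_mesh xs ys S N))) - int (card (interior_l_edges (level_mesh xs ys S N))) +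
    int (1 + (\<Sum>k<N. card (isolated_cells xs ys S k))) = int (card (cvr_cells (level_mesh xs ys S N)))"
proof -
  have gl: "grid_lines xs" "grid_lines ys" using p by (auto simp: subdivision_process_def)
  have gl': "grid_lines (axis xs ys d)" "3 \<le> length (axis xs ys d)" for d using gl len unfolding axis_def by auto
  note lf = grid_lines_facts[OF gl'(1)]
  have "mesh_process (\<lambda>d. set (axis xs ys d)) (\<lambda>d. set (axis xs ys d)) (\<lambda>d. hd (axis xs ys d)) (\<lambda>d. last (axis xs ys d))
      (\<lambda>d. hd (axis xs ys d)) (\<lambda>d. last (axis xs ys d))
    (level_cells xs ys (truncated S N)) (truncated S N) (level_mesh xs ys (truncated S N))"
  proof (rule process_axioms[OF p])
    fix d
    show "set (axis xs ys d) \<inter> {hd (axis xs ys d)..last (axis xs ys d)} = set (axis xs ys d)"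
      using lf(5)[of d] by blast
  qed (simp_all add: lf(2,3,5) inner_grid_line[OF gl'])
  then interpret classical_process "\<lambda>d. set (axis xs ys d)" "\<lambda>d. set (axis xs ys d)" "\<lambda>d. hd (axis xs ys d)" "\<lambda>d. last (axis xs ys d)"
      "\<lambda>d. hd (axis xs ys d)" "\<lambda>d. last (axis xs ys d)"
    "level_cells xs ys (truncated S N)" "truncated S N" "level_mesh xs ys (truncated S N)"
    by (intro classical_process.intro classical_process_axioms.intro) simp_all
  have "isolated k = isolated_cells xs ys S k" if "k < N" for k
    unfolding classical_isolated isolated_cells_def
    using that level_cells_truncated[of k N xs ys S] level_mesh_truncated[of "Suc k" N xs ys S]
    by (simp add: truncated_def del: level_mesh.simps)
  then show ?thesis using classical_Euler[of N] level_mesh_truncated[of N N xs ys S] by simp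
qed

lemma six_list:
  assumes "length u = 6"
  obtains a0 a1 a2 a3 a4 a5 where "u = [a0, a1, a2, a3, a4, a5]"
  using assms by (auto simp: numeral_eq_Suc length_Suc_conv)

lemma frame_list_facts:
  assumes "length u = 6" "sorted_wrt (<) (u :: real list)"
  shows "u ! 0 \<in> set (take 3 u)" "u ! 2 \<in> set (take 3 u)" "u ! 0 < u ! 2" "set (take 3 u) \<subseteq> {u ! 0..u ! 2}"
    "u ! 3 \<in> set (drop 3 u)" "u ! 5 \<in> set (drop 3 u)" "u ! 3 < u ! 5" "set (drop 3 u) \<subseteq> {u ! 3..u ! 5}"
    "u ! 2 < u ! 3" "sorted_wrt (<) (take 3 u)" "sorted_wrt (<) (drop 3 u)"
  by (rule six_list[OF assms(1)]; use assms(2) in \<open>auto simp: numeral_eq_Suc\<close>)+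

lemma extended_case:
  assumes p: "subdivision_process xs ys S N" and fr: "extension_frame u v xs ys"
  defines "M \<equiv> extension u v (level_mesh xs ys S N)"
  shows "int (card (crossing_vertices M)) - int (card (interior_l_edges M)) +
    int (1 + (\<Sum>k<N. card (isolated_cells_ext u v xs ys S k))) = int (card (cvr_cells M))"
proof -
  have gl: "grid_lines xs" "grid_lines ys" using p by (auto simp: subdivision_process_def)
  have gl': "grid_lines (axis xs ys d)" for d using gl unfolding axis_def by auto
  note lf = grid_lines_facts[OF gl']
  have U: "length (axis u v d) = 6" "sorted_wrt (<) (axis u v d)" "axis u v d ! 2 = hd (axis xs ys d)" "axis u v d ! 3 = last (axis xs ys d)" for d
    using fr unfolding extension_frame_def axis_def by auto
  note uf = frame_list_facts[OF U(1,2)]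
  define P where "P d s = set (if s then drop 3 (axis u v d) else take 3 (axis u v d))" for d s
  define F where "F d = P d False \<union> set (axis xs ys d) \<union> P d True" for d
  define A where "A d = axis u v d ! 0" for d
  define B where "B d = axis u v d ! 5" for d
  have P: "A d \<in> P d False" "hd (axis xs ys d) \<in> P d False" "A d < hd (axis xs ys d)"
      "P d False \<subseteq> {A d..hd (axis xs ys d)}"
      "last (axis xs ys d) \<in> P d True" "B d \<in> P d True" "last (axis xs ys d) < B d"
      "P d True \<subseteq> {last (axis xs ys d)..B d}" for d
    unfolding P_def A_def B_def using uf(1-8)[of d] unfolding U(3,4)[of d] by simp_all
  have mp: "mesh_process F (\<lambda>d. set (axis xs ys d)) A B (\<lambda>d. hd (axis xs ys d)) (\<lambda>d. last (axis xs ys d))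
    (level_cells xs ys (truncated S N)) (truncated S N) (level_mesh xs ys (truncated S N))"
  proof (rule process_axioms[OF p])
    fix d
    let ?h = "hd (axis xs ys d)" and ?l = "last (axis xs ys d)"
    have Pd: "\<And>x. x \<in> P d False \<Longrightarrow> A d \<le> x \<and> x \<le> ?h" "\<And>x. x \<in> P d True \<Longrightarrow> ?l \<le> x \<and> x \<le> B d"
      "\<And>x. x \<in> set (axis xs ys d) \<Longrightarrow> ?h \<le> x \<and> x \<le> ?l"
      using subsetD[OF P(4)[of d]] subsetD[OF P(8)[of d]] subsetD[OF lf(5)[of d]] by auto
    show "finite (F d)" unfolding F_def P_def by simp
    show "F d \<inter> {?h..?l} = set (axis xs ys d)"
    proof (intro equalityI subsetI)
      fix x assume x: "x \<in> F d \<inter> {?h..?l}"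
      then consider "x \<in> P d False" | "x \<in> set (axis xs ys d)" | "x \<in> P d True" unfolding F_def by blast
      then show "x \<in> set (axis xs ys d)"
      proof cases
        case 1
        then have "x = ?h" using Pd(1)[of x] x by simp
        then show ?thesis using lf(2) by simp
      next
        case 3
        then have "x = ?l" using Pd(2)[of x] x by simp
        then show ?thesis using lf(3) by simp
      qed
    next
      fix x assume "x \<in> set (axis xs ys d)"
      then show "x \<in> F d \<inter> {?h..?l}" using Pd(3)[of x] unfolding F_def by simp
    qed
    show "A d \<in> F d" "B d \<in> F d" unfolding F_def using P(1,6)[of d] by simp_all
    show "F d \<subseteq> {A d..B d}"
    proof
      fix x assume "x \<in> F d"
      then consider "x \<in> P d False" | "x \<in> set (axis xs ys d)" | "x \<in> P d True" unfolding F_def by blast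
      then show "x \<in> {A d..B d}"
        by cases (use Pd[of x] P(3,7)[of d] lf(4)[of d] in simp_all)
    qed
    have "?h \<in> F d" unfolding F_def using P(2)[of d] by simp
    then show "\<exists>x\<in>F d. A d < x \<and> x < B d"
      using P(3,7)[of d] lf(4)[of d] by (intro bexI[of _ ?h]) simp_all
  qed
  interpret extended_process F "\<lambda>d. set (axis xs ys d)" A B "\<lambda>d. hd (axis xs ys d)" "\<lambda>d. last (axis xs ys d)"
    "level_cells xs ys (truncated S N)" "truncated S N" "level_mesh xs ys (truncated S N)" P
  proof (intro extended_process.intro mp extended_process_axioms.intro)
    fix d s
    show "finite (P d s)" unfolding P_def by simp
    show "F d = P d False \<union> set (axis xs ys d) \<union> P d True" by (rule F_def)
  qed (rule P)+
  have ext_eq: "ext k = extension u v (level_mesh xs ys S k)" if "k \<le> N" for k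
  proof -
    have T: "level_mesh xs ys (truncated S N) k = level_mesh xs ys S k" using level_mesh_truncated[OF that] .
    define PL where "PL d s = (if s then drop 3 (axis u v d) else take 3 (axis u v d))" for d s
    have PL: "sorted_wrt (<) (PL d s)" "set (PL d s) = P d s" for d s
      unfolding PL_def P_def using uf(10,11)[of d] by simp_all
    define WL where "WL d s = sorted_list_of_set (W k d s)" for d s
    have WL: "sorted_wrt (<) (WL d s)" "set (WL d s) = W k d s" for d s
      unfolding WL_def using W_facts(1)[of k d s] by simp_all
    have corner: "(\<Union>\<sigma>. corner_block \<sigma>) = (\<Union>s. \<Union>t. tensor_mesh (PL True s) (PL False t))"
    proof -
      have "corner_block \<sigma> = tensor_mesh (PL True (\<sigma> True)) (PL False (\<sigma> False))" for \<sigma>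
        unfolding corner_block_def tensor_mesh_grid[OF PL(1) PL(1)] PL(2)
        by (rule arg_cong[of _ _ grid]) (auto simp: fun_eq_iff)
      moreover have "\<exists>\<sigma>. s = \<sigma> True \<and> t = \<sigma> False" for s t :: bool
        by (rule exI[of _ "\<lambda>d. if d then s else t"]) simp
      ultimately show ?thesis by (intro equalityI subsetI; clarsimp) (blast, metis)
    qed
    have sideT: "side_block k True s = tensor_mesh (WL True s) (PL False s)" for s
      unfolding side_block_def tensor_mesh_grid[OF WL(1) PL(1)] PL(2) WL(2)
      by (rule arg_cong[of _ _ grid]) (auto simp: fun_eq_iff)
    have sideF: "side_block k False s = tensor_mesh (PL True s) (WL False s)" for s
      unfolding side_block_def tensor_mesh_grid[OF PL(1) WL(1)] PL(2) WL(2)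
      by (rule arg_cong[of _ _ grid]) (auto simp: fun_eq_iff)
    have W: "W k True s = {x. (x, v ! (if s then 3 else 2)) \<in> vertices (level_mesh xs ys S k)}"
      "W k False s = {y. (u ! (if s then 3 else 2), y) \<in> vertices (level_mesh xs ys S k)}" for s
      unfolding W_def border_def T using U(3,4)[of True] U(3,4)[of False] by (auto simp: mk_def axis_def)
    have PLv: "PL True False = take 3 u" "PL True True = drop 3 u" "PL False False = take 3 v" "PL False True = drop 3 v"
      unfolding PL_def axis_def by simp_all
    have "(\<Union>d. \<Union>s. side_block k d s) =
        (\<Union>s. tensor_mesh (WL True s) (PL False s)) \<union> (\<Union>s. tensor_mesh (PL True s) (WL False s))"
      unfolding sideT[symmetric] sideF[symmetric] by (simp add: UNIV_bool Un_ac)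
    then have "ext k = level_mesh xs ys S k \<union> (\<Union>s. \<Union>t. tensor_mesh (PL True s) (PL False t)) \<union>
        ((\<Union>s. tensor_mesh (WL True s) (PL False s)) \<union> (\<Union>s. tensor_mesh (PL True s) (WL False s)))"
      unfolding ext_def T corner by simp
    then show ?thesis
      unfolding extension_def WL_def W by (simp add: UNIV_bool PLv Un_ac)
  qed
  have "isolated k = isolated_cells_ext u v xs ys S k" if "k < N" for k
    unfolding extended_isolated isolated_cells_ext_def
    using that level_cells_truncated[of k N xs ys S] level_mesh_truncated[of k N xs ys S] ext_eq[of k] ext_eq[of "Suc k"]
    by (simp add: truncated_def del: level_mesh.simps)
  then show ?thesis using extended_Euler[of N] ext_eq[of N] unfolding M_def by simp
qed

theorem theorem5p14:
  fixes T :: "cell set" and i :: nat and \<delta> :: int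
  assumes "hierarchical_T_mesh T i"
    and "int i = \<delta> - 1"
  shows "int (card (crossing_vertices T)) - int (card (interior_l_edges T)) + \<delta>
       = int (card (cvr_cells T))"
proof -
  have "int (card (crossing_vertices T)) - int (card (interior_l_edges T)) + int (1 + i) = int (card (cvr_cells T))"
    using assms(1)
  proof cases
    case (classical xs ys S N)
    then show ?thesis using classical_case[of xs ys S N] by simp
  next
    case (extended xs ys S N u v)
    then show ?thesis using extended_case[of xs ys S N u v] by simp
  qed
  then show ?thesis using assms(2) by simp
qed

end
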